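(* There exist universal constants $C,c>0$ such that the following holds. Let $n\geq 1$, $N\geq n$, and let $G_0,\dots,G_N$ be independent standard gaussian vectors in $\mathbb{R}^n$. Denote $$\mathcal K=\mathrm{conv}\{G_0,\dots,G_N\}\quad\text{and}\quad \mathcal T=\mathrm{conv}\{\pm G_1,\dots,\pm G_N\}.$$ Then, with probability greater than $1-Ce^{-cn}$, $$L_{\mathcal K}<C\quad\text{and}\quad L_{\mathcal T}<C.$$
   Context: A standard gaussian vector in $\mathbb{R}^n$ is a random vector whose coordinates are independent standard normal random variables; $\mathrm{conv}$ denotes convex hull. For a convex body $\mathcal K\subset\mathbb{R}^n$ (compact convex set with nonempty interior), the isotropic constant $L_{\mathcal K}$ is defined by $$nL_{\mathcal K}^2=\inf_{T}\frac{1}{\mathrm{vol}_n(\mathcal K)^{1+2/n}}\int_{\mathcal K}|Tx|^2\,dx,$$ where the infimum runs over all volume-preserving affine maps $T:\mathbb{R}^n\to\mathbb{R}^n$ and $|\cdot|$ is the Euclidean norm. Universal constants are independent of $n$, $N$. *)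

theory Defs
  imports "HOL-Probability.Probability"
begin

text \<open>Euclidean space R^n is modelled by extensional functions in PiE {..<n} UNIV
  (coordinates 0..n-1); Lebesgue(-Borel) measure is the product of lborel.\<close>

definition lebesgue_n :: "nat \<Rightarrow> (nat \<Rightarrow> real) measure" where
  "lebesgue_n n = PiM {..<n} (\<lambda>_. lborel)"

definition vneg :: "nat \<Rightarrow> (nat \<Rightarrow> real) \<Rightarrow> (nat \<Rightarrow> real)" where
  "vneg n x = restrict (\<lambda>k. - x k) {..<n}"

definition conv_n :: "nat \<Rightarrow> (nat \<Rightarrow> real) set \<Rightarrow> (nat \<Rightarrow> real) set" where
  "conv_n n S = \<Inter>{C. S \<subseteq> C \<and> C \<subseteq> PiE {..<n} (\<lambda>_. UNIV) \<and>
      (\<forall>x\<in>C. \<forall>y\<in>C. \<forall>t\<in>{0..1::real}. restrict (\<lambda>k. (1 - t) * x k + t * y k) {..<n} \<in> C)}"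

definition det_n :: "nat \<Rightarrow> (nat \<Rightarrow> nat \<Rightarrow> real) \<Rightarrow> real" where
  "det_n n A = (\<Sum>p | p permutes {..<n}. of_int (sign p) * (\<Prod>i<n. A i (p i)))"

definition aff_n :: "nat \<Rightarrow> (nat \<Rightarrow> nat \<Rightarrow> real) \<Rightarrow> (nat \<Rightarrow> real) \<Rightarrow> (nat \<Rightarrow> real) \<Rightarrow> (nat \<Rightarrow> real)" where
  "aff_n n A b x = restrict (\<lambda>i. (\<Sum>j<n. A i j * x j) + b i) {..<n}"

definition sqnorm_n :: "nat \<Rightarrow> (nat \<Rightarrow> real) \<Rightarrow> real" where
  "sqnorm_n n x = (\<Sum>i<n. (x i)\<^sup>2)"

definition isotropic_const :: "nat \<Rightarrow> (nat \<Rightarrow> real) set \<Rightarrow> real" where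
  "isotropic_const n K = sqrt ((INF Ab \<in> {(A, b). \<bar>det_n n A\<bar> = 1}.
      (LINT x:K|lebesgue_n n. sqnorm_n n (aff_n n (fst Ab) (snd Ab) x))
        / measure (lebesgue_n n) K powr (1 + 2 / real n)) / real n)"

text \<open>Joint law of N+1 independent standard gaussian vectors G_0..G_N in R^n:
  the sample point \<omega> has G_i = \<omega> i.\<close>
definition gauss_space :: "nat \<Rightarrow> nat \<Rightarrow> (nat \<Rightarrow> nat \<Rightarrow> real) measure" where
  "gauss_space n N = PiM {..N} (\<lambda>_. PiM {..<n} (\<lambda>_. density lborel std_normal_density))"

end

theory Submission
  imports Defs
begin

text \<open>
  Taking the identity for \<open>T\<close>, it suffices to bound the mean of \<open>|x|\<^sup>2\<close> over the body by a multiple of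
  \<open>log (2 N / n)\<close> and its volume from below by \<open>(c log (2 N / n) / n) ^ (n / 2)\<close>.

  For the mean, the body is triangulated without new vertices. The mean over one simplex is
  \<open>(|\<Sum>p|\<^sup>2 + \<Sum>|p|\<^sup>2) / ((n + 1) (n + 2))\<close>, the sums running over its vertices, and a union bound over all
  choices of \<open>n + 1\<close> sample points controls these quantities simultaneously.

  For the volume with \<open>N \<ge> C n\<close>, every fixed point \<open>x\<close> with \<open>|x|\<^sup>2 \<le> log (N / n) / 2\<close> lies in the hull with
  probability \<open>1 - e\<^bsup>-c n\<^esup>\<close>: by Wendel's symmetry argument, applied to the projections orthogonal to \<open>x\<close> of the
  samples on either side of \<open>x\<close>, the hull meets the ray through \<open>x\<close> both before and after \<open>x\<close>. Markov's
  inequality then shows that the hull fills half of a cube.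

  For \<open>n \<le> N < C n\<close>, a single simplex is large enough. Its edge matrix \<open>H\<close> satisfies
  \<open>vol (Q \<inter> H A) = |det H| vol {\<lambda> \<in> A. H \<lambda> \<in> Q}\<close> for the unit cube \<open>Q\<close> and a large cube \<open>A\<close>. The expected volume on
  the right is small because \<open>H \<lambda>\<close> has density at most \<open>|\<lambda>|\<^bsup>-n\<^esup>\<close>, while \<open>H A\<close> covers most of \<open>Q\<close>.
\<close>

section \<open>Linear systems and sign patterns\<close>

text \<open>If M bounds the mean of |x|^2 and V^n bounds the volume from below, the squared
  isotropic constant is at most M / (n V^2), so the logarithms cancel. Two regimes are forced: the
  symmetry argument pays a factor 2^n, hence needs many times n samples beyond x, which fails for N
  near n. There log (2 N / n) is of order one, and volume (c / sqrt n)^n is enough. The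
  triangulation uses no new vertices because only sums of sample points are under control; it
  consists of the lower faces of the points lifted to generic heights, so the points themselves, in
  particular pairs of opposite ones, may be in any position. Likewise sign patterns are counted by
  shattering, which tolerates degenerate positions. The integral of |\<lambda>|^(-n) diverges
  logarithmically at both ends; near 0 the trivial bound 1 for a probability is used, and a cube of
  size exponential in n leaves O(n) dyadic shells of equal contribution, which costs only a factor
  c^n. Determinants are never computed: a linear map rescales volume by some constant, which either
  cancels or is itself estimated.\<close>

definition lincomb :: "nat \<Rightarrow> 'i set \<Rightarrow> ('i \<Rightarrow> real) \<Rightarrow> ('i \<Rightarrow> nat \<Rightarrow> real) \<Rightarrow> (nat \<Rightarrow> real)" where
  "lincomb n I c v = (\<lambda>k\<in>{..<n}. \<Sum>i\<in>I. c i * v i k)"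

definition dot :: "nat \<Rightarrow> (nat \<Rightarrow> real) \<Rightarrow> (nat \<Rightarrow> real) \<Rightarrow> real" where
  "dot n u v = (\<Sum>k<n. u k * v k)"

text \<open>Gaussian elimination, one equation at a time. This is the only tool from linear algebra:
  normal vectors, affine relations and coordinates with respect to a basis are all obtained from
  it.\<close>

lemma homogeneous_system_nontrivial:
  fixes a :: "'i \<Rightarrow> 'e \<Rightarrow> real"
  assumes "finite E" "finite I" "card E < card I"
  shows "\<exists>c. (\<exists>i\<in>I. c i \<noteq> 0) \<and> (\<forall>e\<in>E. (\<Sum>i\<in>I. c i * a i e) = 0)"
  using assms
proof (induction E arbitrary: I a rule: finite_induct)
  case empty
  then obtain i where "i \<in> I" by fastforce
  then show ?case by (intro exI[of _ "\<lambda>_. 1"]) auto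
next
  case (insert e E)
  show ?case
  proof (cases "\<forall>i\<in>I. a i e = 0")
    case True
    obtain c where "\<exists>i\<in>I. c i \<noteq> 0" "\<forall>e\<in>E. (\<Sum>i\<in>I. c i * a i e) = 0"
      using insert.IH[of I a] insert.prems insert.hyps by auto
    then show ?thesis using True by (intro exI[of _ c]) auto
  next
    case False
    then obtain j where j: "j \<in> I" "a j e \<noteq> 0" by auto
    define J where "J = I - {j}"
    have J: "finite J" "j \<notin> J" "I = insert j J" "card E < card J"
      using insert.prems insert.hyps j by (auto simp: J_def)
    obtain c where c: "\<exists>i\<in>J. c i \<noteq> 0"
      "\<forall>f\<in>E. (\<Sum>i\<in>J. c i * (a i f - a i e / a j e * a j f)) = 0"
      using insert.IH[of J "\<lambda>i f. a i f - a i e / a j e * a j f"] J by blast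
    \<comment> \<open>The pivot \<open>j\<close> was eliminated from the other equations; its
      coefficient is now chosen so that equation \<open>e\<close> holds.\<close>
    define s where "s = (\<Sum>i\<in>J. c i * a i e)"
    define d where "d = c(j := - s / a j e)"
    have sumd: "(\<Sum>i\<in>I. d i * a i f) = - s / a j e * a j f + (\<Sum>i\<in>J. c i * a i f)" for f
      using J by (auto simp: d_def intro!: sum.cong)
    have "(\<Sum>i\<in>I. d i * a i f) = 0" if "f \<in> E" for f
    proof -
      have "0 = (\<Sum>i\<in>J. c i * (a i f - a i e / a j e * a j f))" using c that by simp
      also have "\<dots> = (\<Sum>i\<in>J. c i * a i f) - s / a j e * a j f"
        by (simp add: s_def sum_subtractf algebra_simps sum_distrib_left sum_divide_distrib)
      finally show ?thesis unfolding sumd by simp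
    qed
    moreover have "(\<Sum>i\<in>I. d i * a i e) = 0" unfolding sumd using j by (simp add: s_def)
    moreover have "\<exists>i\<in>I. d i \<noteq> 0" using c J by (auto simp: d_def)
    ultimately show ?thesis by blast
  qed
qed

section \<open>Shattered sets and half-space patterns\<close>

lemma inj_on_insert_Pow:
  assumes "x \<notin> J"
  shows "inj_on (insert x) (Pow J)"
proof (rule inj_onI)
  fix A B assume "A \<in> Pow J" "B \<in> Pow J" "insert x A = insert x B"
  moreover from this have "x \<notin> A" "x \<notin> B" using assms by auto
  ultimately show "A = B" by (simp add: insert_ident)
qed

lemma sum_power_card_Pow:
  fixes x :: real
  assumes "finite J"
  shows "(\<Sum>S\<in>Pow J. x ^ card S) = (1 + x) ^ card J"
  using assms
proof (induction J rule: finite_induct)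
  case (insert j J)
  have "(\<Sum>S\<in>Pow (insert j J). x ^ card S)
      = (\<Sum>S\<in>Pow J. x ^ card S) + (\<Sum>S\<in>insert j ` Pow J. x ^ card S)"
    unfolding Pow_insert using insert by (intro sum.union_disjoint) auto
  also have "(\<Sum>S\<in>insert j ` Pow J. x ^ card S) = (\<Sum>S\<in>Pow J. x * x ^ card S)"
  proof (subst sum.reindex)
    show "inj_on (insert j) (Pow J)"
      using insert.hyps(2) by (rule inj_on_insert_Pow)
    have "card (insert j S) = Suc (card S)" if "S \<subseteq> J" for S
      using that insert by (meson card_insert_disjoint finite_subset in_mono)
    then show "sum ((\<lambda>S. x ^ card S) \<circ> insert j) (Pow J) = (\<Sum>S\<in>Pow J. x * x ^ card S)"
      by (auto intro!: sum.cong)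
  qed
  finally show ?case using insert by (simp add: sum_distrib_left[symmetric] algebra_simps)
qed simp

text \<open>Exponential weighting: for x \<le> 1 a subset of size at most m has weight x ^
  \<open>card S\<close> at least x ^ m, and all weights together sum to (1 + x) ^
  \<open>card J\<close>.\<close>

lemma card_small_subsets_le:
  fixes x :: real
  assumes "finite J" "0 < x" "x \<le> 1"
  shows "real (card {S. S \<subseteq> J \<and> card S \<le> m}) \<le> (1 + x) ^ card J / x ^ m"
proof -
  have "x ^ m * real (card {S. S \<subseteq> J \<and> card S \<le> m}) = (\<Sum>S | S \<subseteq> J \<and> card S \<le> m. x ^ m)" by simp
  also have "\<dots> \<le> (\<Sum>S | S \<subseteq> J \<and> card S \<le> m. x ^ card S)"
    using assms by (intro sum_mono power_decreasing) auto
  also have "\<dots> \<le> (\<Sum>S\<in>Pow J. x ^ card S)"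
    using assms by (intro sum_mono2) auto
  also have "\<dots> = (1 + x) ^ card J" using assms by (simp add: sum_power_card_Pow)
  finally show ?thesis using assms by (simp add: field_simps)
qed

text \<open>Pajor's form of the Sauer-Shelah lemma. Split the family by membership of x, with x
  deleted, into \<open>F0\<close> and \<open>F1\<close>. Sets shattered by the union are shattered
  by the family, and for sets shattered by the intersection so is the set with x added; these two
  kinds are disjoint, and the two cardinalities add up.\<close>

lemma card_le_card_shattered:
  assumes "finite J" "F \<subseteq> Pow J"
  shows "card F \<le> card {S. S \<subseteq> J \<and> (\<lambda>A. A \<inter> S) ` F = Pow S}"
  using assms
proof (induction J arbitrary: F rule: finite_induct)
  case empty
  show ?case
  proof (cases "F = {}")
    case False
    then have F: "F = {{}}" using empty by auto
    have eq: "{S. S \<subseteq> {} \<and> (\<lambda>A. A \<inter> S) ` {{}} = Pow S} = {{}}" by auto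
    show ?thesis unfolding F eq by simp
  qed simp
next
  case (insert x J)
  define F0 where "F0 = {A. A \<subseteq> J \<and> A \<in> F}"
  define F1 where "F1 = {A. A \<subseteq> J \<and> insert x A \<in> F}"
  define sh where "sh = (\<lambda>J F. {S::'a set. S \<subseteq> J \<and> (\<lambda>A. A \<inter> S) ` F = Pow S})"
  have fin: "finite F0" "finite F1" using insert by (auto simp: F0_def F1_def)
  have injP: "inj_on (insert x) (Pow J)"
    using insert.hyps(2) by (rule inj_on_insert_Pow)
  then have inj: "inj_on (insert x) F1" by (rule inj_on_subset) (auto simp: F1_def)
  have F: "F = F0 \<union> insert x ` F1"
  proof (intro equalityI subsetI)
    fix A assume A: "A \<in> F"
    show "A \<in> F0 \<union> insert x ` F1"
    proof (cases "x \<in> A")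
      case True
      then have "insert x (A - {x}) = A" by auto
      moreover have "A - {x} \<subseteq> J" using insert A by auto
      ultimately show ?thesis using A unfolding F1_def by (auto intro!: image_eqI[of A _ "A - {x}"])
    next
      case False then show ?thesis using A insert by (auto simp: F0_def)
    qed
  qed (auto simp: F0_def F1_def)
  have "card F = card F0 + card F1"
    unfolding F using insert fin inj
    by (subst card_Un_disjoint) (auto simp: card_image F0_def)
  also have "\<dots> = card (F0 \<union> F1) + card (F0 \<inter> F1)" using fin by (rule card_Un_Int)
  also have "\<dots> \<le> card (sh J (F0 \<union> F1)) + card (sh J (F0 \<inter> F1))"
    unfolding sh_def using insert by (intro add_mono insert.IH) (auto simp: F0_def F1_def)
  also have "card (sh J (F0 \<inter> F1)) = card (insert x ` sh J (F0 \<inter> F1))"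
    by (intro card_image[symmetric] inj_on_subset[OF injP]) (simp add: sh_def subset_iff)
  also have "card (sh J (F0 \<union> F1)) + \<dots> = card (sh J (F0 \<union> F1) \<union> insert x ` sh J (F0 \<inter> F1))"
  proof (intro card_Un_disjoint[symmetric])
    show "sh J (F0 \<union> F1) \<inter> insert x ` sh J (F0 \<inter> F1) = {}" using insert.hyps unfolding sh_def by blast
  qed (use insert.hyps in \<open>simp_all add: sh_def\<close>)
  also have "\<dots> \<le> card (sh (insert x J) F)"
  proof (intro card_mono)
    show "finite (sh (insert x J) F)" using insert by (simp add: sh_def)
    show "sh J (F0 \<union> F1) \<union> insert x ` sh J (F0 \<inter> F1) \<subseteq> sh (insert x J) F"
    proof (intro Un_least subsetI)
      fix S assume S: "S \<in> sh J (F0 \<union> F1)"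
      then have SJ: "S \<subseteq> J" and eq: "(\<lambda>A. A \<inter> S) ` (F0 \<union> F1) = Pow S" by (simp_all add: sh_def)
      have "D \<in> (\<lambda>A. A \<inter> S) ` F" if "D \<subseteq> S" for D
      proof -
        have "D \<in> (\<lambda>A. A \<inter> S) ` (F0 \<union> F1)" using that unfolding eq by simp
        then obtain A where "A \<in> F0 \<union> F1" "D = A \<inter> S" by (elim imageE)
        moreover have "insert x A \<inter> S = A \<inter> S" using SJ insert.hyps by auto
        moreover have "A \<in> F \<or> insert x A \<in> F" using \<open>A \<in> F0 \<union> F1\<close> unfolding F by blast
        ultimately show ?thesis by blast
      qed
      then have "(\<lambda>A. A \<inter> S) ` F = Pow S" by blast
      then show "S \<in> sh (insert x J) F" using SJ unfolding sh_def by blast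
    next
      fix S' assume "S' \<in> insert x ` sh J (F0 \<inter> F1)"
      then obtain S where S': "S' = insert x S" and SJ: "S \<subseteq> J"
        and eq: "(\<lambda>A. A \<inter> S) ` (F0 \<inter> F1) = Pow S" unfolding sh_def by blast
      have "D \<in> (\<lambda>A. A \<inter> S') ` F" if "D \<subseteq> S'" for D
      proof -
        have "D - {x} \<in> Pow S" using that S' by auto
        then have "D - {x} \<in> (\<lambda>A. A \<inter> S) ` (F0 \<inter> F1)" unfolding eq .
        then obtain A where A: "A \<in> F0" "A \<in> F1" "D - {x} = A \<inter> S" by (elim imageE IntE)
        have xA: "x \<notin> A" using A insert.hyps by (auto simp: F0_def)
        show ?thesis
        proof (cases "x \<in> D")
          case True
          then have "D = insert x A \<inter> S'" using A S' by blast
          then show ?thesis using A unfolding F by blast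
        next
          case False
          then have "D = A \<inter> S'" using A S' xA by blast
          then show ?thesis using A unfolding F by blast
        qed
      qed
      then have "(\<lambda>A. A \<inter> S') ` F = Pow S'" by blast
      then show "S' \<in> sh (insert x J) F" using SJ S' unfolding sh_def by blast
    qed
  qed
  finally show ?case by (simp add: sh_def)
qed

text \<open>More than n vectors are linearly dependent, so half-spaces through the origin cannot
  shatter them, and only sets of size at most n are shattered. Against all 2 ^ \<open>card J\<close>
  patterns this gains (3 / 4) ^ \<open>card J\<close> at the price 2 ^ n.\<close>

lemma card_halfspace_patterns_le:
  fixes v :: "'i \<Rightarrow> nat \<Rightarrow> real"
  assumes J: "finite J"
  shows "real (card {D. D \<subseteq> J \<and> (\<exists>u. (\<forall>i\<in>D. dot n u (v i) < 0) \<and> (\<forall>i\<in>J - D. dot n u (v i) > 0))})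
    \<le> 2 ^ n * (3 / 2) ^ card J"
proof -
  define F where "F = {D. D \<subseteq> J \<and> (\<exists>u. (\<forall>i\<in>D. dot n u (v i) < 0) \<and> (\<forall>i\<in>J - D. dot n u (v i) > 0))}"
  have "card S \<le> n" if S: "S \<subseteq> J" "(\<lambda>A. A \<inter> S) ` F = Pow S" for S
  proof (rule ccontr)
    assume "\<not> card S \<le> n"
    then have "card {..<n} < card S" "finite S" using S J by (auto intro: finite_subset)
    then obtain c where c: "\<exists>i\<in>S. c i \<noteq> 0" "\<forall>k\<in>{..<n}. (\<Sum>i\<in>S. c i * v i k) = 0"
      using homogeneous_system_nontrivial[of "{..<n}" S v] by auto
    \<comment> \<open>The pattern to refute is the sign pattern of the linear relation itself: a
      functional u realising it makes every term with nonzero coefficient positive in a sum that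
      vanishes.\<close>
    have "{i\<in>S. c i < 0} \<in> Pow S" by auto
    then obtain D where D: "D \<in> F" "{i\<in>S. c i < 0} = D \<inter> S" unfolding S(2)[symmetric] by auto
    then obtain u where u: "\<forall>i\<in>D. dot n u (v i) < 0" "\<forall>i\<in>J - D. dot n u (v i) > 0"
      by (auto simp: F_def)
    have pos: "c i * dot n u (v i) > 0" if i: "i \<in> S" "c i \<noteq> 0" for i
    proof (cases "c i < 0")
      case True
      then have "i \<in> D" using D i by auto
      then show ?thesis using True u by (simp add: mult_neg_neg)
    next
      case False
      then have "i \<in> J - D" using D i S by auto
      moreover have "c i > 0" using False i by auto
      ultimately show ?thesis using u by (simp)
    qed
    have "0 < (\<Sum>i\<in>S. c i * dot n u (v i))"
    proof -
      obtain i where i: "i \<in> S" "c i \<noteq> 0" using c by auto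
      have "0 \<le> c j * dot n u (v j)" if "j \<in> S" for j using pos[OF that] by (cases "c j = 0") auto
      then show ?thesis using pos[OF i] i \<open>finite S\<close> by (intro sum_pos2[of S i]) auto
    qed
    also have "(\<Sum>i\<in>S. c i * dot n u (v i)) = (\<Sum>k<n. u k * (\<Sum>i\<in>S. c i * v i k))"
      unfolding dot_def sum_distrib_left by (subst sum.swap) (simp add: algebra_simps)
    also have "\<dots> = 0" using c by simp
    finally show False by simp
  qed
  then have "{S. S \<subseteq> J \<and> (\<lambda>A. A \<inter> S) ` F = Pow S} \<subseteq> {S. S \<subseteq> J \<and> card S \<le> n}" by auto
  then have "card {S. S \<subseteq> J \<and> (\<lambda>A. A \<inter> S) ` F = Pow S} \<le> card {S. S \<subseteq> J \<and> card S \<le> n}"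
    using J by (intro card_mono) auto
  then have "card F \<le> card {S. S \<subseteq> J \<and> card S \<le> n}"
    using order_trans[OF card_le_card_shattered[OF J, of F]] by (simp add: F_def subset_iff)
  then have "real (card F) \<le> real (card {S. S \<subseteq> J \<and> card S \<le> n})" by simp
  also have "\<dots> \<le> 2 ^ n * (3 / 2) ^ card J"
    using card_small_subsets_le[OF J, of "1/2" n] by (simp add: power_divide field_simps)
  finally show ?thesis unfolding F_def .
qed

section \<open>Affine independence and Caratheodory reduction\<close>

definition aff_indep :: "nat \<Rightarrow> 'i set \<Rightarrow> ('i \<Rightarrow> nat \<Rightarrow> real) \<Rightarrow> bool" where
  "aff_indep n B v \<longleftrightarrow> (\<forall>c. (\<Sum>i\<in>B. c i) = 0 \<longrightarrow> (\<forall>k<n. (\<Sum>i\<in>B. c i * v i k) = 0) \<longrightarrow> (\<forall>i\<in>B. c i = 0))"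

definition weights :: "'i set \<Rightarrow> ('i \<Rightarrow> real) set" where
  "weights I = {c. (\<forall>i\<in>I. 0 \<le> c i) \<and> (\<Sum>i\<in>I. c i) = 1}"

lemma card_aff_indep_le:
  assumes "finite B" "aff_indep n B v"
  shows "card B \<le> Suc n"
proof (rule ccontr)
  assume "\<not> card B \<le> Suc n"
  then have "card {..n} < card B" by simp
  \<comment> \<open>An additional coordinate n, constantly 1, encodes that the coefficients sum to
    zero; hence n + 1 equations.\<close>
  then obtain c where c: "\<exists>i\<in>B. c i \<noteq> 0"
    "\<forall>k\<in>{..n}. (\<Sum>i\<in>B. c i * (if k = n then 1 else v i k)) = 0"
    using homogeneous_system_nontrivial[of "{..n}" B "\<lambda>i k. if k = n then 1 else v i k"] assms by auto
  have "(\<Sum>i\<in>B. c i) = 0" using c(2)[rule_format, of n] by simp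
  moreover have "(\<Sum>i\<in>B. c i * v i k) = 0" if "k < n" for k
    using c(2)[rule_format, of k] that by simp
  ultimately show False using c assms unfolding aff_indep_def by blast
qed

lemma aff_indep_unique:
  assumes "aff_indep n B v" "(\<Sum>i\<in>B. c i) = (\<Sum>i\<in>B. d i)"
    "\<And>k. k < n \<Longrightarrow> (\<Sum>i\<in>B. c i * v i k) = (\<Sum>i\<in>B. d i * v i k)" "i \<in> B"
  shows "c i = d i"
proof -
  have "c i - d i = 0"
    using assms(1)[unfolded aff_indep_def, rule_format, of "\<lambda>i. c i - d i" i] assms(2-)
    by (simp add: sum_subtractf algebra_simps)
  then show ?thesis by simp
qed

text \<open>With q added under the index \<open>None\<close> there are n + 2 unknowns for n + 1
  equations. The coefficient of q in a nontrivial relation cannot vanish, since the remaining points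
  are affinely independent, so one can solve for q.\<close>

lemma affine_span_aff_indep:
  assumes B: "finite B" "aff_indep n B v" "card B = Suc n"
  shows "\<exists>c. (\<Sum>i\<in>B. c i) = 1 \<and> (\<forall>k<n. (\<Sum>i\<in>B. c i * v i k) = q k)"
proof -
  define B' where "B' = insert None (Some ` B)"
  have fin: "finite B'" "card {..n} < card B'" using B by (auto simp: B'_def card_image)
  define w where "w = (\<lambda>i k. if k = n then (1::real) else case i of None \<Rightarrow> q k | Some i \<Rightarrow> v i k)"
  obtain c where c: "\<exists>i\<in>B'. c i \<noteq> 0" "\<forall>k\<in>{..n}. (\<Sum>i\<in>B'. c i * w i k) = 0"
    using homogeneous_system_nontrivial[of "{..n}" B' w] fin by auto
  have sum': "(\<Sum>i\<in>B'. f i) = f None + (\<Sum>i\<in>B. f (Some i))" for f :: "_ \<Rightarrow> real"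
    unfolding B'_def using B by (subst sum.insert) (auto simp: sum.reindex)
  have s1: "c None + (\<Sum>i\<in>B. c (Some i)) = 0"
    using c(2)[rule_format, of n] by (simp add: sum' w_def)
  have s2: "c None * q k + (\<Sum>i\<in>B. c (Some i) * v i k) = 0" if "k < n" for k
    using c(2)[rule_format, of k] that by (simp add: sum' w_def)
  have "c None \<noteq> 0"
  proof
    assume 0: "c None = 0"
    then have "\<forall>i\<in>B. c (Some i) = 0"
      using B(2)[unfolded aff_indep_def, rule_format, of "\<lambda>i. c (Some i)"] s1 s2 by auto
    then show False using 0 c(1) by (auto simp: B'_def)
  qed
  then show ?thesis using s1 s2
    by (intro exI[of _ "\<lambda>i. - c (Some i) / c None"])
       (auto simp: sum_divide_distrib[symmetric] sum_negf field_simps add_eq_0_iff)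
qed

text \<open>Caratheodory's argument with a linear cost: as long as the support is affinely
  dependent, move along a dependency, in the direction that does not raise the cost, until a
  coefficient becomes zero.\<close>

lemma caratheodory_cost:
  fixes h :: "'i \<Rightarrow> real"
  assumes I: "finite I" and "c \<in> weights I"
  shows "\<exists>d\<in>weights I. aff_indep n {i\<in>I. d i \<noteq> 0} v \<and>
    (\<forall>k<n. (\<Sum>i\<in>I. d i * v i k) = (\<Sum>i\<in>I. c i * v i k)) \<and>
    (\<Sum>i\<in>I. d i * h i) \<le> (\<Sum>i\<in>I. c i * h i)"
  using assms(2)
proof (induction "card {i\<in>I. c i \<noteq> 0}" arbitrary: c rule: less_induct)
  case less
  define B where "B = {i\<in>I. c i \<noteq> 0}"
  have finB: "finite B" "B \<subseteq> I" using I by (auto simp: B_def)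
  show ?case
  proof (cases "aff_indep n B v")
    case True
    then show ?thesis using less.prems by (intro bexI[of _ c]) (auto simp: B_def)
  next
    case False
    then obtain e0 where e0: "(\<Sum>i\<in>B. e0 i) = 0" "\<forall>k<n. (\<Sum>i\<in>B. e0 i * v i k) = 0" "\<exists>i\<in>B. e0 i \<noteq> 0"
      unfolding aff_indep_def by auto
    \<comment> \<open>Orients the dependency so that subtracting a positive multiple of it does not
      raise the cost.\<close>
    define s :: real where "s = (if (\<Sum>i\<in>B. e0 i * h i) \<ge> 0 then 1 else -1)"
    define e where "e = (\<lambda>i. s * e0 i)"
    have e: "(\<Sum>i\<in>B. e i) = 0" "\<forall>k<n. (\<Sum>i\<in>B. e i * v i k) = 0" "\<exists>i\<in>B. e i \<noteq> 0" "(\<Sum>i\<in>B. e i * h i) \<ge> 0"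
      using e0 by (auto simp: e_def sum_distrib_left[symmetric] mult.assoc s_def)
    have "\<exists>i\<in>B. e i > 0"
    proof (rule ccontr)
      assume "\<not> (\<exists>i\<in>B. e i > 0)"
      then have "\<forall>i\<in>B. e i = 0"
        using sum_nonneg_eq_0_iff[of B "\<lambda>i. - e i"] e finB by (auto simp: sum_negf not_less)
      then show False using e by auto
    qed
    define P where "P = {i\<in>B. e i > 0}"
    have P: "finite P" "P \<noteq> {}" using \<open>\<exists>i\<in>B. e i > 0\<close> finB by (auto simp: P_def)
    \<comment> \<open>The longest step that keeps all coefficients nonnegative; at a minimising
      index j the new coefficient is zero.\<close>
    define t where "t = Min ((\<lambda>i. c i / e i) ` P)"
    have "t \<in> (\<lambda>i. c i / e i) ` P" unfolding t_def using P by (intro Min_in) auto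
    then obtain j where j: "j \<in> P" "t = c j / e j" by auto
    have tle: "t \<le> c i / e i" if "i \<in> P" for i unfolding t_def using P that by (intro Min_le) auto
    have cpos: "c i > 0" if "i \<in> B" for i using that less.prems by (force simp: B_def weights_def)
    have tpos: "t > 0" using j cpos by (auto simp: P_def)
    define d where "d = (\<lambda>i. if i \<in> B then c i - t * e i else 0)"
    have sum_d: "(\<Sum>i\<in>I. d i * f i) = (\<Sum>i\<in>I. c i * f i) - t * (\<Sum>i\<in>B. e i * f i)" for f
    proof -
      have "(\<Sum>i\<in>I. d i * f i) = (\<Sum>i\<in>B. d i * f i)"
        using I finB by (intro sum.mono_neutral_right) (auto simp: d_def)
      also have "\<dots> = (\<Sum>i\<in>B. c i * f i) - t * (\<Sum>i\<in>B. e i * f i)"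
        by (simp add: d_def sum_subtractf sum_distrib_left algebra_simps)
      also have "(\<Sum>i\<in>B. c i * f i) = (\<Sum>i\<in>I. c i * f i)"
        using I finB by (intro sum.mono_neutral_left) (auto simp: B_def)
      finally show ?thesis .
    qed
    have dnn: "d i \<ge> 0" for i
    proof (cases "i \<in> P")
      case True
      then show ?thesis using tle[OF True] by (auto simp: d_def P_def field_simps)
    next
      case False
      show ?thesis
      proof (cases "i \<in> B")
        case True
        then have "t * e i \<le> 0" using False tpos by (auto simp: P_def mult_le_0_iff)
        then show ?thesis using True cpos[OF True] by (simp add: d_def)
      qed (simp add: d_def)
    qed
    have dw: "d \<in> weights I"
      using dnn sum_d[of "\<lambda>_. 1"] e less.prems by (simp add: weights_def)
    have "{i\<in>I. d i \<noteq> 0} \<subseteq> B - {j}" using j by (auto simp: d_def P_def)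
    then have "card {i\<in>I. d i \<noteq> 0} < card B"
      using finB j by (intro psubset_card_mono) (auto simp: P_def)
    then obtain d' where d': "d'\<in>weights I" "aff_indep n {i\<in>I. d' i \<noteq> 0} v"
      "\<forall>k<n. (\<Sum>i\<in>I. d' i * v i k) = (\<Sum>i\<in>I. d i * v i k)"
      "(\<Sum>i\<in>I. d' i * h i) \<le> (\<Sum>i\<in>I. d i * h i)"
      using less.hyps[of d] dw by (auto simp: B_def)
    have "(\<Sum>i\<in>I. d i * h i) \<le> (\<Sum>i\<in>I. c i * h i)" unfolding sum_d using e tpos by simp
    then have "(\<Sum>i\<in>I. d' i * h i) \<le> (\<Sum>i\<in>I. c i * h i)" using d'(4) by linarith
    moreover have "\<forall>k<n. (\<Sum>i\<in>I. d' i * v i k) = (\<Sum>i\<in>I. c i * v i k)"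
      using d'(3) e sum_d by simp
    ultimately show ?thesis using d' by blast
  qed
qed

section \<open>Regular triangulations\<close>

definition chull :: "nat \<Rightarrow> 'i set \<Rightarrow> ('i \<Rightarrow> nat \<Rightarrow> real) \<Rightarrow> (nat \<Rightarrow> real) set" where
  "chull n I v = (\<lambda>c. lincomb n I c v) ` weights I"

lemma lincomb_eq_iff:
  "lincomb n I c v = lincomb n J d w \<longleftrightarrow> (\<forall>k<n. (\<Sum>i\<in>I. c i * v i k) = (\<Sum>i\<in>J. d i * w i k))"
  by (auto simp: lincomb_def fun_eq_iff restrict_def)

lemma lincomb_extend:
  assumes "finite I" "B \<subseteq> I"
  shows "lincomb n I (\<lambda>i. if i \<in> B then c i else 0) v = lincomb n B c v"
proof -
  have "(\<Sum>i\<in>I. (if i \<in> B then c i else 0) * v i k) = (\<Sum>i\<in>B. c i * v i k)" for k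
    using assms by (intro sum.mono_neutral_cong_right) auto
  then show ?thesis by (simp add: lincomb_def)
qed

lemma weights_extend:
  assumes "finite I" "B \<subseteq> I" "c \<in> weights B"
  shows "(\<lambda>i. if i \<in> B then c i else 0) \<in> weights I"
proof -
  have "(\<Sum>i\<in>I. (if i \<in> B then c i else 0)) = (\<Sum>i\<in>B. c i)"
    using assms by (intro sum.mono_neutral_cong_right) auto
  then show ?thesis using assms by (auto simp: weights_def)
qed

lemma chull_mono:
  assumes "finite I" "B \<subseteq> I"
  shows "chull n B v \<subseteq> chull n I v"
proof
  fix x assume "x \<in> chull n B v"
  then obtain c where c: "c \<in> weights B" "x = lincomb n B c v" by (auto simp: chull_def)
  show "x \<in> chull n I v"
    unfolding chull_def c(2) lincomb_extend[OF assms, of n c v, symmetric]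
    by (intro imageI weights_extend assms c)
qed

lemma weights_support:
  assumes "finite I" "c \<in> weights I" "B \<subseteq> I" "\<And>i. i \<in> I - B \<Longrightarrow> c i = 0"
  shows "c \<in> weights B" "lincomb n I c v = lincomb n B c v"
proof -
  have "(\<Sum>i\<in>I. c i * f i) = (\<Sum>i\<in>B. c i * f i)" for f
    using assms by (intro sum.mono_neutral_right) auto
  from this[of "\<lambda>_. 1"] this show "c \<in> weights B" "lincomb n I c v = lincomb n B c v"
    using assms by (auto simp: weights_def lincomb_def)
qed

text \<open>No compactness is required for the minimum: by the reduction above only affinely
  independent supports matter, there are finitely many of them, and each carries at most one
  representation of the given point.\<close>

lemma optimal_representation:
  fixes h :: "'i \<Rightarrow> real"
  assumes I: "finite I" and c: "c \<in> weights I"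
  shows "\<exists>d\<in>weights I. aff_indep n {i\<in>I. d i \<noteq> 0} v \<and> lincomb n I d v = lincomb n I c v \<and>
    (\<forall>e\<in>weights I. lincomb n I e v = lincomb n I c v \<longrightarrow> (\<Sum>i\<in>I. d i * h i) \<le> (\<Sum>i\<in>I. e i * h i))"
proof -
  define D where "D = {d\<in>weights I. aff_indep n {i\<in>I. d i \<noteq> 0} v \<and> lincomb n I d v = lincomb n I c v}"
  define cost where "cost = (\<lambda>d::'i \<Rightarrow> real. \<Sum>i\<in>I. d i * h i)"
  define supp where "supp = (\<lambda>d::'i \<Rightarrow> real. {i\<in>I. d i \<noteq> 0})"
  have red: "\<exists>d\<in>D. cost d \<le> cost e" if "e \<in> weights I" "lincomb n I e v = lincomb n I c v" for e
    using caratheodory_cost[OF I that(1), of n v h] that(2)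
    by (fastforce simp: D_def cost_def lincomb_eq_iff)
  have same: "cost d = cost e" if "d \<in> D" "e \<in> D" "supp d = supp e" for d e
  proof -
    have restr: "(\<Sum>i\<in>I. a i * f i) = (\<Sum>i\<in>supp a. a i * f i)" for a f
      unfolding supp_def using I by (intro sum.mono_neutral_right) auto
    have "d i = e i" if i: "i \<in> supp d" for i
    proof (rule aff_indep_unique[OF _ _ _ i])
      show "aff_indep n (supp d) v" using \<open>d \<in> D\<close> by (simp add: D_def supp_def)
      show "sum d (supp d) = sum e (supp d)"
        using \<open>d \<in> D\<close> \<open>e \<in> D\<close> restr[of d "\<lambda>_. 1"] restr[of e "\<lambda>_. 1"] \<open>supp d = supp e\<close>
        by (simp add: D_def weights_def)
      have "lincomb n I d v = lincomb n I e v" using \<open>d \<in> D\<close> \<open>e \<in> D\<close> by (simp add: D_def)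
      then show "(\<Sum>i\<in>supp d. d i * v i k) = (\<Sum>i\<in>supp d. e i * v i k)" if "k < n" for k
        using that restr[of d "\<lambda>i. v i k"] restr[of e "\<lambda>i. v i k"] \<open>supp d = supp e\<close> by (simp add: lincomb_eq_iff)
    qed
    then show ?thesis unfolding cost_def restr \<open>supp d = supp e\<close>[symmetric] by simp
  qed
  have "finite (cost ` D)"
  proof (rule finite_subset)
    show "cost ` D \<subseteq> (\<lambda>S. cost (SOME d. d \<in> D \<and> supp d = S)) ` Pow I"
    proof
      fix y assume "y \<in> cost ` D"
      then obtain d where d: "d \<in> D" "y = cost d" by auto
      let ?e = "SOME e. e \<in> D \<and> supp e = supp d"
      have "?e \<in> D \<and> supp ?e = supp d" by (rule someI[of _ d]) (simp add: d)
      then have "y = cost ?e" using same[of d ?e] d by metis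
      moreover have "supp d \<in> Pow I" by (auto simp: supp_def)
      ultimately show "y \<in> (\<lambda>S. cost (SOME d. d \<in> D \<and> supp d = S)) ` Pow I" by (rule image_eqI)
    qed
    show "finite ((\<lambda>S. cost (SOME d. d \<in> D \<and> supp d = S)) ` Pow I)" using I by simp
  qed
  moreover have "cost ` D \<noteq> {}" using red[OF c refl] by auto
  ultimately have "Min (cost ` D) \<in> cost ` D" by (rule Min_in)
  then obtain d where d: "d \<in> D" "cost d = Min (cost ` D)" by auto
  have "cost d \<le> cost e" if e: "e \<in> weights I" "lincomb n I e v = lincomb n I c v" for e
  proof -
    obtain e' where e': "e' \<in> D" "cost e' \<le> cost e" using red[OF e] by auto
    have "cost d \<le> cost e'" unfolding d(2) using \<open>finite (cost ` D)\<close> e' by (intro Min_le) auto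
    then show ?thesis using e' by simp
  qed
  then show ?thesis using d unfolding D_def cost_def by (intro bexI[of _ d]) auto
qed

text \<open>General position of the lifted points (v i, h i), demanded only over affinely
  independent bases: no further lifted point lies on the hyperplane through n + 1 of them. It turns
  the weak optimality inequalities into the strict ones required by \<open>cells\<close>.\<close>

definition generic_cost :: "nat \<Rightarrow> 'i set \<Rightarrow> ('i \<Rightarrow> nat \<Rightarrow> real) \<Rightarrow> ('i \<Rightarrow> real) \<Rightarrow> bool" where
  "generic_cost n I v h \<longleftrightarrow> (\<forall>B c q. B \<subseteq> I \<longrightarrow> card B = Suc n \<longrightarrow> aff_indep n B v \<longrightarrow> q \<in> I - B \<longrightarrow>
     (\<Sum>i\<in>B. c i) = 1 \<longrightarrow> (\<forall>k<n. (\<Sum>i\<in>B. c i * v i k) = v q k) \<longrightarrow> (\<Sum>i\<in>B. c i * h i) \<noteq> h q)"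

text \<open>The cells of the regular triangulation of the points \<open>v i\<close> induced by the lifting heights \<open>h i\<close>.\<close>

definition cells :: "nat \<Rightarrow> 'i set \<Rightarrow> ('i \<Rightarrow> nat \<Rightarrow> real) \<Rightarrow> ('i \<Rightarrow> real) \<Rightarrow> 'i set set" where
  "cells n I v h = {B. B \<subseteq> I \<and> card B = Suc n \<and> aff_indep n B v \<and>
     (\<forall>q\<in>I - B. \<forall>c. (\<Sum>i\<in>B. c i) = 1 \<longrightarrow> (\<forall>k<n. (\<Sum>i\<in>B. c i * v i k) = v q k) \<longrightarrow> (\<Sum>i\<in>B. c i * h i) < h q)}"

text \<open>Heights on the moment curve: each genericity condition excludes the roots of one nonzero polynomial.\<close>

lemma generic_cost_exists:
  assumes I: "finite I"
  shows "\<exists>h. generic_cost n I v h"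
proof -
  obtain idx :: "'a \<Rightarrow> nat" where idx: "inj_on idx I"
    using I finite_imp_inj_to_nat_seg by blast
  \<comment> \<open>If q has affine coordinates with respect to B, these are unique, so this choice
    agrees with every c that the genericity condition can produce. Otherwise the choice is
    arbitrary, and the polynomial below is still nonzero.\<close>
  define coords where "coords = (\<lambda>B q. SOME c. (\<Sum>i\<in>B. c i) = 1 \<and> (\<forall>k<n. (\<Sum>i\<in>B. c i * v i k) = v q k))"
  define P :: "'a set \<Rightarrow> 'a \<Rightarrow> real poly" where
    "P = (\<lambda>B q. monom 1 (idx q) - (\<Sum>i\<in>B. monom (coords B q i) (idx i)))"
  define bad where "bad = (\<Union>B\<in>Pow I. \<Union>q\<in>I - B. {t. poly (P B q) t = 0})"
  have "P B q \<noteq> 0" if "B \<subseteq> I" "q \<in> I - B" for B q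
  proof -
    have ne: "idx i \<noteq> idx q" if "i \<in> B" for i
      using that \<open>B \<subseteq> I\<close> \<open>q \<in> I - B\<close> idx by (auto simp: inj_on_def)
    have "coeff (P B q) (idx q) = 1 - (\<Sum>i\<in>B. if idx i = idx q then coords B q i else 0)"
      by (simp add: P_def coeff_sum)
    also have "(\<Sum>i\<in>B. if idx i = idx q then coords B q i else 0) = 0"
      using ne by (intro sum.neutral) auto
    finally show ?thesis by auto
  qed
  then have "finite bad"
    unfolding bad_def using I by (intro finite_UN_I poly_roots_finite) auto
  then obtain t where t: "t \<notin> bad" using ex_new_if_finite infinite_UNIV_char_0 by blast
  show ?thesis
  proof (intro exI[of _ "\<lambda>i. t ^ idx i"], unfold generic_cost_def, safe)
    fix B c q assume B: "B \<subseteq> I" "card B = Suc n" "aff_indep n B v" "q \<in> I" "q \<notin> B"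
      and c: "(\<Sum>i\<in>B. c i) = 1" "\<forall>k<n. (\<Sum>i\<in>B. c i * v i k) = v q k"
      and eq: "(\<Sum>i\<in>B. c i * t ^ idx i) = t ^ idx q"
    have "(\<Sum>i\<in>B. coords B q i) = 1 \<and> (\<forall>k<n. (\<Sum>i\<in>B. coords B q i * v i k) = v q k)"
      unfolding coords_def by (rule someI[of _ c]) (use c in auto)
    then have "coords B q i = c i" if "i \<in> B" for i
      using aff_indep_unique[OF B(3), of "coords B q" c i] that c by auto
    then have "poly (P B q) t = t ^ idx q - (\<Sum>i\<in>B. c i * t ^ idx i)"
      by (simp add: P_def poly_sum poly_monom)
    then have "t \<in> bad" using eq B by (auto simp: bad_def)
    then show False using t by simp
  qed
qed

lemma finite_cells: "finite I \<Longrightarrow> finite (cells n I v h)"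
  by (rule finite_subset[of _ "Pow I"]) (auto simp: cells_def)

text \<open>Take the cheapest representation of x. If its support has n + 1 points it is a cell:
  were some lifted point q on or below the hyperplane of the support, genericity would put it
  strictly below, and shifting a little weight to q would lower the cost. Smaller supports give the
  second alternative, which is a null set later.\<close>

lemma cells_cover:
  assumes I: "finite I" and h: "generic_cost n I v h" and x: "x \<in> chull n I v"
  shows "(\<exists>B\<in>cells n I v h. x \<in> chull n B v) \<or> (\<exists>B\<subseteq>I. card B \<le> n \<and> x \<in> chull n B v)"
proof -
  obtain c where c: "c \<in> weights I" "x = lincomb n I c v" using x by (auto simp: chull_def)
  obtain d where d: "d \<in> weights I" "aff_indep n {i\<in>I. d i \<noteq> 0} v" "lincomb n I d v = lincomb n I c v"
    and opt: "\<And>e. e\<in>weights I \<Longrightarrow> lincomb n I e v = lincomb n I c v \<Longrightarrow> (\<Sum>i\<in>I. d i * h i) \<le> (\<Sum>i\<in>I. e i * h i)"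
    using optimal_representation[OF I c(1), of n v h] by blast
  define B where "B = {i\<in>I. d i \<noteq> 0}"
  have B: "B \<subseteq> I" "finite B" using I by (auto simp: B_def)
  have dB: "d \<in> weights B" "lincomb n I d v = lincomb n B d v"
    by (rule weights_support[OF I d(1)]; auto simp: B_def)+
  have xB: "x \<in> chull n B v" unfolding chull_def using dB d c by auto
  have dpos: "d i > 0" if "i \<in> B" for i using that d(1) by (force simp: B_def weights_def)
  have "card B \<le> Suc n" using card_aff_indep_le[OF B(2)] d by (simp add: B_def)
  moreover have "B \<in> cells n I v h" if card: "card B = Suc n"
  proof -
    have "(\<Sum>i\<in>B. a i * h i) < h q" if q: "q \<in> I - B" and a: "(\<Sum>i\<in>B. a i) = 1"
      "\<forall>k<n. (\<Sum>i\<in>B. a i * v i k) = v q k" for q a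
    proof (rule ccontr)
      assume "\<not> (\<Sum>i\<in>B. a i * h i) < h q"
      moreover have "(\<Sum>i\<in>B. a i * h i) \<noteq> h q"
        using h[unfolded generic_cost_def, rule_format, OF B(1) card _ q a(1)] a d by (simp add: B_def)
      ultimately have gt: "(\<Sum>i\<in>B. a i * h i) > h q" by simp
      \<comment> \<open>A positive amount of weight for q that leaves the other coefficients
        nonnegative; the denominator 1 + |a i| covers all signs of a i, including zero.\<close>
      define t where "t = Min ((\<lambda>i. d i / (1 + \<bar>a i\<bar>)) ` B)"
      have ne: "B \<noteq> {}" using card by auto
      have "t \<in> (\<lambda>i. d i / (1 + \<bar>a i\<bar>)) ` B" unfolding t_def using B ne by (intro Min_in) auto
      then have tpos: "t > 0" using dpos by (auto intro!: divide_pos_pos)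
      have tle: "t * a i \<le> d i" if "i \<in> B" for i
      proof -
        have "t \<le> d i / (1 + \<bar>a i\<bar>)" unfolding t_def using that B by (intro Min_le) auto
        then have "t * (1 + \<bar>a i\<bar>) \<le> d i" by (simp add: pos_le_divide_eq)
        moreover have "t * a i \<le> t * (1 + \<bar>a i\<bar>)" using tpos by (intro mult_left_mono) auto
        ultimately show ?thesis by linarith
      qed
      define e where "e = (\<lambda>i. if i = q then t else if i \<in> B then d i - t * a i else 0)"
      have sum_e: "(\<Sum>i\<in>I. e i * f i) = (\<Sum>i\<in>I. d i * f i) + t * (f q - (\<Sum>i\<in>B. a i * f i))" for f
      proof -
        have "(\<Sum>i\<in>I. e i * f i) = (\<Sum>i\<in>insert q B. e i * f i)"
          using I B q by (intro sum.mono_neutral_right) (auto simp: e_def)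
        also have "\<dots> = t * f q + (\<Sum>i\<in>B. (d i - t * a i) * f i)"
          using q B by (subst sum.insert) (auto simp: e_def intro!: sum.cong)
        also have "\<dots> = (\<Sum>i\<in>B. d i * f i) + t * (f q - (\<Sum>i\<in>B. a i * f i))"
          by (simp add: algebra_simps sum_subtractf sum_distrib_left)
        also have "(\<Sum>i\<in>B. d i * f i) = (\<Sum>i\<in>I. d i * f i)"
          using I B by (intro sum.mono_neutral_left) (auto simp: B_def)
        finally show ?thesis .
      qed
      have "e \<in> weights I"
        using sum_e[of "\<lambda>_. 1"] a d tpos tle by (auto simp: weights_def e_def)
      moreover have "lincomb n I e v = lincomb n I c v"
        using d(3) a by (simp add: lincomb_eq_iff sum_e)
      ultimately have "(\<Sum>i\<in>I. d i * h i) \<le> (\<Sum>i\<in>I. e i * h i)" by (rule opt)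
      moreover have "t * (h q - (\<Sum>i\<in>B. a i * h i)) < 0" using gt tpos by (simp add: mult_pos_neg)
      ultimately show False unfolding sum_e by simp
    qed
    then show ?thesis using B card d by (auto simp: cells_def B_def)
  qed
  ultimately show ?thesis using xB B by (metis le_Suc_eq)
qed

text \<open>The lifted points of a cell span a hyperplane that lies strictly below every other
  lifted point. So the representation of a point by the cell is the cheapest one, strictly so as
  soon as a competitor puts weight outside the cell.\<close>

lemma cell_cost_less:
  assumes I: "finite I" and B: "B \<in> cells n I v h" and B': "B' \<subseteq> I"
    and d: "d \<in> weights B" and e: "e \<in> weights B'" and eq: "lincomb n B d v = lincomb n B' e v"
  shows "(\<Sum>i\<in>B. d i * h i) \<le> (\<Sum>i\<in>B'. e i * h i)"
    and "q \<in> B' - B \<Longrightarrow> e q \<noteq> 0 \<Longrightarrow> (\<Sum>i\<in>B. d i * h i) < (\<Sum>i\<in>B'. e i * h i)"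
proof -
  have fin: "finite B" "finite B'" "B \<subseteq> I" using I B B' by (auto simp: cells_def intro: finite_subset)
  have indep: "aff_indep n B v" "card B = Suc n" using B by (auto simp: cells_def)
  define A where "A = (\<lambda>q. SOME c. (\<Sum>i\<in>B. c i) = 1 \<and> (\<forall>k<n. (\<Sum>i\<in>B. c i * v i k) = v q k))"
  have A: "(\<Sum>i\<in>B. A q i) = 1 \<and> (\<forall>k<n. (\<Sum>i\<in>B. A q i * v i k) = v q k)" for q
    unfolding A_def
    using someI_ex[of "\<lambda>c. (\<Sum>i\<in>B. c i) = 1 \<and> (\<forall>k<n. (\<Sum>i\<in>B. c i * v i k) = v q k)",
      OF affine_span_aff_indep[OF fin(1) indep]] .
  \<comment> \<open>Substituting for each q in B' its affine coordinates with respect to B yields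
    another representation by B, which is unique.\<close>
  have dA: "d i = (\<Sum>q\<in>B'. e q * A q i)" if "i \<in> B" for i
  proof (rule aff_indep_unique[OF indep(1) _ _ that])
    show "sum d B = (\<Sum>i\<in>B. \<Sum>q\<in>B'. e q * A q i)"
      by (subst sum.swap) (use A d e in \<open>simp add: sum_distrib_left[symmetric] weights_def\<close>)
    fix k assume k: "k < n"
    have "(\<Sum>i\<in>B. d i * v i k) = (\<Sum>q\<in>B'. e q * v q k)" using eq k by (simp add: lincomb_eq_iff)
    also have "\<dots> = (\<Sum>q\<in>B'. e q * (\<Sum>i\<in>B. A q i * v i k))" using A k by simp
    also have "\<dots> = (\<Sum>i\<in>B. (\<Sum>q\<in>B'. e q * A q i) * v i k)"
      unfolding sum_distrib_left sum_distrib_right by (subst sum.swap) (simp add: mult.assoc)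
    finally show "(\<Sum>i\<in>B. d i * v i k) = (\<Sum>i\<in>B. (\<Sum>q\<in>B'. e q * A q i) * v i k)" .
  qed
  have cost: "(\<Sum>i\<in>B. d i * h i) = (\<Sum>q\<in>B'. e q * (\<Sum>i\<in>B. A q i * h i))"
  proof -
    have "(\<Sum>i\<in>B. d i * h i) = (\<Sum>i\<in>B. (\<Sum>q\<in>B'. e q * A q i) * h i)" using dA by simp
    also have "\<dots> = (\<Sum>q\<in>B'. e q * (\<Sum>i\<in>B. A q i * h i))"
      unfolding sum_distrib_left sum_distrib_right by (subst sum.swap) (simp add: mult.assoc)
    finally show ?thesis .
  qed
  have Aq: "(\<Sum>i\<in>B. A q i * h i) < h q" if "q \<in> B' - B" for q
    using B A[of q] that B' unfolding cells_def by blast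
  have Aq': "(\<Sum>i\<in>B. A q i * h i) = h q" if "q \<in> B" for q
  proof -
    have "A q i = (if i = q then 1 else 0)" if "i \<in> B" for i
      using aff_indep_unique[OF indep(1), of "A q" "\<lambda>i. if i = q then 1 else 0" i] A[of q] that fin \<open>q \<in> B\<close>
      by (auto simp: if_distrib[of "\<lambda>x. x * _"] cong: if_cong)
    then show ?thesis using fin that by (simp add: if_distrib[of "\<lambda>x. x * _"] cong: if_cong)
  qed
  have le: "e q * (\<Sum>i\<in>B. A q i * h i) \<le> e q * h q" if "q \<in> B'" for q
    using that e Aq[of q] Aq'[of q] by (cases "q \<in> B") (auto simp: weights_def intro!: mult_left_mono)
  show "(\<Sum>i\<in>B. d i * h i) \<le> (\<Sum>i\<in>B'. e i * h i)"
    unfolding cost by (rule sum_mono) (rule le)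
  show "(\<Sum>i\<in>B. d i * h i) < (\<Sum>i\<in>B'. e i * h i)" if q: "q \<in> B' - B" "e q \<noteq> 0"
    unfolding cost
  proof (rule sum_strict_mono_ex1[OF fin(2)])
    have "e q > 0" using q e by (force simp: weights_def)
    then have "e q * (\<Sum>i\<in>B. A q i * h i) < e q * h q" using Aq[OF q(1)] by simp
    then show "\<exists>a\<in>B'. e a * (\<Sum>i\<in>B. A a i * h i) < e a * h a" using q by auto
  qed (use le in auto)
qed

text \<open>Minimality applied to both cells makes the two costs equal; by strictness the second
  representation is then supported on the intersection, which has at most n points.\<close>

lemma cells_overlap:
  assumes I: "finite I" and B: "B \<in> cells n I v h" "B' \<in> cells n I v h" "B \<noteq> B'"
    and x: "x \<in> chull n B v" "x \<in> chull n B' v"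
  shows "\<exists>D\<subseteq>I. card D \<le> n \<and> x \<in> chull n D v"
proof -
  obtain d e where d: "d \<in> weights B" "x = lincomb n B d v" and e: "e \<in> weights B'" "x = lincomb n B' e v"
    using x by (auto simp: chull_def)
  have sub: "B \<subseteq> I" "B' \<subseteq> I" "card B = Suc n" "card B' = Suc n" "finite B" "finite B'"
    using B I by (auto simp: cells_def intro: finite_subset)
  have "(\<Sum>i\<in>B'. e i * h i) \<le> (\<Sum>i\<in>B. d i * h i)"
    using cell_cost_less(1)[OF I B(2) sub(1) e(1) d(1)] d e by simp
  then have "e q = 0" if "q \<in> B' - B" for q
    using cell_cost_less(2)[OF I B(1) sub(2) d(1) e(1) _ that] d e by force
  then have "e \<in> weights (B' \<inter> B)" "lincomb n B' e v = lincomb n (B' \<inter> B) e v"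
    by (auto intro!: weights_support[OF sub(6) e(1)])
  then have "x \<in> chull n (B' \<inter> B) v" using e by (auto simp: chull_def)
  moreover have "card (B' \<inter> B) \<le> n"
  proof -
    have "B' \<inter> B \<subset> B'" using B(3) sub card_subset_eq[of B B'] by auto
    then show ?thesis using psubset_card_mono[OF sub(6), of "B' \<inter> B"] sub by simp
  qed
  ultimately show ?thesis using sub by blast
qed

section \<open>Linear substitutions\<close>

interpretation lborel_product: product_sigma_finite "\<lambda>_::nat. lborel::real measure"
  by standard

lemma sigma_finite_lebesgue_n: "sigma_finite_measure (lebesgue_n n)"
  unfolding lebesgue_n_def by (rule lborel_product.sigma_finite) simp

lemma space_lebesgue_n: "space (lebesgue_n n) = PiE {..<n} (\<lambda>_. UNIV)"
  by (simp add: lebesgue_n_def space_PiM)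

lemma measurable_lebesgue_n_component [measurable (raw)]:
  "k < n \<Longrightarrow> (\<lambda>x. x k) \<in> borel_measurable (lebesgue_n n)"
  unfolding lebesgue_n_def by (rule measurable_compose[OF measurable_component_singleton]) auto

lemma measurable_into_lebesgue_n:
  assumes "\<And>k. k < n \<Longrightarrow> (\<lambda>x. f x k) \<in> borel_measurable M" "\<And>x. f x \<in> extensional {..<n}"
  shows "f \<in> measurable M (lebesgue_n n)"
proof -
  have "(\<lambda>x. \<lambda>k\<in>{..<n}. f x k) \<in> measurable M (lebesgue_n n)"
    unfolding lebesgue_n_def using assms(1) by (intro measurable_restrict) simp
  moreover have "(\<lambda>k\<in>{..<n}. f x k) = f x" for x using assms(2) by (rule extensional_restrict)
  ultimately show ?thesis by simp
qed

lemma extensional_lincomb [simp]: "lincomb n I c v \<in> extensional {..<n}"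
  by (simp add: lincomb_def)

lemma lincomb_in_space [simp]: "lincomb n I c v \<in> space (lebesgue_n n)"
  by (simp add: lincomb_def space_lebesgue_n)

lemma measurable_vec_plus [measurable (raw)]:
  assumes "u \<in> measurable M (lebesgue_n n)" "w \<in> measurable M (lebesgue_n n)"
  shows "(\<lambda>z. \<lambda>k\<in>{..<n}. u z k + w z k) \<in> measurable M (lebesgue_n n)"
proof (rule measurable_into_lebesgue_n)
  fix k assume k: "k < n"
  have "(\<lambda>z. u z k + w z k) \<in> borel_measurable M"
    by (intro borel_measurable_add measurable_compose[OF assms(1) measurable_lebesgue_n_component[OF k]]
        measurable_compose[OF assms(2) measurable_lebesgue_n_component[OF k]])
  then show "(\<lambda>z. (\<lambda>k\<in>{..<n}. u z k + w z k) k) \<in> borel_measurable M" using k by simp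
qed simp

lemma measurable_vec_minus [measurable (raw)]:
  assumes "u \<in> measurable M (lebesgue_n n)" "w \<in> measurable M (lebesgue_n n)"
  shows "(\<lambda>z. \<lambda>k\<in>{..<n}. u z k - w z k) \<in> measurable M (lebesgue_n n)"
proof (rule measurable_into_lebesgue_n)
  fix k assume k: "k < n"
  have "(\<lambda>z. u z k - w z k) \<in> borel_measurable M"
    by (intro borel_measurable_diff measurable_compose[OF assms(1) measurable_lebesgue_n_component[OF k]]
        measurable_compose[OF assms(2) measurable_lebesgue_n_component[OF k]])
  then show "(\<lambda>z. (\<lambda>k\<in>{..<n}. u z k - w z k) k) \<in> borel_measurable M" using k by simp
qed simp

lemma nn_integral_lebesgue_n_componentwise:
  assumes f: "f \<in> borel_measurable (lebesgue_n n)"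
    and g: "\<And>k. k < n \<Longrightarrow> distr lborel borel (g k) = lborel" "\<And>k. k < n \<Longrightarrow> g k \<in> borel_measurable borel"
  shows "(\<integral>\<^sup>+x. f (\<lambda>k\<in>{..<n}. g k (x k)) \<partial>lebesgue_n n) = (\<integral>\<^sup>+x. f x \<partial>lebesgue_n n)"
proof -
  let ?T = "\<lambda>x. \<lambda>k\<in>{..<n}. g k (x k)"
  have T: "?T \<in> measurable (lebesgue_n n) (lebesgue_n n)"
    by (rule measurable_into_lebesgue_n) (auto intro: measurable_compose[OF _ g(2)] measurable_lebesgue_n_component)
  have "distr (lebesgue_n n) (lebesgue_n n) ?T = lebesgue_n n"
    unfolding lebesgue_n_def
  proof (rule lborel_product.PiM_eqI)
    fix A :: "nat \<Rightarrow> real set" assume A: "\<And>i. i \<in> {..<n} \<Longrightarrow> A i \<in> sets lborel"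
    have pre: "?T -` PiE {..<n} A \<inter> space (lebesgue_n n) = PiE {..<n} (\<lambda>k. g k -` A k)"
      unfolding space_lebesgue_n by (auto simp: PiE_iff)
    have meas: "g k -` A k \<in> sets borel" if "k < n" for k
      using measurable_sets[OF g(2)[OF that]] A that by simp
    have "emeasure (distr (PiM {..<n} (\<lambda>_. lborel)) (PiM {..<n} (\<lambda>_. lborel)) ?T) (PiE {..<n} A)
        = emeasure (PiM {..<n} (\<lambda>_. lborel)) (PiE {..<n} (\<lambda>k. g k -` A k))"
      using A T pre unfolding lebesgue_n_def by (subst emeasure_distr) (auto intro!: sets_PiM_I_finite)
    also have "\<dots> = (\<Prod>i<n. emeasure lborel (g i -` A i))"
      using meas by (intro lborel_product.emeasure_PiM) auto
    also have "\<dots> = (\<Prod>i<n. emeasure lborel (A i))"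
    proof (rule prod.cong[OF refl])
      fix k assume k: "k \<in> {..<n}"
      have "emeasure lborel (g k -` A k) = emeasure (distr lborel borel (g k)) (A k)"
        using A[OF k] g(2) k by (subst emeasure_distr) auto
      then show "emeasure lborel (g k -` A k) = emeasure lborel (A k)" using g(1) k by simp
    qed
    finally show "emeasure (distr (PiM {..<n} (\<lambda>_. lborel)) (PiM {..<n} (\<lambda>_. lborel)) ?T) (PiE {..<n} A)
      = (\<Prod>i\<in>{..<n}. emeasure lborel (A i))" .
  qed auto
  then have "(\<integral>\<^sup>+x. f x \<partial>lebesgue_n n) = (\<integral>\<^sup>+x. f x \<partial>distr (lebesgue_n n) (lebesgue_n n) ?T)" by simp
  also have "\<dots> = (\<integral>\<^sup>+x. f (?T x) \<partial>lebesgue_n n)" by (rule nn_integral_distr[OF T]) (use f in simp)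
  finally show ?thesis by simp
qed

lemma nn_integral_lebesgue_n_translate:
  assumes "f \<in> borel_measurable (lebesgue_n n)"
  shows "(\<integral>\<^sup>+x. f (\<lambda>k\<in>{..<n}. a k + x k) \<partial>lebesgue_n n) = (\<integral>\<^sup>+x. f x \<partial>lebesgue_n n)"
  using assms by (rule nn_integral_lebesgue_n_componentwise[where g="\<lambda>k t. a k + t"]) (auto simp: lborel_distr_plus)

lemma nn_integral_lebesgue_n_reflect:
  assumes "f \<in> borel_measurable (lebesgue_n n)"
  shows "(\<integral>\<^sup>+x. f (\<lambda>k\<in>{..<n}. a k - x k) \<partial>lebesgue_n n) = (\<integral>\<^sup>+x. f x \<partial>lebesgue_n n)"
proof (rule nn_integral_lebesgue_n_componentwise[where g="\<lambda>k t. a k - t", OF assms])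
  fix k
  have "distr lborel borel (\<lambda>t. a k - t) = distr (distr lborel borel uminus) borel (\<lambda>t. a k + t)"
    by (subst distr_distr) (auto simp: comp_def)
  then show "distr lborel borel (\<lambda>t. a k - t) = lborel"
    by (simp add: lborel_distr_uminus lborel_distr_plus)
qed auto

lemma measurable_lincomb_coeffs:
  assumes "\<And>i. i \<in> I \<Longrightarrow> (\<lambda>x. c x i) \<in> borel_measurable M"
    "\<And>i k. i \<in> I \<Longrightarrow> k < n \<Longrightarrow> (\<lambda>x. v x i k) \<in> borel_measurable M"
  shows "(\<lambda>x. lincomb n I (c x) (v x)) \<in> measurable M (lebesgue_n n)"
proof (rule measurable_into_lebesgue_n)
  fix k assume k: "k < n"
  have "(\<lambda>x. \<Sum>i\<in>I. c x i * v x i k) \<in> borel_measurable M"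
    using assms k by (intro borel_measurable_sum borel_measurable_times) auto
  then show "(\<lambda>x. lincomb n I (c x) (v x) k) \<in> borel_measurable M"
    using k by (simp add: lincomb_def)
qed simp

text \<open>Uniqueness of translation invariant measures, in the form needed for linear substitutions:
  both sides are the integral of \<open>f x * g y\<close>, after shifting first one and then the other variable.\<close>

lemma nn_integral_linear_proportional:
  assumes f: "f \<in> borel_measurable (lebesgue_n n)" and g: "g \<in> borel_measurable (lebesgue_n n)"
    and surj: "\<And>x. x \<in> space (lebesgue_n n) \<Longrightarrow> \<exists>b\<in>space (lebesgue_n n). lincomb n {..<n} b h = x"
  shows "(\<integral>\<^sup>+x. f x \<partial>lebesgue_n n) * (\<integral>\<^sup>+c. g (lincomb n {..<n} c h) \<partial>lebesgue_n n)
    = (\<integral>\<^sup>+c. f (lincomb n {..<n} c h) \<partial>lebesgue_n n) * (\<integral>\<^sup>+x. g x \<partial>lebesgue_n n)"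
proof -
  let ?L = "lebesgue_n n" and ?T = "\<lambda>c. lincomb n {..<n} c h"
  interpret L: pair_sigma_finite ?L ?L
    by (simp add: pair_sigma_finite_def sigma_finite_lebesgue_n)
  have T [measurable]: "?T \<in> measurable ?L ?L"
    by (rule measurable_lincomb_coeffs) (auto intro: measurable_lebesgue_n_component)
  note f [measurable] g [measurable]
  let ?plus = "\<lambda>x y. \<lambda>k\<in>{..<n}. (x k + y k :: real)" and ?minus = "\<lambda>x y. \<lambda>k\<in>{..<n}. (x k - y k :: real)"
  have "(\<integral>\<^sup>+x. f x \<partial>?L) * (\<integral>\<^sup>+c. g (?T c) \<partial>?L) = (\<integral>\<^sup>+c. (\<integral>\<^sup>+x. f x \<partial>?L) * g (?T c) \<partial>?L)"
    by (rule nn_integral_cmult[symmetric]) measurable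
  also have "\<dots> = (\<integral>\<^sup>+c. (\<integral>\<^sup>+x. f (?plus (?T c) x) \<partial>?L) * g (?T c) \<partial>?L)"
    by (simp add: nn_integral_lebesgue_n_translate f)
  also have "\<dots> = (\<integral>\<^sup>+c. (\<integral>\<^sup>+x. f (?plus (?T c) x) * g (?T c) \<partial>?L) \<partial>?L)"
  proof (rule nn_integral_cong)
    fix c assume c: "c \<in> space ?L"
    have "(\<lambda>x. ?plus (?T c) x) \<in> measurable ?L ?L"
      by (rule measurable_vec_plus) simp_all
    then show "(\<integral>\<^sup>+x. f (?plus (?T c) x) \<partial>?L) * g (?T c) = (\<integral>\<^sup>+x. f (?plus (?T c) x) * g (?T c) \<partial>?L)"
      by (intro nn_integral_multc[symmetric] measurable_compose[OF _ f])
  qed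
  also have "\<dots> = (\<integral>\<^sup>+x. (\<integral>\<^sup>+c. f (?plus (?T c) x) * g (?T c) \<partial>?L) \<partial>?L)"
    by (rule L.Fubini') measurable
  also have "\<dots> = (\<integral>\<^sup>+x. (\<integral>\<^sup>+c. f (?T c) * g (?minus (?T c) x) \<partial>?L) \<partial>?L)"
  proof (rule nn_integral_cong)
    fix x assume "x \<in> space ?L"
    \<comment> \<open>For this fixed x = T b the inner variable c is shifted by b, which moves the
      translation by x from the argument of f to that of g.\<close>
    then obtain b where b: "b \<in> space ?L" "?T b = x" using surj by blast
    have Tb: "(\<Sum>i<n. b i * h i k) = x k" if "k < n" for k
      using arg_cong[OF b(2), of "\<lambda>y. y k"] that by (simp add: lincomb_def)
    have m: "(\<lambda>c. ?minus (?T c) x) \<in> measurable ?L ?L"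
      using T \<open>x \<in> space ?L\<close> by (intro measurable_vec_minus) simp_all
    have "?T (\<lambda>k\<in>{..<n}. b k + c k) = ?plus (?T c) x" for c
      using Tb by (auto simp: lincomb_def fun_eq_iff distrib_right sum.distrib)
    moreover have "?minus (?plus (?T c) x) x = ?T c" for c
      by (auto simp: lincomb_def fun_eq_iff)
    moreover have "(\<lambda>c. f (?T c) * g (?minus (?T c) x)) \<in> borel_measurable ?L"
      by (intro borel_measurable_times_ennreal measurable_compose[OF T f] measurable_compose[OF m g])
    ultimately show "(\<integral>\<^sup>+c. f (?plus (?T c) x) * g (?T c) \<partial>?L) = (\<integral>\<^sup>+c. f (?T c) * g (?minus (?T c) x) \<partial>?L)"
      by (subst nn_integral_lebesgue_n_translate[symmetric, of "\<lambda>c. f (?T c) * g (?minus (?T c) x)" n b]) simp_all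
  qed
  also have "\<dots> = (\<integral>\<^sup>+c. (\<integral>\<^sup>+x. f (?T c) * g (?minus (?T c) x) \<partial>?L) \<partial>?L)"
    by (rule L.Fubini'[symmetric]) measurable
  also have "\<dots> = (\<integral>\<^sup>+c. f (?T c) * (\<integral>\<^sup>+x. g x \<partial>?L) \<partial>?L)"
  proof (rule nn_integral_cong)
    fix c assume c: "c \<in> space ?L"
    have "(\<lambda>x. ?minus (?T c) x) \<in> measurable ?L ?L"
      by (rule measurable_vec_minus) simp_all
    then show "(\<integral>\<^sup>+x. f (?T c) * g (?minus (?T c) x) \<partial>?L) = f (?T c) * (\<integral>\<^sup>+x. g x \<partial>?L)"
      by (subst nn_integral_cmult) (auto intro: measurable_compose[OF _ g] simp: nn_integral_lebesgue_n_reflect[OF g])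
  qed
  also have "\<dots> = (\<integral>\<^sup>+c. f (?T c) \<partial>?L) * (\<integral>\<^sup>+x. g x \<partial>?L)"
    by (rule nn_integral_multc) measurable
  finally show ?thesis .
qed

definition lin_indep :: "nat \<Rightarrow> (nat \<Rightarrow> nat \<Rightarrow> real) \<Rightarrow> bool" where
  "lin_indep n h \<longleftrightarrow> (\<forall>c. (\<forall>k<n. (\<Sum>i<n. c i * h i k) = 0) \<longrightarrow> (\<forall>i<n. c i = 0))"

lemma lin_indep_surj:
  assumes "lin_indep n h"
  shows "\<exists>b\<in>space (lebesgue_n n). \<forall>k<n. (\<Sum>i<n. b i * h i k) = x k"
proof -
  obtain c where c: "\<exists>i\<in>{..n}. c i \<noteq> 0" "\<forall>k\<in>{..<n}. (\<Sum>i\<le>n. c i * (if i = n then x k else h i k)) = 0"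
    using homogeneous_system_nontrivial[of "{..<n}" "{..n}" "\<lambda>i k. if i = n then x k else h i k"] by auto
  have s: "(\<Sum>i<n. c i * h i k) + c n * x k = 0" if "k < n" for k
    using c(2) that by (simp add: lessThan_Suc_atMost[symmetric])
  have "c n \<noteq> 0"
  proof
    assume 0: "c n = 0"
    then have "\<forall>i<n. c i = 0" using assms[unfolded lin_indep_def, rule_format, of c] s by auto
    then show False using 0 c(1) by (metis atMost_iff le_neq_implies_less)
  qed
  then have "(\<Sum>i<n. (- c i / c n) * h i k) = x k" if "k < n" for k
    using s[OF that] by (simp add: sum_divide_distrib[symmetric] sum_negf field_simps add_eq_0_iff)
  then show ?thesis
    by (intro bexI[of _ "\<lambda>i\<in>{..<n}. - c i / c n"]) (auto simp: space_lebesgue_n)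
qed

text \<open>The factor r is the inverse modulus of the determinant, but only 0 < r < \<infinity>
  matters. Proportionality against the unit cube identifies r as the volume of the preimage of that
  cube; it is positive, as otherwise the whole space would be null, and finite, as the inverse map
  is bounded.\<close>

lemma nn_integral_linear_substitution:
  assumes h: "lin_indep n h"
  shows "\<exists>r>0. \<forall>f\<in>borel_measurable (lebesgue_n n).
    (\<integral>\<^sup>+c. f (lincomb n {..<n} c h) \<partial>lebesgue_n n) = ennreal r * (\<integral>\<^sup>+x. f x \<partial>lebesgue_n n)"
proof -
  let ?L = "lebesgue_n n" and ?T = "\<lambda>c. lincomb n {..<n} c h"
  have T [measurable]: "?T \<in> measurable ?L ?L"
    by (rule measurable_lincomb_coeffs) (auto intro: measurable_lebesgue_n_component)
  have surj: "\<exists>b\<in>space ?L. ?T b = x" if "x \<in> space ?L" for x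
    using lin_indep_surj[OF h, of x] that
    by (auto simp: lincomb_def fun_eq_iff space_lebesgue_n PiE_iff extensional_def intro!: bexI)
  define Q where "Q = (PiE {..<n} (\<lambda>_. {0..1}) :: (nat \<Rightarrow> real) set)"
  have box: "emeasure ?L (PiE {..<n} (\<lambda>_. {-M..M})) = ennreal (2 * M) ^ n" if "M \<ge> 0" for M
    unfolding lebesgue_n_def using that by (subst lborel_product.emeasure_PiM) auto
  have Q: "Q \<in> sets ?L" "emeasure ?L Q = 1" unfolding Q_def lebesgue_n_def
    by (auto simp: lborel_product.emeasure_PiM intro!: sets_PiM_I_finite)
  define r where "r = (\<integral>\<^sup>+c. indicator Q (?T c) \<partial>?L)"
  have scal: "(\<integral>\<^sup>+c. f (?T c) \<partial>?L) = r * (\<integral>\<^sup>+x. f x \<partial>?L)" if f: "f \<in> borel_measurable ?L" for f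
    using nn_integral_linear_proportional[OF f, of "indicator Q" h] surj Q by (simp add: r_def mult.commute)
  have "r \<noteq> 0"
  proof
    assume "r = 0"
    then have "(\<integral>\<^sup>+c. 1 \<partial>?L) = 0" using scal[of "\<lambda>_. 1"] by simp
    then have "emeasure ?L (space ?L) = 0" by simp
    then have "emeasure ?L Q = 0" using emeasure_space[of ?L Q] by simp
    then show False using Q by simp
  qed
  moreover have "r < \<infinity>"
  proof -
    \<comment> \<open>Preimages of the unit vectors, that is, the rows of the inverse matrix; the
      sum M of their entries in modulus bounds the preimage of the cube.\<close>
    have "\<forall>k. \<exists>b. \<forall>l<n. (\<Sum>i<n. b i * h i l) = (if l = k then 1 else 0)"
    proof
      fix k show "\<exists>b. \<forall>l<n. (\<Sum>i<n. b i * h i l) = (if l = k then 1 else 0)"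
        using lin_indep_surj[OF h, of "\<lambda>l. if l = k then 1 else 0"] by (elim bexE) (rule exI)
    qed
    from choice[OF this] obtain b where b': "\<forall>k. \<forall>l<n. (\<Sum>i<n. b k i * h i l) = (if l = k then 1 else 0)"
      by (elim exE)
    have b: "(\<Sum>i<n. b k i * h i l) = (if l = k then 1 else 0)" if "l < n" for k l
      using b'[rule_format, OF that] .
    define M where "M = (\<Sum>i<n. \<Sum>k<n. \<bar>b k i\<bar>)"
    have M: "M \<ge> 0" by (auto simp: M_def intro!: sum_nonneg)
    have "c \<in> PiE {..<n} (\<lambda>_. {-M..M})" if c: "c \<in> space ?L" "?T c \<in> Q" for c
    proof -
      have Tc: "\<bar>\<Sum>i<n. c i * h i k\<bar> \<le> 1" if "k < n" for k
        using c(2) that by (force simp: Q_def PiE_iff lincomb_def)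
      have inv: "c i = (\<Sum>k<n. (\<Sum>j<n. c j * h j k) * b k i)" if i: "i < n" for i
      proof -
        have "(\<Sum>i<n. (c i - (\<Sum>k<n. (\<Sum>j<n. c j * h j k) * b k i)) * h i l) = 0" if l: "l < n" for l
        proof -
          define s where "s = (\<lambda>k. \<Sum>j<n. c j * h j k)"
          have "(\<Sum>i<n. (\<Sum>k<n. s k * b k i) * h i l) = (\<Sum>i<n. \<Sum>k<n. s k * (b k i * h i l))"
            by (simp add: sum_distrib_right mult.assoc)
          also have "\<dots> = (\<Sum>k<n. \<Sum>i<n. s k * (b k i * h i l))" by (rule sum.swap)
          also have "\<dots> = (\<Sum>k<n. s k * (\<Sum>i<n. b k i * h i l))" by (simp add: sum_distrib_left)
          also have "\<dots> = (\<Sum>k<n. if l = k then s k else 0)" by (rule sum.cong) (use b l in auto)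
          also have "\<dots> = (\<Sum>j<n. c j * h j l)" using l by (simp add: s_def)
          finally show ?thesis by (simp add: left_diff_distrib sum_subtractf s_def)
        qed
        then have "c i - (\<Sum>k<n. (\<Sum>j<n. c j * h j k) * b k i) = 0"
          using h[unfolded lin_indep_def, THEN spec, of "\<lambda>i. c i - (\<Sum>k<n. (\<Sum>j<n. c j * h j k) * b k i)"] i
          by simp
        then show ?thesis by simp
      qed
      have "\<bar>c i\<bar> \<le> M" if i: "i < n" for i
      proof -
        have "\<bar>c i\<bar> \<le> (\<Sum>k<n. \<bar>(\<Sum>j<n. c j * h j k) * b k i\<bar>)"
          unfolding inv[OF i] by (rule sum_abs)
        also have "\<dots> \<le> (\<Sum>k<n. 1 * \<bar>b k i\<bar>)"
          unfolding abs_mult by (intro sum_mono mult_right_mono Tc) auto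
        also have "\<dots> \<le> M" unfolding M_def
          using member_le_sum[of i "{..<n}" "\<lambda>i. \<Sum>k<n. \<bar>b k i\<bar>"] i by (simp add: sum_nonneg)
        finally show ?thesis .
      qed
      then show ?thesis using c by (force simp: PiE_iff space_lebesgue_n abs_le_iff)
    qed
    then have "r \<le> (\<integral>\<^sup>+c. indicator (PiE {..<n} (\<lambda>_. {-M..M})) c \<partial>?L)"
      unfolding r_def by (intro nn_integral_mono) (auto split: split_indicator)
    also have "\<dots> = ennreal (2 * M) ^ n"
      using box[OF M] by (subst nn_integral_indicator) (auto simp: lebesgue_n_def intro!: sets_PiM_I_finite)
    also have "\<dots> < \<infinity>" using M by (simp add: ennreal_power ennreal_less_top)
    finally show ?thesis .
  qed
  ultimately obtain r' where "r = ennreal r'" "r' > 0"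
    by (cases r) (auto simp: less_le)
  then show ?thesis using scal by auto
qed

section \<open>Measurability and volume of convex hulls\<close>

text \<open>Projection along a compact factor is a closed map. This makes events of the form "some
  coefficient vector solves a system depending on the sample" measurable without a measurable
  selection.\<close>

lemma closed_compact_zero_set:
  fixes F :: "'a::{first_countable_topology,t2_space} \<Rightarrow> 'b::{first_countable_topology,t2_space} \<Rightarrow> real"
  assumes "compact C" and F: "continuous_on UNIV (\<lambda>z. F (fst z) (snd z))"
  shows "closed {z. \<exists>c\<in>C. F z c = 0}"
proof (subst closed_sequential_limits, safe)
  fix z l assume z: "\<forall>m. z m \<in> {z. \<exists>c\<in>C. F z c = 0}" and lim: "z \<longlonglongrightarrow> l"
  then have "\<forall>m. \<exists>c. c \<in> C \<and> F (z m) c = 0" by auto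
  from choice[OF this] obtain c where c: "\<And>m. c m \<in> C" "\<And>m. F (z m) (c m) = 0" by auto
  have "seq_compact C" using assms(1) by (rule compact_imp_seq_compact)
  then obtain d r where d: "d \<in> C" "strict_mono (r :: nat \<Rightarrow> nat)" "(c \<circ> r) \<longlonglongrightarrow> d"
    using c(1) by (meson seq_compactE)
  have "(\<lambda>m. (z (r m), c (r m))) \<longlonglongrightarrow> (l, d)"
    using d lim LIMSEQ_subseq_LIMSEQ[OF lim d(2)] by (intro tendsto_Pair) (auto simp: comp_def)
  then have "(\<lambda>m. F (z (r m)) (c (r m))) \<longlonglongrightarrow> F l d"
    using F continuous_on_tendsto_compose[OF F, of "\<lambda>m. (z (r m), c (r m))" "(l, d)"] by simp
  then have "F l d = 0" using c(2) by (simp add: LIMSEQ_const_iff)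
  then show "\<exists>c\<in>C. F l c = 0" using d(1) by blast
qed

text \<open>The system is one equation, a vanishing sum of squares, that is jointly continuous in
  data and coefficients. Its solvability is a closed condition on the data, pulled back by a
  measurable map.\<close>

lemma sets_solution_set:
  fixes v :: "'z \<Rightarrow> nat \<Rightarrow> nat \<Rightarrow> real" and x :: "'z \<Rightarrow> nat \<Rightarrow> real"
  assumes I: "finite I" and C: "compact C"
    and v: "\<And>i k. i \<in> I \<Longrightarrow> k < n \<Longrightarrow> (\<lambda>z. v z i k) \<in> borel_measurable M"
    and x: "\<And>k. k < n \<Longrightarrow> (\<lambda>z. x z k) \<in> borel_measurable M"
  shows "{z\<in>space M. \<exists>c\<in>C. \<forall>k<n. x z k = (\<Sum>i\<in>I. c i * v z i k)} \<in> sets M"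
proof -
  define F :: "(nat \<Rightarrow> nat \<Rightarrow> real) \<times> (nat \<Rightarrow> real) \<Rightarrow> (nat \<Rightarrow> real) \<Rightarrow> real"
    where "F = (\<lambda>z c. \<Sum>k<n. (snd z k - (\<Sum>i\<in>I. c i * fst z i k))\<^sup>2)"
  have "continuous_on UNIV (\<lambda>z::((nat \<Rightarrow> nat \<Rightarrow> real) \<times> (nat \<Rightarrow> real)) \<times> (nat \<Rightarrow> real). snd (fst z) k)" for k
    by (rule continuous_on_product_then_coordinatewise) (intro continuous_intros)
  moreover have "continuous_on UNIV (\<lambda>z::((nat \<Rightarrow> nat \<Rightarrow> real) \<times> (nat \<Rightarrow> real)) \<times> (nat \<Rightarrow> real). snd z i)" for i
    by (rule continuous_on_product_then_coordinatewise) (intro continuous_intros)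
  moreover have "continuous_on UNIV (\<lambda>z::((nat \<Rightarrow> nat \<Rightarrow> real) \<times> (nat \<Rightarrow> real)) \<times> (nat \<Rightarrow> real). fst (fst z) i k)" for i k
    by (rule continuous_on_product_then_coordinatewise, rule continuous_on_product_then_coordinatewise)
      (intro continuous_intros)
  ultimately have "continuous_on UNIV (\<lambda>z. F (fst z) (snd z))"
    unfolding F_def
    by (intro continuous_on_sum continuous_on_power continuous_on_diff continuous_on_mult)
  then have cl: "closed {z. \<exists>c\<in>C. F z c = 0}" by (rule closed_compact_zero_set[OF C])
  \<comment> \<open>The data are set to zero outside the finite index range, so that they form a
    measurable map into a countable product of real lines with its Borel sets.\<close>
  define V where "V = (\<lambda>z. (\<lambda>i k. if i \<in> I \<and> k < n then v z i k else 0, \<lambda>k. if k < n then x z k else 0))"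
  have "(\<lambda>z. \<lambda>i k. if i \<in> I \<and> k < n then v z i k else 0) \<in> borel_measurable M"
  proof (intro measurable_coordinatewise_then_product)
    fix i k show "(\<lambda>z. if i \<in> I \<and> k < n then v z i k else 0) \<in> borel_measurable M"
      using v by (cases "i \<in> I \<and> k < n") auto
  qed
  moreover have "(\<lambda>z. \<lambda>k. if k < n then x z k else 0) \<in> borel_measurable M"
  proof (intro measurable_coordinatewise_then_product)
    fix k show "(\<lambda>z. if k < n then x z k else 0) \<in> borel_measurable M"
      using x by (cases "k < n") auto
  qed
  ultimately have "V \<in> borel_measurable M" unfolding V_def by (rule borel_measurable_Pair)
  then have "V -` {z. \<exists>c\<in>C. F z c = 0} \<inter> space M \<in> sets M"
    by (rule measurable_sets) (use cl in simp)
  also have "V -` {z. \<exists>c\<in>C. F z c = 0} \<inter> space M = {z\<in>space M. \<exists>c\<in>C. \<forall>k<n. x z k = (\<Sum>i\<in>I. c i * v z i k)}"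
  proof -
    have "F (V z) c = 0 \<longleftrightarrow> (\<forall>k<n. x z k = (\<Sum>i\<in>I. c i * v z i k))" for z c
      by (simp add: F_def V_def sum_nonneg_eq_0_iff Ball_def)
    then show ?thesis by auto
  qed
  finally show ?thesis .
qed

lemma compact_PiE_UNIV:
  fixes S :: "'i \<Rightarrow> 'a::topological_space set"
  assumes "\<And>i. compact (S i)"
  shows "compact (PiE UNIV S)"
  using assms compactin_PiE[of "\<lambda>_. euclidean" UNIV S]
  by (simp add: euclidean_product_topology)

text \<open>Coefficients are functions on all of \<open>nat\<close>; forcing them to be zero off I
  is what makes the box compact, by Tychonoff.\<close>

lemma compact_coeff_box: "compact {c :: nat \<Rightarrow> real. \<forall>i. c i \<in> (if i \<in> I then {-R..R} else {0})}"
proof -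
  have "compact (PiE UNIV (\<lambda>i::nat. if i \<in> I then {-R..R} else {0::real}))"
    by (rule compact_PiE_UNIV) auto
  moreover have "PiE UNIV (\<lambda>i::nat. if i \<in> I then {-R..R} else {0::real}) = {c. \<forall>i. c i \<in> (if i \<in> I then {-R..R} else {0})}"
    by (auto simp: PiE_UNIV_domain Pi_def)
  ultimately show ?thesis by simp
qed

lemma compact_weights:
  assumes "finite I"
  shows "compact {c\<in>weights I. \<forall>i::nat. i \<notin> I \<longrightarrow> c i = 0}"
proof -
  have coord: "continuous_on UNIV (\<lambda>c::nat \<Rightarrow> real. c i)" for i by simp
  have "closed ({c. (\<Sum>i\<in>I. c i) = (1::real)} \<inter> (\<Inter>i\<in>I. {c::nat \<Rightarrow> real. 0 \<le> c i}))"
    by (intro closed_Int closed_INT ballI closed_Collect_eq closed_Collect_le continuous_on_sum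
        continuous_on_const coord)
  then have "compact ({c. \<forall>i. c i \<in> (if i \<in> I then {-1..1} else {0::real})} \<inter>
      ({c. (\<Sum>i\<in>I. c i) = (1::real)} \<inter> (\<Inter>i\<in>I. {c. 0 \<le> c i})))"
    by (intro compact_Int_closed compact_coeff_box)
  also have "\<dots> = {c\<in>weights I. \<forall>i::nat. i \<notin> I \<longrightarrow> c i = 0}"
  proof -
    have "c i \<le> 1" if "c \<in> weights I" "i \<in> I" for c :: "nat \<Rightarrow> real" and i
      using that member_le_sum[of i I c] assms by (auto simp: weights_def)
    moreover have "- 1 \<le> c i" if "c \<in> weights I" "i \<in> I" for c :: "nat \<Rightarrow> real" and i
    proof -
      have "0 \<le> c i" using that by (auto simp: weights_def)
      then show ?thesis by simp
    qed
    ultimately show ?thesis by (auto simp: weights_def)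
  qed
  finally show ?thesis .
qed

lemma mem_chull_iff:
  assumes "finite I" "x \<in> space (lebesgue_n n)"
  shows "x \<in> chull n I v \<longleftrightarrow> (\<exists>c\<in>{c\<in>weights I. \<forall>i. i \<notin> I \<longrightarrow> c i = 0}. \<forall>k<n. x k = (\<Sum>i\<in>I. c i * v i k))"
proof
  assume "x \<in> chull n I v"
  then obtain c where c: "c \<in> weights I" "x = lincomb n I c v" by (auto simp: chull_def)
  show "\<exists>c\<in>{c\<in>weights I. \<forall>i. i \<notin> I \<longrightarrow> c i = 0}. \<forall>k<n. x k = (\<Sum>i\<in>I. c i * v i k)"
    by (rule bexI[of _ "\<lambda>i. if i \<in> I then c i else 0"])
       (use c weights_extend[OF assms(1) subset_refl c(1)] in \<open>auto simp: lincomb_def\<close>)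
next
  assume "\<exists>c\<in>{c\<in>weights I. \<forall>i. i \<notin> I \<longrightarrow> c i = 0}. \<forall>k<n. x k = (\<Sum>i\<in>I. c i * v i k)"
  then obtain c where c: "c \<in> weights I" "\<forall>k<n. x k = (\<Sum>i\<in>I. c i * v i k)" by auto
  then have "x = lincomb n I c v"
    using assms(2) by (auto simp: lincomb_def fun_eq_iff space_lebesgue_n PiE_iff extensional_def)
  then show "x \<in> chull n I v" using c by (auto simp: chull_def)
qed

lemma sets_mem_chull:
  fixes v :: "'z \<Rightarrow> nat \<Rightarrow> nat \<Rightarrow> real"
  assumes I: "finite I"
    and v: "\<And>i k. i \<in> I \<Longrightarrow> k < n \<Longrightarrow> (\<lambda>z. v z i k) \<in> borel_measurable M"
    and x: "x \<in> measurable M (lebesgue_n n)"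
  shows "{z\<in>space M. x z \<in> chull n I (v z)} \<in> sets M"
proof -
  have "{z\<in>space M. x z \<in> chull n I (v z)} = {z\<in>space M. \<exists>c\<in>{c\<in>weights I. \<forall>i. i \<notin> I \<longrightarrow> c i = 0}. \<forall>k<n. x z k = (\<Sum>i\<in>I. c i * v z i k)}"
    using mem_chull_iff[OF I measurable_space[OF x]] by auto
  also have "\<dots> \<in> sets M"
    using measurable_compose[OF x measurable_lebesgue_n_component]
    by (intro sets_solution_set[OF I compact_weights[OF I]] v) auto
  finally show ?thesis .
qed

lemma chull_reindex:
  assumes b: "bij_betw b J I"
  shows "chull n I v = chull n J (\<lambda>j. v (b j))"
proof (intro equalityI subsetI)
  fix x assume "x \<in> chull n I v"
  then obtain c where c: "c \<in> weights I" "x = lincomb n I c v" by (auto simp: chull_def)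
  have "(\<lambda>j. c (b j)) \<in> weights J"
    using c(1) sum.reindex_bij_betw[OF b, of c] b by (auto simp: weights_def bij_betw_def)
  moreover have "x = lincomb n J (\<lambda>j. c (b j)) (\<lambda>j. v (b j))"
    unfolding c(2) lincomb_eq_iff using sum.reindex_bij_betw[OF b, of "\<lambda>i. c i * v i _"] by simp
  ultimately show "x \<in> chull n J (\<lambda>j. v (b j))" by (auto simp: chull_def)
next
  fix x assume "x \<in> chull n J (\<lambda>j. v (b j))"
  then obtain c where c: "c \<in> weights J" "x = lincomb n J c (\<lambda>j. v (b j))" by (auto simp: chull_def)
  define d where "d = (\<lambda>i. c (inv_into J b i))"
  have d: "d (b j) = c j" if "j \<in> J" for j
    using that b by (simp add: d_def bij_betw_def)
  have sum: "(\<Sum>i\<in>I. d i * f i) = (\<Sum>j\<in>J. c j * f (b j))" for f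
    using sum.reindex_bij_betw[OF b, of "\<lambda>i. d i * f i"] d by (metis (mono_tags, lifting) sum.cong)
  have "0 \<le> d i" if "i \<in> I" for i
    using that b d c by (auto simp: bij_betw_def weights_def)
  then have "d \<in> weights I"
    using c(1) sum[of "\<lambda>_. 1"] by (simp add: weights_def)
  moreover have "x = lincomb n I d v" unfolding c(2) lincomb_eq_iff using sum by simp
  ultimately show "x \<in> chull n I v" by (auto simp: chull_def)
qed

text \<open>Compactness was shown for coefficients indexed by \<open>nat\<close>; the reindexing
  extends measurability to other index types, such as pairs of an index and a sign.\<close>

lemma sets_chull:
  assumes "finite I"
  shows "chull n I v \<in> sets (lebesgue_n n)"
proof -
  obtain b where b: "bij_betw b {..<card I} I"
    using ex_bij_betw_nat_finite[OF assms] by (auto simp: atLeast0LessThan)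
  have "{z\<in>space (lebesgue_n n). z \<in> chull n {..<card I} (\<lambda>j. v (b j))} \<in> sets (lebesgue_n n)"
    by (rule sets_mem_chull) auto
  moreover have "{z\<in>space (lebesgue_n n). z \<in> chull n {..<card I} (\<lambda>j. v (b j))} = chull n I v"
    unfolding chull_reindex[OF b] by (auto simp: chull_def)
  ultimately show ?thesis by simp
qed

lemma emeasure_chull_finite:
  assumes "finite I"
  shows "emeasure (lebesgue_n n) (chull n I v) < \<infinity>"
proof -
  define R where "R = (\<Sum>i\<in>I. \<Sum>k<n. \<bar>v i k\<bar>)"
  have R: "R \<ge> 0" by (auto simp: R_def intro!: sum_nonneg)
  have "chull n I v \<subseteq> PiE {..<n} (\<lambda>_. {-R..R})"
  proof
    fix x assume "x \<in> chull n I v"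
    then obtain c where c: "c \<in> weights I" "x = lincomb n I c v" by (auto simp: chull_def)
    have "\<bar>x k\<bar> \<le> R" if k: "k < n" for k
    proof -
      have "\<bar>x k\<bar> \<le> (\<Sum>i\<in>I. \<bar>c i * v i k\<bar>)" using c k by (simp add: lincomb_def)
      also have "\<dots> \<le> (\<Sum>i\<in>I. \<Sum>k<n. \<bar>v i k\<bar>)"
      proof (rule sum_mono)
        fix i assume i: "i \<in> I"
        have "c i \<le> 1" using c i member_le_sum[of i I c] assms by (auto simp: weights_def)
        moreover have "0 \<le> c i" using c i by (auto simp: weights_def)
        ultimately have "\<bar>c i * v i k\<bar> \<le> \<bar>v i k\<bar>" by (simp add: abs_mult mult_left_le_one_le)
        also have "\<dots> \<le> (\<Sum>k<n. \<bar>v i k\<bar>)" using k by (intro member_le_sum) auto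
        finally show "\<bar>c i * v i k\<bar> \<le> (\<Sum>k<n. \<bar>v i k\<bar>)" .
      qed
      finally show ?thesis by (simp add: R_def)
    qed
    then show "x \<in> PiE {..<n} (\<lambda>_. {-R..R})" using c by (force simp: PiE_iff abs_le_iff lincomb_def)
  qed
  then have "emeasure (lebesgue_n n) (chull n I v) \<le> emeasure (lebesgue_n n) (PiE {..<n} (\<lambda>_. {-R..R}))"
    by (intro emeasure_mono) (auto simp: lebesgue_n_def intro!: sets_PiM_I_finite)
  also have "\<dots> = (\<Prod>k<n. emeasure lborel {-R..R})"
    unfolding lebesgue_n_def by (rule lborel_product.emeasure_PiM) auto
  also have "\<dots> < \<infinity>" using R by (simp add: ennreal_power ennreal_less_top)
  finally show ?thesis .
qed

lemma dot_fun_upd: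
  assumes "k < n"
  shows "dot n u (x(k := y)) = u k * y + (\<Sum>i\<in>{..<n} - {k}. u i * x i)"
proof -
  have "dot n u (x(k := y)) = u k * (x(k := y)) k + (\<Sum>i\<in>{..<n} - {k}. u i * (x(k := y)) i)"
    unfolding dot_def using assms by (intro sum.remove) auto
  then show ?thesis by simp
qed

text \<open>Integrate first over coordinate k: each section of the slab is a one-dimensional set of
  measure at most e. Used with Lebesgue measure and e = 0 for hyperplanes, and with the Gaussian
  measure for slabs of positive width.\<close>

lemma emeasure_slab_le:
  assumes M: "product_sigma_finite (\<lambda>_::nat. M)" and sets [measurable_cong]: "sets M = sets borel"
    and k: "k < n" and le: "\<And>b. emeasure M {y\<in>space M. \<bar>u k * y + b\<bar> \<le> s} \<le> e"
  shows "emeasure (PiM {..<n} (\<lambda>_. M)) {x\<in>space (PiM {..<n} (\<lambda>_. M)). \<bar>dot n u x - t\<bar> \<le> s}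
    \<le> e * emeasure (PiM ({..<n} - {k}) (\<lambda>_. M)) (space (PiM ({..<n} - {k}) (\<lambda>_. M)))"
proof -
  interpret product_sigma_finite "\<lambda>_::nat. M" by fact
  let ?J = "{..<n} - {k}" and ?P = "PiM {..<n} (\<lambda>_. M)"
  let ?A = "{x\<in>space ?P. \<bar>dot n u x - t\<bar> \<le> s}"
  have ins: "{..<n} = insert k ?J" using k by auto
  have spM: "space M = UNIV" using sets_eq_imp_space_eq[OF sets] by simp
  have dot: "dot n u \<in> borel_measurable ?P"
    unfolding dot_def by (intro borel_measurable_sum borel_measurable_times borel_measurable_const)
      (use sets in \<open>auto intro!: measurable_component_singleton[THEN measurable_compose] simp: measurable_ident_sets\<close>)
  have A: "?A \<in> sets ?P"
    by (intro borel_measurable_le borel_measurable_abs borel_measurable_diff dot borel_measurable_const)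
  have "emeasure ?P ?A = (\<integral>\<^sup>+x. indicator ?A x \<partial>?P)" using A by simp
  also have "\<dots> = (\<integral>\<^sup>+x. (\<integral>\<^sup>+y. indicator ?A (x(k := y)) \<partial>M) \<partial>PiM ?J (\<lambda>_. M))"
    using product_nn_integral_insert[of ?J k "indicator ?A"] A unfolding ins[symmetric] by simp
  also have "\<dots> \<le> (\<integral>\<^sup>+x. e \<partial>PiM ?J (\<lambda>_. M))"
  proof (rule nn_integral_mono)
    fix x assume x: "x \<in> space (PiM ?J (\<lambda>_. M))"
    define b where "b = (\<Sum>i\<in>?J. u i * x i) - t"
    have "x(k := y) \<in> space ?P" for y
      using x k by (auto simp: space_PiM PiE_iff extensional_def spM)
    then have "(\<integral>\<^sup>+y. indicator ?A (x(k := y)) \<partial>M) = (\<integral>\<^sup>+y. indicator {y\<in>space M. \<bar>u k * y + b\<bar> \<le> s} y \<partial>M)"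
      by (intro nn_integral_cong) (auto simp: indicator_def dot_fun_upd[OF k] b_def algebra_simps spM)
    also have "\<dots> = emeasure M {y\<in>space M. \<bar>u k * y + b\<bar> \<le> s}"
      by (intro nn_integral_indicator) measurable
    also have "\<dots> \<le> e" by (rule le)
    finally show "(\<integral>\<^sup>+y. indicator ?A (x(k := y)) \<partial>M) \<le> e" .
  qed
  also have "\<dots> = e * emeasure (PiM ?J (\<lambda>_. M)) (space (PiM ?J (\<lambda>_. M)))" by simp
  finally show ?thesis .
qed

lemma emeasure_hyperplane:
  assumes "k < n" "u k \<noteq> 0"
  shows "emeasure (lebesgue_n n) {x\<in>space (lebesgue_n n). dot n u x = t} = 0"
proof -
  have "{y. \<bar>u k * y + b\<bar> \<le> 0} = {- b / u k}" for b using assms by (auto simp: field_simps add_eq_0_iff)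
  then have z: "emeasure lborel {y\<in>space lborel. \<bar>u k * y + b\<bar> \<le> 0} \<le> 0" for b by simp
  have "emeasure (PiM {..<n} (\<lambda>_. lborel)) {x\<in>space (PiM {..<n} (\<lambda>_. lborel)). \<bar>dot n u x - t\<bar> \<le> 0}
    \<le> 0 * emeasure (PiM ({..<n} - {k}) (\<lambda>_. lborel :: real measure)) (space (PiM ({..<n} - {k}) (\<lambda>_. lborel :: real measure)))"
    by (rule emeasure_slab_le[where k=k]) (use z assms lborel_product.product_sigma_finite_axioms in simp_all)
  then show ?thesis by (simp add: lebesgue_n_def)
qed

lemma null_chull:
  assumes B: "finite B" "card B \<le> n"
  shows "chull n B v \<in> null_sets (lebesgue_n n)"
proof (cases "B = {}")
  case True
  then show ?thesis by (simp add: chull_def weights_def)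
next
  case False
  then obtain i0 where i0: "i0 \<in> B" by auto
  \<comment> \<open>A hyperplane through all points of B: n + 1 unknowns for at most n equations,
    where w n is the level and enters with coefficient -1.\<close>
  obtain w where w: "\<exists>k\<in>{..n}. w k \<noteq> 0" "\<forall>i\<in>B. (\<Sum>k\<le>n. w k * (if k = n then -1 else v i k)) = 0"
    using homogeneous_system_nontrivial[of B "{..n}" "\<lambda>k i. if k = n then -1 else v i k"] B by auto
  have w': "dot n w (v i) = w n" if "i \<in> B" for i
    using w(2) that by (simp add: lessThan_Suc_atMost[symmetric] dot_def)
  obtain k where k: "k < n" "w k \<noteq> 0"
  proof (cases "\<exists>k<n. w k \<noteq> 0")
    case False
    then have "w n = 0" using w'[OF i0] by (simp add: dot_def)
    then show ?thesis using False w(1) by (metis atMost_iff le_neq_implies_less)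
  qed (use that in auto)
  have "chull n B v \<subseteq> {x\<in>space (lebesgue_n n). dot n w x = w n}"
  proof
    fix x assume "x \<in> chull n B v"
    then obtain c where c: "c \<in> weights B" "x = lincomb n B c v" by (auto simp: chull_def)
    have "dot n w x = (\<Sum>k<n. \<Sum>i\<in>B. c i * (w k * v i k))"
      unfolding c dot_def by (simp add: lincomb_def sum_distrib_left mult.left_commute)
    also have "\<dots> = (\<Sum>i\<in>B. c i * dot n w (v i))"
      unfolding dot_def sum_distrib_left by (rule sum.swap)
    also have "\<dots> = (\<Sum>i\<in>B. c i) * w n" using w' by (simp add: sum_distrib_right)
    finally show "x \<in> {x\<in>space (lebesgue_n n). dot n w x = w n}" using c by (simp add: weights_def)
  qed
  moreover have "{x\<in>space (lebesgue_n n). dot n w x = w n} \<in> sets (lebesgue_n n)"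
    unfolding dot_def by measurable
  ultimately have "emeasure (lebesgue_n n) (chull n B v) \<le> emeasure (lebesgue_n n) {x\<in>space (lebesgue_n n). dot n w x = w n}"
    by (rule emeasure_mono)
  then show ?thesis using emeasure_hyperplane[where u=w, OF k] sets_chull[OF B(1), of n v] by (simp add: null_setsI)
qed

section \<open>Second moments of a simplex\<close>

definition corner :: "nat \<Rightarrow> (nat \<Rightarrow> real) set" where
  "corner n = {c\<in>space (lebesgue_n n). (\<forall>i<n. 0 \<le> c i) \<and> (\<Sum>i<n. c i) \<le> 1}"

definition bary :: "nat \<Rightarrow> (nat \<Rightarrow> real) \<Rightarrow> nat \<Rightarrow> real" where
  "bary n c i = (if i < n then c i else 1 - (\<Sum>i<n. c i))"

lemma sets_corner [measurable]: "corner n \<in> sets (lebesgue_n n)"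
  unfolding corner_def by measurable

lemma measurable_bary [measurable]: "(\<lambda>c. bary n c i) \<in> borel_measurable (lebesgue_n n)"
  unfolding bary_def by (cases "i < n") simp_all

lemma bary_corner:
  assumes "c \<in> corner n"
  shows "0 \<le> bary n c i" "bary n c i \<le> 1" "(\<Sum>i\<le>n. bary n c i) = 1"
proof -
  have c: "\<And>i. i < n \<Longrightarrow> 0 \<le> c i" "(\<Sum>i<n. c i) \<le> 1" using assms by (auto simp: corner_def)
  show "0 \<le> bary n c i" using c by (auto simp: bary_def)
  have "c i \<le> (\<Sum>i<n. c i)" if "i < n" using that c by (intro member_le_sum) auto
  then show "bary n c i \<le> 1" using c by (auto simp: bary_def intro: order_trans sum_nonneg)
  show "(\<Sum>i\<le>n. bary n c i) = 1" by (simp add: lessThan_Suc_atMost[symmetric] bary_def)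
qed

lemma emeasure_corner_finite: "emeasure (lebesgue_n n) (corner n) < \<infinity>"
proof -
  have "corner n \<subseteq> PiE {..<n} (\<lambda>_. {0..1})"
  proof
    fix c assume c: "c \<in> corner n"
    have "0 \<le> c i \<and> c i \<le> 1" if "i < n" for i using bary_corner(1,2)[OF c, of i] that by (simp add: bary_def)
    then show "c \<in> PiE {..<n} (\<lambda>_. {0..1})" using c by (auto simp: corner_def PiE_iff space_lebesgue_n)
  qed
  then have "emeasure (lebesgue_n n) (corner n) \<le> emeasure (lebesgue_n n) (PiE {..<n} (\<lambda>_. {0..1}))"
    by (intro emeasure_mono) (auto simp: lebesgue_n_def intro!: sets_PiM_I_finite)
  also have "\<dots> = (\<Prod>k<n. emeasure lborel {0..1::real})"
    unfolding lebesgue_n_def by (rule lborel_product.emeasure_PiM) auto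
  also have "\<dots> < \<infinity>" by simp
  finally show ?thesis .
qed

lemma sum_fun_upd_lessThan:
  fixes x :: "nat \<Rightarrow> real"
  assumes "j < n"
  shows "(\<Sum>i<n. (x(j := y)) i) = y + (\<Sum>i\<in>{..<n} - {j}. x i)"
proof -
  have "(\<Sum>i<n. (x(j := y)) i) = (x(j := y)) j + (\<Sum>i\<in>{..<n} - {j}. (x(j := y)) i)"
    using assms by (intro sum.remove) auto
  then show ?thesis by simp
qed

text \<open>By Fubini it suffices to compare f and g on the fibres along coordinate j. Such a fibre
  is a segment {0..t} on which the barycentric coordinates j and n are y and t - y and the others
  are constant.\<close>

lemma nn_integral_corner_eqI:
  fixes f g :: "(nat \<Rightarrow> real) \<Rightarrow> real"
  assumes j: "j < n"
    and [measurable]: "f \<in> borel_measurable (lebesgue_n n)" "g \<in> borel_measurable (lebesgue_n n)"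
    and eq: "\<And>x t. \<lbrakk>\<And>i. i < n \<Longrightarrow> i \<noteq> j \<Longrightarrow> 0 \<le> x i; t = 1 - (\<Sum>i\<in>{..<n} - {j}. x i); 0 \<le> t\<rbrakk> \<Longrightarrow>
      (\<integral>\<^sup>+y. ennreal (f (x(j := y))) * indicator {0..t} y \<partial>lborel) = (\<integral>\<^sup>+y. ennreal (g (x(j := y))) * indicator {0..t} y \<partial>lborel)"
  shows "(\<integral>\<^sup>+c. ennreal (f c) * indicator (corner n) c \<partial>lebesgue_n n) = (\<integral>\<^sup>+c. ennreal (g c) * indicator (corner n) c \<partial>lebesgue_n n)"
proof -
  let ?J = "{..<n} - {j}"
  have ins: "{..<n} = insert j ?J" using j by auto
  have fub: "(\<integral>\<^sup>+c. ennreal (f c) * indicator (corner n) c \<partial>lebesgue_n n)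
    = (\<integral>\<^sup>+x. (\<integral>\<^sup>+y. ennreal (f (x(j := y))) * indicator (corner n) (x(j := y)) \<partial>lborel) \<partial>PiM ?J (\<lambda>_. lborel))"
    if [measurable]: "f \<in> borel_measurable (lebesgue_n n)" for f
  proof -
    have "(\<lambda>c. ennreal (f c) * indicator (corner n) c) \<in> borel_measurable (lebesgue_n n)" by measurable
    then show ?thesis
      using lborel_product.product_nn_integral_insert[of ?J j "\<lambda>c. ennreal (f c) * indicator (corner n) c"]
      unfolding ins[symmetric] lebesgue_n_def by simp
  qed
  have "(\<integral>\<^sup>+y. ennreal (f (x(j := y))) * indicator (corner n) (x(j := y)) \<partial>lborel)
      = (\<integral>\<^sup>+y. ennreal (g (x(j := y))) * indicator (corner n) (x(j := y)) \<partial>lborel)"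
    if x: "x \<in> space (PiM ?J (\<lambda>_. lborel))" for x
  proof -
    define t where "t = 1 - (\<Sum>i\<in>?J. x i)"
    have sp: "x(j := y) \<in> space (lebesgue_n n)" for y
      using x j by (auto simp: space_lebesgue_n space_PiM PiE_iff extensional_def)
    have mem: "x(j := y) \<in> corner n \<longleftrightarrow> (\<forall>i\<in>?J. 0 \<le> x i) \<and> 0 \<le> y \<and> y \<le> t" for y
    proof -
      have "(\<forall>i<n. 0 \<le> (x(j := y)) i) \<longleftrightarrow> (\<forall>i\<in>?J. 0 \<le> x i) \<and> 0 \<le> y" using j by auto
      then show ?thesis
        unfolding corner_def mem_Collect_eq sum_fun_upd_lessThan[OF j] using sp[of y] by (auto simp: t_def)
    qed
    show ?thesis
    proof (cases "(\<forall>i\<in>?J. 0 \<le> x i) \<and> 0 \<le> t")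
      case True
      then have ind: "(indicator (corner n) (x(j := y)) :: ennreal) = indicator {0..t} y" for y
        by (auto simp: indicator_def mem)
      show ?thesis unfolding ind by (rule eq) (use True t_def in auto)
    next
      case False
      then have "(indicator (corner n) (x(j := y)) :: ennreal) = 0" for y
        by (auto simp: indicator_def mem)
      then show ?thesis by simp
    qed
  qed
  then show ?thesis unfolding fub[OF assms(2)] fub[OF assms(3)] by (rule nn_integral_cong)
qed

lemma nn_integral_poly_Icc:
  fixes a b c t s :: real
  assumes "0 \<le> t" "\<And>y. 0 \<le> y \<Longrightarrow> y \<le> t \<Longrightarrow> 0 \<le> f y" "\<And>y. f y = a + b * y + c * y\<^sup>2"
    "s = a * t + b * t\<^sup>2 / 2 + c * t ^ 3 / 3"
  shows "(\<integral>\<^sup>+y. ennreal (f y) * indicator {0..t} y \<partial>lborel) = ennreal s"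
proof -
  have "(\<integral>\<^sup>+y. ennreal (a + b * y + c * y\<^sup>2) * indicator {0..t} y \<partial>lborel)
      = ennreal ((a * t + b * t\<^sup>2 / 2 + c * t ^ 3 / 3) - (a * 0 + b * 0\<^sup>2 / 2 + c * 0 ^ 3 / 3))"
    using assms(1,2) unfolding assms(3)
    by (intro nn_integral_FTC_Icc) (auto intro!: derivative_eq_intros simp: power2_eq_square)
  then show ?thesis by (simp add: assms(3,4))
qed

definition corner_moment :: "nat \<Rightarrow> nat \<Rightarrow> nat \<Rightarrow> real" where
  "corner_moment n i j = (LINT c|lebesgue_n n. bary n c i * bary n c j * indicator (corner n) c)"

lemma corner_moment_nn:
  "corner_moment n i j = enn2real (\<integral>\<^sup>+c. ennreal (bary n c i * bary n c j) * indicator (corner n) c \<partial>lebesgue_n n)"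
proof -
  have "corner_moment n i j = enn2real (\<integral>\<^sup>+c. ennreal (bary n c i * bary n c j * indicator (corner n) c) \<partial>lebesgue_n n)"
    unfolding corner_moment_def
    by (intro integral_eq_nn_integral) (auto simp: bary_corner indicator_def intro!: AE_I2)
  also have "(\<lambda>c. ennreal (bary n c i * bary n c j * indicator (corner n) c)) = (\<lambda>c. ennreal (bary n c i * bary n c j) * indicator (corner n) c)"
    by (auto simp: indicator_def fun_eq_iff)
  finally show ?thesis .
qed

lemma integrable_corner_moment:
  "integrable (lebesgue_n n) (\<lambda>c. bary n c i * bary n c j * indicator (corner n) c)"
proof (rule Bochner_Integration.integrable_bound)
  show "integrable (lebesgue_n n) (indicator (corner n) :: _ \<Rightarrow> real)"
    using emeasure_corner_finite by simp
  show "AE c in lebesgue_n n. norm (bary n c i * bary n c j * indicator (corner n) c) \<le> norm (indicator (corner n) c :: real)"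
    by (intro AE_I2) (auto simp: indicator_def abs_mult bary_corner intro!: mult_le_one)
qed measurable

text \<open>On a fibre, y^2, (t - y)^2 and 2 y (t - y) all have integral t^3 / 3, while y and t - y
  have the same integral. So moments are compared without evaluating any of them.\<close>

lemma corner_moment_rel:
  assumes "j < n"
  shows "corner_moment n j j = 2 * corner_moment n j n" "corner_moment n n n = 2 * corner_moment n j n"
    "i < n \<Longrightarrow> i \<noteq> j \<Longrightarrow> corner_moment n i j = corner_moment n i n"
proof -
  let ?N = "\<lambda>f. \<integral>\<^sup>+c. ennreal (f c) * indicator (corner n) c \<partial>lebesgue_n n"
  have b: "bary n (x(j := y)) j = y" "bary n (x(j := y)) n = t - y" "i < n \<Longrightarrow> i \<noteq> j \<Longrightarrow> bary n (x(j := y)) i = x i"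
    if "t = 1 - (\<Sum>i\<in>{..<n} - {j}. x i)" for x y t i
    using assms that sum_fun_upd_lessThan[OF assms, of x y] by (auto simp: bary_def simp del: fun_upd_apply) (auto)
  have two: "?N (\<lambda>c. 2 * (bary n c j * bary n c n)) = 2 * ?N (\<lambda>c. bary n c j * bary n c n)"
    by (subst nn_integral_cmult[symmetric]) (auto intro!: nn_integral_cong simp: ennreal_mult' mult.assoc)
  have q: "(\<integral>\<^sup>+y. ennreal (2 * (y * (t - y))) * indicator {0..t} y \<partial>lborel) = ennreal (t ^ 3 / 3)"
    and q1: "(\<integral>\<^sup>+y. ennreal (y * y) * indicator {0..t} y \<partial>lborel) = ennreal (t ^ 3 / 3)"
    and q2: "(\<integral>\<^sup>+y. ennreal ((t - y) * (t - y)) * indicator {0..t} y \<partial>lborel) = ennreal (t ^ 3 / 3)"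
    and q3: "0 \<le> r \<Longrightarrow> (\<integral>\<^sup>+y. ennreal (r * y) * indicator {0..t} y \<partial>lborel) = ennreal (r * t\<^sup>2 / 2)"
    and q4: "0 \<le> r \<Longrightarrow> (\<integral>\<^sup>+y. ennreal (r * (t - y)) * indicator {0..t} y \<partial>lborel) = ennreal (r * t\<^sup>2 / 2)"
    if t: "0 \<le> t" for t r :: real
  proof -
    show "(\<integral>\<^sup>+y. ennreal (2 * (y * (t - y))) * indicator {0..t} y \<partial>lborel) = ennreal (t ^ 3 / 3)"
      by (rule nn_integral_poly_Icc[OF t, where a=0 and b="2 * t" and c="-2"], use t in simp,
          simp add: power2_eq_square algebra_simps, simp add: power2_eq_square power3_eq_cube field_simps)
    show "(\<integral>\<^sup>+y. ennreal (y * y) * indicator {0..t} y \<partial>lborel) = ennreal (t ^ 3 / 3)"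
      by (rule nn_integral_poly_Icc[OF t, where a=0 and b=0 and c=1], use t in simp,
          simp add: power2_eq_square algebra_simps, simp add: power2_eq_square power3_eq_cube field_simps)
    show "(\<integral>\<^sup>+y. ennreal ((t - y) * (t - y)) * indicator {0..t} y \<partial>lborel) = ennreal (t ^ 3 / 3)"
      by (rule nn_integral_poly_Icc[OF t, where a="t\<^sup>2" and b="- 2 * t" and c=1], use t in simp,
          simp add: power2_eq_square algebra_simps, simp add: power2_eq_square power3_eq_cube field_simps)
    show "(\<integral>\<^sup>+y. ennreal (r * y) * indicator {0..t} y \<partial>lborel) = ennreal (r * t\<^sup>2 / 2)" if "0 \<le> r"
      by (rule nn_integral_poly_Icc[OF t, where a=0 and b=r and c=0], use t that in simp,
          simp add: power2_eq_square algebra_simps, simp add: power2_eq_square power3_eq_cube field_simps)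
    show "(\<integral>\<^sup>+y. ennreal (r * (t - y)) * indicator {0..t} y \<partial>lborel) = ennreal (r * t\<^sup>2 / 2)" if "0 \<le> r"
      by (rule nn_integral_poly_Icc[OF t, where a="r * t" and b="- r" and c=0], use t that in simp,
          simp add: power2_eq_square algebra_simps, simp add: power2_eq_square power3_eq_cube field_simps)
  qed
  have "?N (\<lambda>c. bary n c j * bary n c j) = ?N (\<lambda>c. 2 * (bary n c j * bary n c n))"
    by (rule nn_integral_corner_eqI[OF assms]; (measurable)?) (simp only: b q q1)
  then show "corner_moment n j j = 2 * corner_moment n j n"
    unfolding corner_moment_nn two by (simp add: enn2real_mult)
  have "?N (\<lambda>c. bary n c n * bary n c n) = ?N (\<lambda>c. 2 * (bary n c j * bary n c n))"
    by (rule nn_integral_corner_eqI[OF assms]; (measurable)?) (simp only: b q q2)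
  then show "corner_moment n n n = 2 * corner_moment n j n"
    unfolding corner_moment_nn two by (simp add: enn2real_mult)
  show "corner_moment n i j = corner_moment n i n" if i: "i < n" "i \<noteq> j"
  proof -
    have bi: "bary n (x(j := y)) i = x i" for x y using i by (simp add: bary_def)
    have "?N (\<lambda>c. bary n c i * bary n c j) = ?N (\<lambda>c. bary n c i * bary n c n)"
    proof (rule nn_integral_corner_eqI[OF assms])
      fix x :: "nat \<Rightarrow> real" and t assume x: "\<And>i. i < n \<Longrightarrow> i \<noteq> j \<Longrightarrow> 0 \<le> x i" "t = 1 - (\<Sum>i\<in>{..<n} - {j}. x i)" "0 \<le> t"
      show "(\<integral>\<^sup>+y. ennreal (bary n (x(j := y)) i * bary n (x(j := y)) j) * indicator {0..t} y \<partial>lborel)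
          = (\<integral>\<^sup>+y. ennreal (bary n (x(j := y)) i * bary n (x(j := y)) n) * indicator {0..t} y \<partial>lborel)"
        unfolding b(1)[OF x(2)] b(2)[OF x(2)] bi using q3[OF x(3) x(1)[OF i]] q4[OF x(3) x(1)[OF i]] by simp
    qed measurable
    then show ?thesis unfolding corner_moment_nn by simp
  qed
qed

lemma corner_moment_commute: "corner_moment n i j = corner_moment n j i"
  by (simp add: corner_moment_def mult.commute)

text \<open>The relations leave one unknown b: off-diagonal moments equal b, diagonal ones 2 b.
  Since the barycentric coordinates sum to 1, the n + 1 by n + 1 moments sum to the volume, which
  gives (n + 1) (n + 2) b.\<close>

lemma corner_moment_eq:
  assumes "i \<le> n" "j \<le> n"
  shows "corner_moment n i j = (if i = j then 2 else 1) * measure (lebesgue_n n) (corner n) / ((real n + 1) * (real n + 2))"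
proof -
  define b where "b = corner_moment n n n / 2"
  have bj: "corner_moment n j n = b" "corner_moment n j j = 2 * b" if "j < n" for j
    using corner_moment_rel(1,2)[OF that] by (auto simp: b_def)
  have m: "corner_moment n i j = (if i = j then 2 else 1) * b" if "i \<le> n" "j \<le> n" for i j
  proof -
    consider "i = n" "j = n" | "i = n" "j < n" | "i < n" "j = n" | "i < n" "j < n" "i = j" | "i < n" "j < n" "i \<noteq> j"
      using \<open>i \<le> n\<close> \<open>j \<le> n\<close> by linarith
    then show ?thesis
    proof cases
      case 1 then show ?thesis by (simp add: b_def)
    next
      case 2 then show ?thesis using bj(1)[of j] by (subst corner_moment_commute) simp
    next
      case 5 then show ?thesis using corner_moment_rel(3)[of j n i] bj(1)[of i] by simp
    qed (simp_all add: bj)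
  qed
  have "measure (lebesgue_n n) (corner n) = (LINT c|lebesgue_n n. indicator (corner n) c)" by simp
  also have "\<dots> = (LINT c|lebesgue_n n. (\<Sum>i\<le>n. \<Sum>j\<le>n. bary n c i * bary n c j * indicator (corner n) c))"
  proof (rule Bochner_Integration.integral_cong[OF refl])
    fix c show "(indicator (corner n) c :: real) = (\<Sum>i\<le>n. \<Sum>j\<le>n. bary n c i * bary n c j * indicator (corner n) c)"
      using bary_corner(3)[of c n]
      by (cases "c \<in> corner n") (simp_all add: sum_distrib_left[symmetric])
  qed
  also have "\<dots> = (\<Sum>i\<le>n. \<Sum>j\<le>n. corner_moment n i j)"
    unfolding corner_moment_def by (simp only: Bochner_Integration.integral_sum Bochner_Integration.integrable_sum integrable_corner_moment)
  also have "\<dots> = (\<Sum>i\<le>n. \<Sum>j\<le>n. (if i = j then 2 else 1) * b)" using m by simp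
  also have "\<dots> = (\<Sum>i\<le>n. (\<Sum>j\<le>n. b + (if i = j then b else 0)))"
    by (intro sum.cong) auto
  also have "\<dots> = (real n + 1) * ((real n + 2) * b)"
    by (simp add: sum.distrib algebra_simps)
  finally have "measure (lebesgue_n n) (corner n) = ((real n + 1) * (real n + 2)) * b" by (simp only: mult.assoc)
  moreover have "(real n + 1) * (real n + 2) \<noteq> 0" by (simp add: add_eq_0_iff)
  ultimately have "b = measure (lebesgue_n n) (corner n) / ((real n + 1) * (real n + 2))" by simp
  then show ?thesis using m[OF assms] by simp
qed

lemma integral_corner_sqnorm:
  fixes p :: "nat \<Rightarrow> nat \<Rightarrow> real"
  shows "integrable (lebesgue_n n) (\<lambda>c. sqnorm_n n (lincomb n {..n} (bary n c) p) * indicator (corner n) c)" (is ?int)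
    and "(LINT c|lebesgue_n n. sqnorm_n n (lincomb n {..n} (bary n c) p) * indicator (corner n) c)
    = (sqnorm_n n (lincomb n {..n} (\<lambda>_. 1) p) + (\<Sum>i\<le>n. sqnorm_n n (p i))) / ((real n + 1) * (real n + 2))
       * measure (lebesgue_n n) (corner n)" (is ?eq)
proof -
  have sq: "(\<Sum>i\<le>n. a i)\<^sup>2 = (\<Sum>i\<le>n. \<Sum>j\<le>n. a i * a j)" for a :: "nat \<Rightarrow> real"
    by (simp add: power2_eq_square sum_product)
  have expand: "sqnorm_n n (lincomb n {..n} (bary n c) p) * indicator (corner n) c
      = (\<Sum>k<n. \<Sum>i\<le>n. \<Sum>j\<le>n. (p i k * p j k) * (bary n c i * bary n c j * indicator (corner n) c))" for c
    unfolding sqnorm_n_def sum_distrib_right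
    by (intro sum.cong refl) (simp add: lincomb_def sq sum_distrib_left sum_distrib_right mult_ac)
  show ?int unfolding expand
    by (intro Bochner_Integration.integrable_sum integrable_mult_right integrable_corner_moment)
  define b where "b = measure (lebesgue_n n) (corner n) / ((real n + 1) * (real n + 2))"
  have "(LINT c|lebesgue_n n. sqnorm_n n (lincomb n {..n} (bary n c) p) * indicator (corner n) c)
      = (\<Sum>k<n. \<Sum>i\<le>n. \<Sum>j\<le>n. (p i k * p j k) * corner_moment n i j)"
    unfolding expand corner_moment_def
    by (simp only: Bochner_Integration.integral_sum Bochner_Integration.integrable_sum integrable_mult_right
        integrable_corner_moment integral_mult_right_zero)
  also have "\<dots> = (\<Sum>k<n. \<Sum>i\<le>n. \<Sum>j\<le>n. (p i k * p j k) * b + (if i = j then p i k * p j k * b else 0))"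
    by (intro sum.cong refl) (auto simp: corner_moment_eq b_def)
  also have "\<dots> = (\<Sum>k<n. (\<Sum>i\<le>n. p i k)\<^sup>2 * b + (\<Sum>i\<le>n. (p i k)\<^sup>2) * b)"
    unfolding sq by (intro sum.cong refl) (simp add: sum.distrib sum_distrib_right power2_eq_square)
  also have "\<dots> = (sqnorm_n n (lincomb n {..n} (\<lambda>_. 1) p) + (\<Sum>i\<le>n. sqnorm_n n (p i))) * b"
  proof -
    have "(\<Sum>i\<le>n. \<Sum>k<n. (p i k)\<^sup>2) = (\<Sum>k<n. \<Sum>i\<le>n. (p i k)\<^sup>2)" by (rule sum.swap)
    then show ?thesis
      unfolding sqnorm_n_def by (simp add: sum.distrib sum_distrib_right distrib_right lincomb_def)
  qed
  finally show ?eq by (simp add: b_def)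
qed

section \<open>Second moments of arbitrary simplices and of hulls\<close>

definition vertex_moment :: "nat \<Rightarrow> 'i set \<Rightarrow> ('i \<Rightarrow> nat \<Rightarrow> real) \<Rightarrow> real" where
  "vertex_moment n B v = (sqnorm_n n (lincomb n B (\<lambda>_. 1) v) + (\<Sum>i\<in>B. sqnorm_n n (v i))) / ((real n + 1) * (real n + 2))"

lemma sqnorm_n_nonneg [simp]: "0 \<le> sqnorm_n n x"
  by (simp add: sqnorm_n_def sum_nonneg)

lemma measurable_sqnorm_n [measurable]: "sqnorm_n n \<in> borel_measurable (lebesgue_n n)"
  unfolding sqnorm_n_def by measurable

lemma bary_sum:
  fixes p :: "nat \<Rightarrow> nat \<Rightarrow> real"
  shows "(\<Sum>i\<le>n. bary n c i * p i k) = p n k + (\<Sum>i<n. c i * (p i k - p n k))"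
  by (simp add: lessThan_Suc_atMost[symmetric] bary_def algebra_simps sum_subtractf sum_distrib_left)

text \<open>The affine map T carries the standard simplex onto the hull. The unknown Jacobian factor
  r enters the moment and the volume alike, and being positive it cancels.\<close>

lemma cell_second_moment_nat:
  fixes p :: "nat \<Rightarrow> nat \<Rightarrow> real"
  assumes indep: "aff_indep n {..n} p"
  shows "(\<integral>\<^sup>+x. ennreal (sqnorm_n n x) * indicator (chull n {..n} p) x \<partial>lebesgue_n n)
    = ennreal (vertex_moment n {..n} p) * emeasure (lebesgue_n n) (chull n {..n} p)"
proof -
  let ?L = "lebesgue_n n" and ?K = "chull n {..n} p"
  define h where "h = (\<lambda>i k. p i k - p n k)"
  define T where "T = (\<lambda>c. lincomb n {..n} (bary n c) p)"
  have T_eq: "T c = (\<lambda>k\<in>{..<n}. p n k + lincomb n {..<n} c h k)" for c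
    unfolding T_def by (auto simp: lincomb_def bary_sum h_def)
  have "lin_indep n h" unfolding lin_indep_def
  proof (intro allI impI)
    fix c i assume c: "\<forall>k<n. (\<Sum>i<n. c i * h i k) = 0" and i: "i < n"
    \<comment> \<open>Difference of the barycentric coordinates of c and of the origin, the origin
      being vertex n. It turns a linear relation between the edge vectors into an affine relation
      between the vertices.\<close>
    define d where "d = (\<lambda>j. bary n c j - (if j = n then 1 else 0))"
    have "(\<Sum>j\<le>n. d j) = 0" by (simp add: d_def lessThan_Suc_atMost[symmetric] bary_def)
    moreover have "(\<Sum>j\<le>n. d j * p j k) = 0" if "k < n" for k
    proof -
      have "(\<Sum>j\<le>n. d j * p j k) = (\<Sum>j\<le>n. bary n c j * p j k) - p n k"
        by (simp add: d_def left_diff_distrib sum_subtractf if_distrib[of "\<lambda>x. x * _"] cong: if_cong)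
      then show ?thesis using c that by (simp add: bary_sum h_def)
    qed
    ultimately have "d i = 0" using indep i unfolding aff_indep_def by (metis atMost_iff less_imp_le)
    then show "c i = 0" using i by (simp add: d_def bary_def)
  qed
  then obtain r where r: "r > 0" "\<And>f. f \<in> borel_measurable ?L \<Longrightarrow>
      (\<integral>\<^sup>+c. f (lincomb n {..<n} c h) \<partial>?L) = ennreal r * (\<integral>\<^sup>+x. f x \<partial>?L)"
    using nn_integral_linear_substitution by blast
  have subst: "(\<integral>\<^sup>+c. f (T c) \<partial>?L) = ennreal r * (\<integral>\<^sup>+x. f x \<partial>?L)" if f: "f \<in> borel_measurable ?L" for f
  proof -
    let ?t = "\<lambda>x. \<lambda>k\<in>{..<n}. p n k + x k"
    have "?t \<in> measurable ?L ?L" by (rule measurable_into_lebesgue_n) auto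
    then have "(\<lambda>x. f (?t x)) \<in> borel_measurable ?L" using f by (rule measurable_compose)
    then have "(\<integral>\<^sup>+c. f (T c) \<partial>?L) = ennreal r * (\<integral>\<^sup>+x. f (?t x) \<partial>?L)"
      unfolding T_eq by (rule r(2))
    then show ?thesis using nn_integral_lebesgue_n_translate[OF f] by simp
  qed
  have mem: "T c \<in> ?K \<longleftrightarrow> c \<in> corner n" if c: "c \<in> space ?L" for c
  proof
    assume "c \<in> corner n"
    then show "T c \<in> ?K" unfolding T_def chull_def using bary_corner by (auto simp: weights_def)
  next
    assume "T c \<in> ?K"
    then obtain d where d: "d \<in> weights {..n}" "T c = lincomb n {..n} d p" by (auto simp: chull_def)
    have "bary n c i = d i" if "i \<le> n" for i
    proof (rule aff_indep_unique[OF indep])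
      show "sum (bary n c) {..n} = sum d {..n}"
        using d by (simp add: weights_def lessThan_Suc_atMost[symmetric] bary_def)
      show "(\<Sum>i\<le>n. bary n c i * p i k) = (\<Sum>i\<le>n. d i * p i k)" if "k < n" for k
        using d(2) that unfolding T_def lincomb_eq_iff by blast
    qed (use that in simp)
    then have nn: "0 \<le> bary n c i" if "i \<le> n" for i using d(1) that by (simp add: weights_def)
    have "0 \<le> c i" if "i < n" for i using nn[of i] that by (simp add: bary_def)
    moreover have "(\<Sum>i<n. c i) \<le> 1" using nn[of n] by (simp add: bary_def)
    ultimately show "c \<in> corner n" using c by (simp add: corner_def)
  qed
  have K [measurable]: "?K \<in> sets ?L" by (rule sets_chull) simp
  have "ennreal r * emeasure ?L ?K = ennreal r * (\<integral>\<^sup>+x. indicator ?K x \<partial>?L)" by simp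
  also have "\<dots> = (\<integral>\<^sup>+c. indicator ?K (T c) \<partial>?L)" by (rule subst[symmetric]) measurable
  also have "\<dots> = (\<integral>\<^sup>+c. indicator (corner n) c \<partial>?L)"
    by (rule nn_integral_cong) (simp add: indicator_def mem)
  finally have vol: "ennreal r * emeasure ?L ?K = emeasure ?L (corner n)" by simp
  have "ennreal r * (\<integral>\<^sup>+x. ennreal (sqnorm_n n x) * indicator ?K x \<partial>?L)
      = (\<integral>\<^sup>+c. ennreal (sqnorm_n n (T c)) * indicator ?K (T c) \<partial>?L)"
    by (rule subst[symmetric]) measurable
  also have "\<dots> = (\<integral>\<^sup>+c. ennreal (sqnorm_n n (T c) * indicator (corner n) c) \<partial>?L)"
    by (rule nn_integral_cong) (auto simp: indicator_def mem)
  also have "\<dots> = ennreal (LINT c|?L. sqnorm_n n (T c) * indicator (corner n) c)"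
    unfolding T_def by (intro nn_integral_eq_integral integral_corner_sqnorm(1)) simp
  also have "\<dots> = ennreal (vertex_moment n {..n} p * measure ?L (corner n))"
    unfolding T_def integral_corner_sqnorm(2) by (simp add: vertex_moment_def)
  also have "\<dots> = ennreal (vertex_moment n {..n} p) * emeasure ?L (corner n)"
    using emeasure_corner_finite[of n]
    by (subst ennreal_mult') (auto simp: vertex_moment_def sum_nonneg emeasure_eq_ennreal_measure)
  also have "\<dots> = ennreal r * (ennreal (vertex_moment n {..n} p) * emeasure ?L ?K)"
    unfolding vol[symmetric] by (simp add: mult_ac)
  finally show ?thesis using r(1) by (simp add: ennreal_mult_cancel_left)
qed

lemma cell_second_moment:
  assumes B: "finite B" "card B = Suc n" "aff_indep n B v"
  shows "(\<integral>\<^sup>+x. ennreal (sqnorm_n n x) * indicator (chull n B v) x \<partial>lebesgue_n n)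
    = ennreal (vertex_moment n B v) * emeasure (lebesgue_n n) (chull n B v)"
proof -
  obtain b where b: "bij_betw b {..n} B"
    using ex_bij_betw_nat_finite[OF B(1)] B(2) by (auto simp: atLeast0LessThan lessThan_Suc_atMost)
  let ?p = "\<lambda>j. v (b j)"
  have re: "(\<Sum>i\<in>B. f i) = (\<Sum>j\<le>n. f (b j))" for f :: "_ \<Rightarrow> real"
    by (rule sum.reindex_bij_betw[OF b, symmetric])
  have "aff_indep n {..n} ?p" unfolding aff_indep_def
  proof (intro allI impI ballI)
    fix c i assume c: "sum c {..n} = 0" "\<forall>k<n. (\<Sum>j\<le>n. c j * v (b j) k) = 0" and i: "i \<in> {..n}"
    define d where "d = (\<lambda>j. c (inv_into {..n} b j))"
    have d: "d (b j) = c j" if "j \<le> n" for j using that b by (simp add: d_def bij_betw_def)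
    have bi: "b i \<in> B" using b i by (auto simp: bij_betw_def)
    have "(\<Sum>i\<in>B. d i) = 0" unfolding re using d c by simp
    moreover have "\<forall>k<n. (\<Sum>i\<in>B. d i * v i k) = 0" unfolding re using d c by simp
    ultimately have "d (b i) = 0" using B(3) bi unfolding aff_indep_def by blast
    then show "c i = 0" using d i by simp
  qed
  from cell_second_moment_nat[OF this] show ?thesis
    unfolding chull_reindex[OF b] by (simp add: vertex_moment_def re lincomb_def)
qed

lemma chull_second_moment_le:
  assumes I: "finite I" and M: "\<And>B. B \<subseteq> I \<Longrightarrow> card B = Suc n \<Longrightarrow> vertex_moment n B v \<le> M"
  shows "(\<integral>\<^sup>+x. ennreal (sqnorm_n n x) * indicator (chull n I v) x \<partial>lebesgue_n n)
    \<le> ennreal M * emeasure (lebesgue_n n) (chull n I v)"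
proof -
  let ?L = "lebesgue_n n"
  obtain h where h: "generic_cost n I v h" using generic_cost_exists[OF I] by blast
  define C where "C = cells n I v h"
  have C: "finite C" "\<And>B. B \<in> C \<Longrightarrow> B \<subseteq> I \<and> finite B \<and> card B = Suc n \<and> aff_indep n B v"
    using finite_cells[OF I] I by (auto simp: C_def cells_def intro: finite_subset)
  \<comment> \<open>The exceptional set of both covering and overlap: hulls of at most n of the
    points. Outside it each point of the body lies in exactly one cell.\<close>
  define Z where "Z = (\<Union>D\<in>{D. D \<subseteq> I \<and> card D \<le> n}. chull n D v)"
  have "Z \<in> null_sets ?L" unfolding Z_def
    using I by (intro null_sets_UN') (auto intro!: null_chull countable_finite intro: finite_subset)
  then have "AE x in ?L. x \<notin> Z" by (rule AE_not_in)
  then have ae: "AE x in ?L. (indicator (chull n I v) x :: ennreal) = (\<Sum>B\<in>C. indicator (chull n B v) x)"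
  proof eventually_elim
    case (elim x)
    show ?case
    proof (cases "x \<in> chull n I v")
      case True
      then obtain B where B: "B \<in> C" "x \<in> chull n B v"
        using cells_cover[OF I h True] elim by (auto simp: C_def Z_def)
      have "x \<notin> chull n B' v" if "B' \<in> C - {B}" for B'
        using cells_overlap[OF I, of B n v h B' x] B that elim by (auto simp: C_def Z_def)
      then have "(\<Sum>B\<in>C. indicator (chull n B v) x :: ennreal) = (\<Sum>B\<in>{B}. indicator (chull n B v) x)"
        using B C(1) by (intro sum.mono_neutral_right) auto
      then show ?thesis using True B by simp
    next
      case False
      then have "x \<notin> chull n B v" if "B \<in> C" for B using chull_mono[OF I, of B n v] C(2)[OF that] by auto
      then show ?thesis using False by simp
    qed
  qed
  have meas [measurable]: "chull n B v \<in> sets ?L" if "B \<in> C" for B using C(2)[OF that] by (intro sets_chull) simp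
  have measI [measurable]: "chull n I v \<in> sets ?L" by (rule sets_chull[OF I])
  have "(\<integral>\<^sup>+x. ennreal (sqnorm_n n x) * indicator (chull n I v) x \<partial>?L)
      = (\<integral>\<^sup>+x. (\<Sum>B\<in>C. ennreal (sqnorm_n n x) * indicator (chull n B v) x) \<partial>?L)"
    using ae by (intro nn_integral_cong_AE) (auto simp: sum_distrib_left)
  also have "\<dots> = (\<Sum>B\<in>C. \<integral>\<^sup>+x. ennreal (sqnorm_n n x) * indicator (chull n B v) x \<partial>?L)"
    by (rule nn_integral_sum) measurable
  also have "\<dots> = (\<Sum>B\<in>C. ennreal (vertex_moment n B v) * emeasure ?L (chull n B v))"
    using C(2) by (intro sum.cong refl cell_second_moment) auto
  also have "\<dots> \<le> (\<Sum>B\<in>C. ennreal M * emeasure ?L (chull n B v))"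
    using C(2) by (intro sum_mono mult_right_mono ennreal_leI M) auto
  also have "\<dots> = ennreal M * (\<Sum>B\<in>C. \<integral>\<^sup>+x. indicator (chull n B v) x \<partial>?L)"
    by (simp add: sum_distrib_left)
  also have "(\<Sum>B\<in>C. \<integral>\<^sup>+x. indicator (chull n B v) x \<partial>?L) = (\<integral>\<^sup>+x. (\<Sum>B\<in>C. indicator (chull n B v) x) \<partial>?L)"
    by (rule nn_integral_sum[symmetric]) measurable
  also have "\<dots> = (\<integral>\<^sup>+x. indicator (chull n I v) x \<partial>?L)"
    using ae by (intro nn_integral_cong_AE) auto
  finally show ?thesis by simp
qed

section \<open>Gaussian vectors\<close>

abbreviation gauss1 :: "real measure" where
  "gauss1 \<equiv> density lborel (\<lambda>x. ennreal (std_normal_density x))"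

definition gauss_n :: "nat \<Rightarrow> (nat \<Rightarrow> real) measure" where
  "gauss_n n = PiM {..<n} (\<lambda>_. gauss1)"

lemma prob_space_gauss1: "prob_space gauss1"
  by (rule prob_space_normal_density) simp

interpretation gauss1_product: product_sigma_finite "\<lambda>_::nat. gauss1"
  unfolding product_sigma_finite_def by (intro allI prob_space_imp_sigma_finite prob_space_gauss1)

lemma prob_space_gauss_n: "prob_space (gauss_n n)"
  unfolding gauss_n_def by (rule prob_space_PiM) (rule prob_space_gauss1)

interpretation gauss_n_product: product_sigma_finite "\<lambda>_::nat. gauss_n n" for n
  unfolding product_sigma_finite_def by (intro allI prob_space_imp_sigma_finite prob_space_gauss_n)

lemma sets_gauss_n [measurable_cong]: "sets (gauss_n n) = sets (lebesgue_n n)"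
  unfolding gauss_n_def lebesgue_n_def by (rule sets_PiM_cong) auto

lemma space_gauss_n: "space (gauss_n n) = space (lebesgue_n n)"
  by (rule sets_eq_imp_space_eq[OF sets_gauss_n])

lemma nn_integral_gauss1_affine:
  assumes a: "a \<noteq> 0" and [measurable]: "f \<in> borel_measurable borel"
  shows "(\<integral>\<^sup>+z. f (t + a * z) \<partial>gauss1) = (\<integral>\<^sup>+u. f u * ennreal (normal_density 0 \<bar>a\<bar> (u - t)) \<partial>lborel)"
proof -
  have nd: "\<bar>a\<bar> * normal_density 0 \<bar>a\<bar> (a * z) = std_normal_density z" for z
    using a by (simp add: normal_density_def real_sqrt_mult power_mult_distrib field_simps)
  have "(\<integral>\<^sup>+z. f (t + a * z) \<partial>gauss1) = (\<integral>\<^sup>+z. ennreal (std_normal_density z) * f (t + a * z) \<partial>lborel)"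
    by (rule nn_integral_density) auto
  also have "\<dots> = (\<integral>\<^sup>+z. ennreal \<bar>a\<bar> * (f (t + a * z) * ennreal (normal_density 0 \<bar>a\<bar> ((t + a * z) - t))) \<partial>lborel)"
    by (rule nn_integral_cong) (simp add: nd[symmetric] ennreal_mult mult_ac)
  also have "\<dots> = ennreal \<bar>a\<bar> * (\<integral>\<^sup>+z. f (t + a * z) * ennreal (normal_density 0 \<bar>a\<bar> ((t + a * z) - t)) \<partial>lborel)"
    by (rule nn_integral_cmult) measurable
  also have "\<dots> = (\<integral>\<^sup>+u. f u * ennreal (normal_density 0 \<bar>a\<bar> (u - t)) \<partial>lborel)"
    using nn_integral_real_affine[of "\<lambda>u. f u * ennreal (normal_density 0 \<bar>a\<bar> (u - t))" a t] a by simp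
  finally show ?thesis .
qed

text \<open>If X and Y are independent standard normal, a X + b Y is distributed as sqrt (a^2 + b^2)
  Z: after an affine substitution and Fubini this is the convolution of two normal
  densities.\<close>

lemma nn_integral_gauss1_stable:
  assumes [measurable]: "f \<in> borel_measurable borel"
  shows "(\<integral>\<^sup>+x. (\<integral>\<^sup>+y. f (a * x + b * y) \<partial>gauss1) \<partial>gauss1) = (\<integral>\<^sup>+z. f (sqrt (a\<^sup>2 + b\<^sup>2) * z) \<partial>gauss1)"
proof -
  interpret G: prob_space gauss1 by (rule prob_space_gauss1)
  have abs: "(\<integral>\<^sup>+z. f (c * z) \<partial>gauss1) = (\<integral>\<^sup>+z. f (\<bar>c\<bar> * z) \<partial>gauss1)" for c
    using nn_integral_gauss1_affine[of c f 0] nn_integral_gauss1_affine[of "\<bar>c\<bar>" f 0] by (cases "c = 0") auto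
  \<comment> \<open>A vanishing coefficient gives a point mass, which has no normal density, so
    these cases are separate.\<close>
  consider "a = 0" | "b = 0" | "a \<noteq> 0" "b \<noteq> 0" by blast
  then show ?thesis
  proof cases
    case 1 then show ?thesis using abs[of b] G.emeasure_space_1 by simp
  next
    case 2 then show ?thesis using abs[of a] G.emeasure_space_1 by simp
  next
    case 3
    have pos: "sqrt (a\<^sup>2 + b\<^sup>2) > 0" using 3 by (simp add: sum_power2_gt_zero_iff)
    interpret P: pair_sigma_finite gauss1 lborel
      by (intro pair_sigma_finite.intro prob_space_imp_sigma_finite prob_space_gauss1 sigma_finite_lborel)
    have "(\<integral>\<^sup>+x. (\<integral>\<^sup>+y. f (a * x + b * y) \<partial>gauss1) \<partial>gauss1)
        = (\<integral>\<^sup>+x. (\<integral>\<^sup>+u. f u * ennreal (normal_density 0 \<bar>b\<bar> (u - a * x)) \<partial>lborel) \<partial>gauss1)"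
      using nn_integral_gauss1_affine[OF 3(2), of f] by simp
    also have "\<dots> = (\<integral>\<^sup>+u. (\<integral>\<^sup>+x. f u * ennreal (normal_density 0 \<bar>b\<bar> (u - a * x)) \<partial>gauss1) \<partial>lborel)"
      by (rule P.Fubini'[symmetric]) measurable
    also have "\<dots> = (\<integral>\<^sup>+u. f u * (\<integral>\<^sup>+x. ennreal (normal_density 0 \<bar>b\<bar> (u - (0 + a * x))) \<partial>gauss1) \<partial>lborel)"
      by (intro nn_integral_cong) (simp add: nn_integral_cmult)
    also have "\<dots> = (\<integral>\<^sup>+u. f u * (\<integral>\<^sup>+v. ennreal (normal_density 0 \<bar>b\<bar> (u - v)) * ennreal (normal_density 0 \<bar>a\<bar> (v - 0)) \<partial>lborel) \<partial>lborel)"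
      by (subst nn_integral_gauss1_affine[OF 3(1), where t=0]) auto
    also have "\<dots> = (\<integral>\<^sup>+u. f u * ennreal (normal_density 0 (sqrt (\<bar>b\<bar>\<^sup>2 + \<bar>a\<bar>\<^sup>2)) u) \<partial>lborel)"
      using conv_normal_density_zero_mean[of "\<bar>b\<bar>" "\<bar>a\<bar>"] 3
      by (simp add: fun_eq_iff ennreal_mult'[symmetric])
    also have "\<dots> = (\<integral>\<^sup>+z. f (sqrt (a\<^sup>2 + b\<^sup>2) * z) \<partial>gauss1)"
      using nn_integral_gauss1_affine[of "sqrt (a\<^sup>2 + b\<^sup>2)" f 0] pos 3 by (simp add: add.commute)
    finally show ?thesis .
  qed
qed

lemma measurable_PiM_gauss1_component:
  "k \<in> K \<Longrightarrow> (\<lambda>x. x k) \<in> borel_measurable (PiM K (\<lambda>_. gauss1))"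
  by (rule measurable_compose[OF measurable_component_singleton]) auto

lemma nn_integral_gauss_linear_form:
  assumes "finite K" and f [measurable]: "f \<in> borel_measurable borel"
  shows "(\<integral>\<^sup>+x. f (\<Sum>k\<in>K. u k * x k) \<partial>PiM K (\<lambda>_::nat. gauss1)) = (\<integral>\<^sup>+z. f (sqrt (\<Sum>k\<in>K. (u k)\<^sup>2) * z) \<partial>gauss1)"
  using assms
proof (induction K arbitrary: f rule: finite_induct)
  case empty
  interpret G: prob_space gauss1 by (rule prob_space_gauss1)
  show ?case using G.emeasure_space_1 by (simp add: gauss1_product.nn_integral_empty PiM_empty)
next
  case (insert k K)
  note [measurable] = insert.prems
  have m: "(\<lambda>x. \<Sum>k\<in>L. u k * x k) \<in> borel_measurable (PiM L (\<lambda>_. gauss1))" for L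
    by (intro borel_measurable_sum borel_measurable_times borel_measurable_const measurable_PiM_gauss1_component)
  have "(\<integral>\<^sup>+x. f (\<Sum>k\<in>insert k K. u k * x k) \<partial>PiM (insert k K) (\<lambda>_. gauss1))
      = (\<integral>\<^sup>+y. (\<integral>\<^sup>+x. f (\<Sum>j\<in>insert k K. u j * (x(k := y)) j) \<partial>PiM K (\<lambda>_. gauss1)) \<partial>gauss1)"
    by (rule gauss1_product.product_nn_integral_insert_rev)
      (use insert.hyps in \<open>auto intro: measurable_compose[OF m insert.prems]\<close>)
  also have "\<dots> = (\<integral>\<^sup>+y. (\<integral>\<^sup>+x. f (u k * y + (\<Sum>j\<in>K. u j * x j)) \<partial>PiM K (\<lambda>_. gauss1)) \<partial>gauss1)"
  proof -
    have "(\<Sum>j\<in>insert k K. u j * (x(k := y)) j) = u k * y + (\<Sum>j\<in>K. u j * x j)" for x y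
    proof -
      have "(\<Sum>j\<in>K. u j * (x(k := y)) j) = (\<Sum>j\<in>K. u j * x j)"
        using insert.hyps by (intro sum.cong) auto
      then show ?thesis using insert.hyps by (simp del: fun_upd_apply) simp
    qed
    then show ?thesis by simp
  qed
  also have "\<dots> = (\<integral>\<^sup>+y. (\<integral>\<^sup>+z. f (u k * y + sqrt (\<Sum>k\<in>K. (u k)\<^sup>2) * z) \<partial>gauss1) \<partial>gauss1)"
    by (intro nn_integral_cong insert.IH) measurable
  also have "\<dots> = (\<integral>\<^sup>+z. f (sqrt ((u k)\<^sup>2 + (sqrt (\<Sum>k\<in>K. (u k)\<^sup>2))\<^sup>2) * z) \<partial>gauss1)"
    by (rule nn_integral_gauss1_stable) measurable
  also have "(u k)\<^sup>2 + (sqrt (\<Sum>k\<in>K. (u k)\<^sup>2))\<^sup>2 = (\<Sum>k\<in>insert k K. (u k)\<^sup>2)"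
    using insert.hyps by (simp add: sum_nonneg)
  finally show ?case .
qed

text \<open>The vector form of stability, by induction on the coordinates: the new coordinate is
  split off from both vectors, the induction hypothesis treats the remaining ones, and the
  one-dimensional statement treats the new one.\<close>

lemma nn_integral_gauss_stable:
  assumes "finite K" and f: "f \<in> borel_measurable (PiM K (\<lambda>_::nat. borel))"
  shows "(\<integral>\<^sup>+w. (\<integral>\<^sup>+z. f (\<lambda>k\<in>K. a * w k + b * z k) \<partial>PiM K (\<lambda>_. gauss1)) \<partial>PiM K (\<lambda>_. gauss1))
    = (\<integral>\<^sup>+z. f (\<lambda>k\<in>K. sqrt (a\<^sup>2 + b\<^sup>2) * z k) \<partial>PiM K (\<lambda>_. gauss1))"
  using assms
proof (induction K arbitrary: f rule: finite_induct)
  case empty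
  show ?case by (simp add: gauss1_product.nn_integral_empty PiM_empty)
next
  case (insert k K)
  let ?P = "PiM K (\<lambda>_. gauss1)" and ?Q = "PiM (insert k K) (\<lambda>_. gauss1)"
  let ?s = "sqrt (a\<^sup>2 + b\<^sup>2)"
  note f = insert.prems
  have nk: "k \<notin> K" "finite K" using insert.hyps by auto
  interpret P: prob_space ?P by (rule prob_space_PiM) (rule prob_space_gauss1)
  interpret Q: prob_space ?Q by (rule prob_space_PiM) (rule prob_space_gauss1)
  interpret G: prob_space gauss1 by (rule prob_space_gauss1)
  interpret PG: pair_sigma_finite ?P gauss1
    by (intro pair_sigma_finite.intro prob_space_imp_sigma_finite P.prob_space_axioms prob_space_gauss1)
  note comp = measurable_PiM_gauss1_component
  have upd: "(\<lambda>j\<in>insert k K. a * (w(k := wk)) j + b * (z(k := zk)) j) = (\<lambda>j\<in>K. a * w j + b * z j)(k := a * wk + b * zk)"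
    for w z wk zk using nk by (auto simp: fun_eq_iff restrict_def)
  have updm: "(\<lambda>x. (g x)(k := h x)) \<in> measurable M (PiM (insert k K) (\<lambda>_. borel))"
    if "g \<in> measurable M (PiM K (\<lambda>_. borel))" "h \<in> borel_measurable M" for g h and M :: "'q measure"
    using that by (rule measurable_fun_upd[rotated]) auto
  have m1: "(\<lambda>z. \<lambda>j\<in>insert k K. a * w j + b * z j) \<in> measurable ?Q (PiM (insert k K) (\<lambda>_. borel))" for w
    by (intro measurable_restrict borel_measurable_add borel_measurable_times borel_measurable_const comp)
  have m2: "(\<lambda>x. \<lambda>j\<in>insert k K. a * fst x j + b * snd x j) \<in> measurable (?Q \<Otimes>\<^sub>M ?Q) (PiM (insert k K) (\<lambda>_. borel))"
    by (intro measurable_restrict borel_measurable_add borel_measurable_times borel_measurable_const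
        measurable_compose[OF measurable_fst comp] measurable_compose[OF measurable_snd comp])
  have "(\<integral>\<^sup>+w. (\<integral>\<^sup>+z. f (\<lambda>j\<in>insert k K. a * w j + b * z j) \<partial>?Q) \<partial>?Q)
      = (\<integral>\<^sup>+wk. (\<integral>\<^sup>+w. (\<integral>\<^sup>+z. f (\<lambda>j\<in>insert k K. a * (w(k := wk)) j + b * z j) \<partial>?Q) \<partial>?P) \<partial>gauss1)"
    by (rule gauss1_product.product_nn_integral_insert_rev[OF nk(2,1)])
       (intro Q.borel_measurable_nn_integral, simp only: case_prod_unfold, rule measurable_compose[OF m2 f])
  also have "\<dots> = (\<integral>\<^sup>+wk. (\<integral>\<^sup>+w. (\<integral>\<^sup>+zk. (\<integral>\<^sup>+z. f ((\<lambda>j\<in>K. a * w j + b * z j)(k := a * wk + b * zk)) \<partial>?P) \<partial>gauss1) \<partial>?P) \<partial>gauss1)"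
    unfolding upd[symmetric]
    by (intro nn_integral_cong gauss1_product.product_nn_integral_insert_rev[OF nk(2,1)] measurable_compose[OF m1 f])
  \<comment> \<open>Exchanging the middle integrals brings the remaining coordinates of both vectors
    together, as the induction hypothesis requires.\<close>
  also have "\<dots> = (\<integral>\<^sup>+wk. (\<integral>\<^sup>+zk. (\<integral>\<^sup>+w. (\<integral>\<^sup>+z. f ((\<lambda>j\<in>K. a * w j + b * z j)(k := a * wk + b * zk)) \<partial>?P) \<partial>?P) \<partial>gauss1) \<partial>gauss1)"
  proof (rule nn_integral_cong)
    fix wk
    have um: "(\<lambda>x. (\<lambda>j\<in>K. a * fst (fst x) j + b * snd x j)(k := a * wk + b * snd (fst x))) \<in> measurable ((?P \<Otimes>\<^sub>M gauss1) \<Otimes>\<^sub>M ?P) (PiM (insert k K) (\<lambda>_. borel))"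
    proof (rule updm)
      show "(\<lambda>x. \<lambda>j\<in>K. a * fst (fst x) j + b * snd x j) \<in> measurable ((?P \<Otimes>\<^sub>M gauss1) \<Otimes>\<^sub>M ?P) (PiM K (\<lambda>_. borel))"
        by (intro measurable_restrict borel_measurable_add borel_measurable_times borel_measurable_const
          measurable_compose[OF measurable_compose[OF measurable_fst measurable_fst] comp] measurable_compose[OF measurable_snd comp])
    qed measurable
    have "(\<lambda>x. \<integral>\<^sup>+z. f ((\<lambda>j\<in>K. a * fst x j + b * z j)(k := a * wk + b * snd x)) \<partial>?P) \<in> borel_measurable (?P \<Otimes>\<^sub>M gauss1)"
      by (intro P.borel_measurable_nn_integral, simp only: case_prod_unfold, rule measurable_compose[OF um f])
    then show "(\<integral>\<^sup>+w. (\<integral>\<^sup>+zk. (\<integral>\<^sup>+z. f ((\<lambda>j\<in>K. a * w j + b * z j)(k := a * wk + b * zk)) \<partial>?P) \<partial>gauss1) \<partial>?P)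
        = (\<integral>\<^sup>+zk. (\<integral>\<^sup>+w. (\<integral>\<^sup>+z. f ((\<lambda>j\<in>K. a * w j + b * z j)(k := a * wk + b * zk)) \<partial>?P) \<partial>?P) \<partial>gauss1)"
      by (intro PG.Fubini'[symmetric]) (simp add: case_prod_unfold)
  qed
  also have "\<dots> = (\<integral>\<^sup>+wk. (\<integral>\<^sup>+zk. (\<integral>\<^sup>+z. f ((\<lambda>j\<in>K. ?s * z j)(k := a * wk + b * zk)) \<partial>?P) \<partial>gauss1) \<partial>gauss1)"
    by (intro nn_integral_cong insert.IH measurable_compose[OF updm f]) auto
  also have "\<dots> = (\<integral>\<^sup>+y. (\<integral>\<^sup>+z. f ((\<lambda>j\<in>K. ?s * z j)(k := ?s * y)) \<partial>?P) \<partial>gauss1)"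
  proof (rule nn_integral_gauss1_stable)
    have um: "(\<lambda>x. (\<lambda>j\<in>K. ?s * snd x j)(k := fst x)) \<in> measurable (borel \<Otimes>\<^sub>M ?P) (PiM (insert k K) (\<lambda>_. borel))"
      by (intro updm measurable_restrict borel_measurable_times borel_measurable_const
          measurable_compose[OF measurable_snd comp] measurable_fst)
    show "(\<lambda>y. \<integral>\<^sup>+z. f ((\<lambda>j\<in>K. ?s * z j)(k := y)) \<partial>?P) \<in> borel_measurable borel"
      by (intro P.borel_measurable_nn_integral, simp only: case_prod_unfold, rule measurable_compose[OF um f])
  qed
  also have "\<dots> = (\<integral>\<^sup>+y. (\<integral>\<^sup>+z. f (\<lambda>j\<in>insert k K. ?s * (z(k := y)) j) \<partial>?P) \<partial>gauss1)"
  proof -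
    have "(\<lambda>j\<in>insert k K. ?s * (z(k := y)) j) = (\<lambda>j\<in>K. ?s * z j)(k := ?s * y)" for z y
      using nk by (auto simp: fun_eq_iff restrict_def)
    then show ?thesis by (simp only:)
  qed
  also have "\<dots> = (\<integral>\<^sup>+z. f (\<lambda>j\<in>insert k K. ?s * z j) \<partial>?Q)"
    by (rule gauss1_product.product_nn_integral_insert_rev[OF nk(2,1), symmetric])
       (intro measurable_compose[OF _ f] measurable_restrict borel_measurable_times borel_measurable_const comp)
  finally show ?case .
qed

text \<open>A linear combination of independent standard Gaussian vectors is a standard one
  multiplied by the Euclidean norm of the coefficients. The vectors are added one at a time.\<close>

lemma nn_integral_gauss_lincomb:
  fixes I :: "nat set"
  assumes "finite I" and f: "f \<in> borel_measurable (lebesgue_n n)"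
  shows "(\<integral>\<^sup>+w. f (lincomb n I c w) \<partial>PiM I (\<lambda>_. gauss_n n))
    = (\<integral>\<^sup>+z. f (\<lambda>k\<in>{..<n}. sqrt (\<Sum>i\<in>I. (c i)\<^sup>2) * z k) \<partial>gauss_n n)"
  using assms
proof (induction I arbitrary: f rule: finite_induct)
  case empty
  interpret G: prob_space "gauss_n n" by (rule prob_space_gauss_n)
  show ?case using G.emeasure_space_1 by (simp add: gauss_n_product.nn_integral_empty PiM_empty lincomb_def)
next
  case (insert i I)
  note f = insert.prems
  let ?P = "PiM I (\<lambda>_. gauss_n n)"
  have comp: "(\<lambda>w. w j k) \<in> borel_measurable (PiM J (\<lambda>_. gauss_n n))" if "j \<in> J" "k < n" for j k J
    using that by (intro measurable_compose[OF measurable_component_singleton, of j J]) measurable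
  have m: "(\<lambda>w. lincomb n J c w) \<in> measurable (PiM J (\<lambda>_. gauss_n n)) (lebesgue_n n)" for J
    by (rule measurable_lincomb_coeffs) (auto intro: comp)
  have "(\<integral>\<^sup>+w. f (lincomb n (insert i I) c w) \<partial>PiM (insert i I) (\<lambda>_. gauss_n n))
      = (\<integral>\<^sup>+g. (\<integral>\<^sup>+w. f (lincomb n (insert i I) c (w(i := g))) \<partial>?P) \<partial>gauss_n n)"
    by (rule gauss_n_product.product_nn_integral_insert_rev[OF insert.hyps measurable_compose[OF m f]])
  also have "\<dots> = (\<integral>\<^sup>+g. (\<integral>\<^sup>+w. f (\<lambda>k\<in>{..<n}. c i * g k + lincomb n I c w k) \<partial>?P) \<partial>gauss_n n)"
  proof -
    have "lincomb n (insert i I) c (w(i := g)) = (\<lambda>k\<in>{..<n}. c i * g k + lincomb n I c w k)" for w g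
    proof -
      have "(\<Sum>j\<in>I. c j * (w(i := g)) j k) = (\<Sum>j\<in>I. c j * w j k)" for k
        using insert.hyps by (intro sum.cong) auto
      then show ?thesis using insert.hyps by (auto simp: lincomb_def)
    qed
    then show ?thesis by simp
  qed
  also have "\<dots> = (\<integral>\<^sup>+g. (\<integral>\<^sup>+z. f (\<lambda>k\<in>{..<n}. c i * g k + (\<lambda>k\<in>{..<n}. sqrt (\<Sum>i\<in>I. (c i)\<^sup>2) * z k) k) \<partial>gauss_n n) \<partial>gauss_n n)"
  proof (intro nn_integral_cong insert.IH measurable_compose[OF _ f])
    fix g show "(\<lambda>x. \<lambda>k\<in>{..<n}. c i * g k + x k) \<in> measurable (lebesgue_n n) (lebesgue_n n)"
      by (rule measurable_into_lebesgue_n) auto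
  qed
  also have "\<dots> = (\<integral>\<^sup>+g. (\<integral>\<^sup>+z. f (\<lambda>k\<in>{..<n}. c i * g k + sqrt (\<Sum>i\<in>I. (c i)\<^sup>2) * z k) \<partial>gauss_n n) \<partial>gauss_n n)"
    by (simp cong: restrict_cong)
  also have "\<dots> = (\<integral>\<^sup>+z. f (\<lambda>k\<in>{..<n}. sqrt ((c i)\<^sup>2 + (sqrt (\<Sum>i\<in>I. (c i)\<^sup>2))\<^sup>2) * z k) \<partial>gauss_n n)"
  proof -
    have "sets (PiM {..<n} (\<lambda>_. borel)) = sets (lebesgue_n n)" unfolding lebesgue_n_def by (rule sets_PiM_cong) auto
    then have "f \<in> borel_measurable (PiM {..<n} (\<lambda>_. borel))" using f by (simp cong: measurable_cong_sets)
    then show ?thesis unfolding gauss_n_def by (intro nn_integral_gauss_stable) auto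
  qed
  also have "(c i)\<^sup>2 + (sqrt (\<Sum>i\<in>I. (c i)\<^sup>2))\<^sup>2 = (\<Sum>i\<in>insert i I. (c i)\<^sup>2)"
    using insert.hyps by (simp add: sum_nonneg)
  finally show ?case .
qed

section \<open>Sums over small subsets of the sample\<close>

lemma gauss_space_eq: "gauss_space n N = PiM {..N} (\<lambda>_. gauss_n n)"
  by (simp add: gauss_space_def gauss_n_def)

lemma prob_space_gauss_space: "prob_space (gauss_space n N)"
  unfolding gauss_space_eq by (rule prob_space_PiM) (rule prob_space_gauss_n)

lemma measurable_PiM_gauss_n_component:
  "i \<in> I \<Longrightarrow> k < n \<Longrightarrow> (\<lambda>w. w i k) \<in> borel_measurable (PiM I (\<lambda>_. gauss_n n))"
  by (rule measurable_compose[OF measurable_component_singleton, of i I]) measurable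

lemma measurable_gauss_lincomb:
  "J \<subseteq> I \<Longrightarrow> (\<lambda>w. lincomb n J c w) \<in> measurable (PiM I (\<lambda>_. gauss_n n)) (lebesgue_n n)"
  by (rule measurable_lincomb_coeffs) (auto intro: measurable_PiM_gauss_n_component)

text \<open>The standard normal density times exp (z^2 / 4) is sqrt 2 times the normal density of
  variance 2; the coordinates then factor.\<close>

lemma nn_integral_exp_sqnorm_gauss:
  "(\<integral>\<^sup>+z. ennreal (exp (sqnorm_n n z / 4)) \<partial>gauss_n n) = ennreal (sqrt 2 ^ n)"
proof -
  have nd: "std_normal_density z * exp (z\<^sup>2 / 4) = sqrt 2 * normal_density 0 (sqrt 2) z" for z
    by (simp add: normal_density_def real_sqrt_mult mult_exp_exp field_simps)
  have one: "(\<integral>\<^sup>+z. ennreal (exp (z\<^sup>2 / 4)) \<partial>gauss1) = ennreal (sqrt 2)"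
  proof -
    have "(\<integral>\<^sup>+z. ennreal (exp (z\<^sup>2 / 4)) \<partial>gauss1)
        = (\<integral>\<^sup>+z. ennreal (std_normal_density z) * ennreal (exp (z\<^sup>2 / 4)) \<partial>lborel)"
      by (rule nn_integral_density) auto
    also have "\<dots> = (\<integral>\<^sup>+z. ennreal (sqrt 2) * ennreal (normal_density 0 (sqrt 2) z) \<partial>lborel)"
      by (intro nn_integral_cong) (simp add: ennreal_mult[symmetric] nd)
    also have "\<dots> = ennreal (sqrt 2) * (\<integral>\<^sup>+z. ennreal (normal_density 0 (sqrt 2) z) \<partial>lborel)"
      by (rule nn_integral_cmult) measurable
    also have "(\<integral>\<^sup>+z. ennreal (normal_density 0 (sqrt 2) z) \<partial>lborel) = 1"
      by (subst nn_integral_eq_integral) auto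
    finally show ?thesis by simp
  qed
  have "(\<integral>\<^sup>+z. ennreal (exp (sqnorm_n n z / 4)) \<partial>gauss_n n) = (\<integral>\<^sup>+z. (\<Prod>k<n. ennreal (exp ((z k)\<^sup>2 / 4))) \<partial>gauss_n n)"
    by (simp add: sqnorm_n_def sum_divide_distrib exp_sum prod_ennreal)
  also have "\<dots> = (\<Prod>k<n. \<integral>\<^sup>+z. ennreal (exp (z\<^sup>2 / 4)) \<partial>gauss1)"
    unfolding gauss_n_def by (rule gauss1_product.product_nn_integral_prod) auto
  also have "\<dots> = ennreal (sqrt 2 ^ n)" by (simp add: one ennreal_power)
  finally show ?thesis .
qed

text \<open>Exponential Markov inequality: the sum over J is sqrt (card J) times a standard Gaussian
  vector, so dividing its squared norm by 4 \<open>card J\<close> gives the exponential moment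
  computed above.\<close>

lemma emeasure_subset_sum_tail:
  assumes J: "J \<subseteq> {..N}" "card J \<noteq> 0"
  shows "emeasure (gauss_space n N) {w\<in>space (gauss_space n N). 4 * real (card J) * t < sqnorm_n n (lincomb n J (\<lambda>_. 1) w)}
    \<le> ennreal (sqrt 2 ^ n * exp (- t))"
proof -
  let ?G = "gauss_space n N" and ?m = "real (card J)"
  have m: "?m > 0" using J by simp
  define f where "f = (\<lambda>x. ennreal (exp (sqnorm_n n x / (4 * ?m))))"
  have f: "f \<in> borel_measurable (lebesgue_n n)" unfolding f_def by measurable
  let ?c = "\<lambda>i. if i \<in> J then 1 else (0::real)"
  have c: "(\<Sum>i\<le>N. (?c i)\<^sup>2) = ?m"
  proof -
    have "(\<Sum>i\<le>N. (?c i)\<^sup>2) = (\<Sum>i\<in>J. 1)"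
      using J by (intro sum.mono_neutral_cong_right) auto
    then show ?thesis by simp
  qed
  have lc: "lincomb n {..N} ?c w = lincomb n J (\<lambda>_. 1) w" for w :: "nat \<Rightarrow> nat \<Rightarrow> real"
    using lincomb_extend[of "{..N}" J n "\<lambda>_. 1" w] J by simp
  have "(\<integral>\<^sup>+w. f (lincomb n J (\<lambda>_. 1) w) \<partial>?G) = (\<integral>\<^sup>+z. f (\<lambda>k\<in>{..<n}. sqrt ?m * z k) \<partial>gauss_n n)"
    using nn_integral_gauss_lincomb[of "{..N}" f n ?c] f c lc by (simp add: gauss_space_eq)
  also have "\<dots> = (\<integral>\<^sup>+z. ennreal (exp (sqnorm_n n z / 4)) \<partial>gauss_n n)"
    using m by (simp add: f_def sqnorm_n_def power_mult_distrib sum_distrib_left[symmetric])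
  finally have int: "(\<integral>\<^sup>+w. f (lincomb n J (\<lambda>_. 1) w) \<partial>?G) = ennreal (sqrt 2 ^ n)"
    by (simp add: nn_integral_exp_sqnorm_gauss)
  have lm: "(\<lambda>w. lincomb n J (\<lambda>_. 1) w) \<in> measurable ?G (lebesgue_n n)"
    unfolding gauss_space_eq by (rule measurable_gauss_lincomb) (rule J)
  define A where "A = {w\<in>space ?G. 4 * ?m * t < sqnorm_n n (lincomb n J (\<lambda>_. 1) w)}"
  have A: "A \<in> sets ?G" unfolding A_def
    using measurable_compose[OF lm measurable_sqnorm_n] by measurable
  have "emeasure ?G A = (\<integral>\<^sup>+w. indicator A w \<partial>?G)" using A by simp
  also have "\<dots> \<le> (\<integral>\<^sup>+w. ennreal (exp (- t)) * f (lincomb n J (\<lambda>_. 1) w) \<partial>?G)"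
  proof (rule nn_integral_mono)
    fix w assume "w \<in> space ?G"
    have "ennreal 1 \<le> ennreal (exp (- t) * exp (sqnorm_n n (lincomb n J (\<lambda>_. 1) w) / (4 * ?m)))" if "w \<in> A"
    proof (rule ennreal_leI)
      have "t \<le> sqnorm_n n (lincomb n J (\<lambda>_. 1) w) / (4 * ?m)"
        using that m by (simp add: A_def field_simps)
      then show "1 \<le> exp (- t) * exp (sqnorm_n n (lincomb n J (\<lambda>_. 1) w) / (4 * ?m))"
        by (simp add: mult_exp_exp)
    qed
    then show "indicator A w \<le> ennreal (exp (- t)) * f (lincomb n J (\<lambda>_. 1) w)"
      by (auto simp: indicator_def f_def ennreal_mult)
  qed
  also have "\<dots> = ennreal (exp (- t)) * ennreal (sqrt 2 ^ n)"
    unfolding int[symmetric] by (rule nn_integral_cmult) (rule measurable_compose[OF lm f])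
  finally show ?thesis by (simp add: A_def ennreal_mult[symmetric] mult.commute)
qed

text \<open>All sizes up to n + 1 are included, not only n + 1: signed sums over a vertex set are
  differences of sums over two of its subsets.\<close>

definition subset_sums_bounded :: "nat \<Rightarrow> nat \<Rightarrow> real \<Rightarrow> (nat \<Rightarrow> nat \<Rightarrow> real) \<Rightarrow> bool" where
  "subset_sums_bounded n N R w \<longleftrightarrow> (\<forall>J\<subseteq>{..N}. card J \<le> Suc n \<longrightarrow> sqnorm_n n (lincomb n J (\<lambda>_. 1) w) \<le> R)"

lemma subset_sums_bounded_prob:
  assumes n: "1 \<le> n" "n \<le> N"
  defines "R \<equiv> (real n)\<^sup>2 * (16 * ln (real N / real n) + 32)"
  shows "{w\<in>space (gauss_space n N). subset_sums_bounded n N R w} \<in> sets (gauss_space n N)" (is ?meas)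
    and "measure (gauss_space n N) {w\<in>space (gauss_space n N). \<not> subset_sums_bounded n N R w} \<le> exp (- real n)" (is ?prob)
proof -
  let ?G = "gauss_space n N"
  interpret G: prob_space ?G by (rule prob_space_gauss_space)
  define L where "L = ln (real N / real n)"
  have L: "L \<ge> 0" using n by (simp add: L_def)
  \<comment> \<open>Chosen for the union bound: there are at most exp (2 n + 2 n L) index sets, sqrt
    2 ^ n is at most exp n, and the total exponent must be -n. Since \<open>card J\<close> is at
    most n + 1, hence at most 2 n, the tail level is at most 8 n t, which is R.\<close>
  define t where "t = 2 * real n * L + 4 * real n"
  have t: "t \<ge> 0" using L by (simp add: t_def)
  have R: "R = 8 * real n * t" by (simp add: R_def t_def L_def power2_eq_square algebra_simps)
  define F where "F = {J. J \<subseteq> {..N} \<and> card J \<le> Suc n}"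
  have F: "finite F" by (rule finite_subset[of _ "Pow {..N}"]) (auto simp: F_def)
  define A where "A = (\<lambda>J. {w\<in>space ?G. R < sqnorm_n n (lincomb n J (\<lambda>_. 1) w)})"
  have A: "A J \<in> sets ?G" if "J \<in> F" for J
  proof -
    have "(\<lambda>w. lincomb n J (\<lambda>_. 1) w) \<in> measurable ?G (lebesgue_n n)"
      unfolding gauss_space_eq by (rule measurable_gauss_lincomb) (use that in \<open>auto simp: F_def\<close>)
    from measurable_compose[OF this measurable_sqnorm_n] show ?thesis unfolding A_def by measurable
  qed
  have bad: "{w\<in>space ?G. \<not> subset_sums_bounded n N R w} = (\<Union>J\<in>F. A J)"
    by (auto simp: subset_sums_bounded_def F_def A_def not_le)
  have badm: "(\<Union>J\<in>F. A J) \<in> sets ?G" using F A by auto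
  have "{w\<in>space ?G. subset_sums_bounded n N R w} = space ?G - (\<Union>J\<in>F. A J)"
    unfolding bad[symmetric] by auto
  then show ?meas using badm by simp
  have pA: "measure ?G (A J) \<le> sqrt 2 ^ n * exp (- t)" if J: "J \<in> F" for J
  proof (cases "card J = 0")
    case True
    then have "J = {}" using J finite_subset[of J "{..N}"] by (auto simp: F_def)
    moreover have "0 \<le> R" using t by (simp add: R)
    ultimately have "A J = {}" by (auto simp: A_def lincomb_def sqnorm_n_def)
    then show ?thesis by simp
  next
    case False
    have "real (card J) \<le> real (Suc n)" using J unfolding F_def by (metis (mono_tags, lifting) mem_Collect_eq of_nat_mono)
    then have le: "4 * real (card J) * t \<le> 8 * real n * t"
      using t n by (intro mult_right_mono) auto
    have "A J \<subseteq> {w\<in>space ?G. 4 * real (card J) * t < sqnorm_n n (lincomb n J (\<lambda>_. 1) w)}"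
    proof
      fix w assume "w \<in> A J"
      then have w: "8 * real n * t < sqnorm_n n (lincomb n J (\<lambda>_. 1) w)" "w \<in> space ?G" by (simp_all add: A_def R)
      from le_less_trans[OF le w(1)] w(2) show "w \<in> {w\<in>space ?G. 4 * real (card J) * t < sqnorm_n n (lincomb n J (\<lambda>_. 1) w)}"
        by simp
    qed
    moreover have "{w\<in>space ?G. 4 * real (card J) * t < sqnorm_n n (lincomb n J (\<lambda>_. 1) w)} \<in> sets ?G"
    proof -
      have "(\<lambda>w. lincomb n J (\<lambda>_. 1) w) \<in> measurable ?G (lebesgue_n n)"
        unfolding gauss_space_eq by (rule measurable_gauss_lincomb) (use J in \<open>auto simp: F_def\<close>)
      from measurable_compose[OF this measurable_sqnorm_n] show ?thesis by measurable
    qed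
    ultimately have "emeasure ?G (A J) \<le> emeasure ?G {w\<in>space ?G. 4 * real (card J) * t < sqnorm_n n (lincomb n J (\<lambda>_. 1) w)}"
      by (rule emeasure_mono)
    also have "\<dots> \<le> ennreal (sqrt 2 ^ n * exp (- t))"
      by (rule emeasure_subset_sum_tail) (use J False in \<open>simp_all add: F_def\<close>)
    finally show ?thesis by (simp add: G.emeasure_eq_measure)
  qed
  have "measure ?G (\<Union>J\<in>F. A J) \<le> (\<Sum>J\<in>F. measure ?G (A J))"
    using F A by (intro G.finite_measure_subadditive_finite) auto
  also have "\<dots> \<le> real (card F) * (sqrt 2 ^ n * exp (- t))"
    using sum_mono[of F "\<lambda>J. measure ?G (A J)" "\<lambda>_. sqrt 2 ^ n * exp (- t)"] pA by simp
  also have "\<dots> \<le> exp (2 * real n + 2 * real n * L) * (exp (real n) * exp (- t))"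
  proof (intro mult_mono)
    \<comment> \<open>The optimal order of the weight: (1 + x) ^ (N + 1) is at most exp (2 n), and 1
      / x = exp L.\<close>
    define x where "x = real n / real N"
    have x: "0 < x" "x \<le> 1" using n by (auto simp: x_def)
    have lx: "1 / x = exp L" using n by (simp add: L_def x_def exp_ln)
    have "real (card F) \<le> (1 + x) ^ Suc N / x ^ Suc n"
      using card_small_subsets_le[of "{..N}" x "Suc n"] x by (simp add: F_def)
    also have "\<dots> = (1 + x) ^ Suc N * exp L ^ Suc n"
      unfolding lx[symmetric] by (simp add: power_divide)
    also have "\<dots> \<le> exp (2 * real n) * exp (2 * real n * L)"
    proof (intro mult_mono)
      have "(1 + x) ^ Suc N \<le> exp x ^ Suc N" using x by (intro power_mono) auto
      also have "\<dots> = exp (real (Suc N) * x)" by (rule exp_of_nat_mult[symmetric])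
      also have "real (Suc N) * x \<le> 2 * real n"
      proof -
        have "real (Suc N) \<le> 2 * real N" using n by simp
        then have "real (Suc N) * x \<le> 2 * real N * x" using x by (intro mult_right_mono) auto
        also have "\<dots> = 2 * real n" using n by (simp add: x_def)
        finally show ?thesis .
      qed
      finally show "(1 + x) ^ Suc N \<le> exp (2 * real n)" by simp
      have "exp L ^ Suc n = exp (real (Suc n) * L)" by (rule exp_of_nat_mult[symmetric])
      also have "real (Suc n) * L \<le> 2 * real n * L" using n L by (intro mult_right_mono) auto
      finally show "exp L ^ Suc n \<le> exp (2 * real n * L)" by simp
    qed (use x in auto)
    finally show "real (card F) \<le> exp (2 * real n + 2 * real n * L)" by (simp add: exp_add)
    have "sqrt 2 \<le> exp 1" using exp_ge_add_one_self[of 1] real_sqrt_le_iff[of 2 "2^2"] by (simp del: real_sqrt_le_iff)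
    then have "sqrt 2 ^ n \<le> exp 1 ^ n" by (intro power_mono) auto
    then show "sqrt 2 ^ n \<le> exp (real n)" by (simp add: exp_of_nat_mult[symmetric])
  qed auto
  also have "\<dots> = exp (- real n)" by (simp add: mult_exp_exp t_def)
  finally show ?prob unfolding bad .
qed

section \<open>From subset sums to sums of squared norms\<close>

lemma sqnorm_n_add:
  "sqnorm_n n (\<lambda>k. x k + s * y k) = sqnorm_n n x + 2 * s * dot n x y + s\<^sup>2 * sqnorm_n n y"
  by (simp add: sqnorm_n_def dot_def power2_sum power_mult_distrib sum.distrib sum_distrib_left algebra_simps)

lemma sqnorm_n_cong: "(\<And>k. k < n \<Longrightarrow> x k = y k) \<Longrightarrow> sqnorm_n n x = sqnorm_n n y"
  by (simp add: sqnorm_n_def)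

text \<open>Greedy choice of signs: each new vector is added with the sign that makes the cross term nonnegative.\<close>

lemma signed_sum_ge:
  assumes "finite J"
  shows "\<exists>E\<subseteq>J. (\<Sum>i\<in>J. sqnorm_n n (p i)) \<le> sqnorm_n n (lincomb n J (\<lambda>i. if i \<in> E then 1 else - 1) p)"
  using assms
proof (induction J rule: finite_induct)
  case (insert j J)
  then obtain E where E: "E \<subseteq> J" "(\<Sum>i\<in>J. sqnorm_n n (p i)) \<le> sqnorm_n n (lincomb n J (\<lambda>i. if i \<in> E then 1 else - 1) p)"
    by blast
  define S where "S = lincomb n J (\<lambda>i. if i \<in> E then 1 else - 1) p"
  define s :: real where "s = (if dot n S (p j) \<ge> 0 then 1 else - 1)"
  define E' where "E' = (if dot n S (p j) \<ge> 0 then insert j E else E)"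
  have jE: "j \<notin> E" using E insert by auto
  have E': "E' \<subseteq> insert j J" using E by (auto simp: E'_def)
  have "sqnorm_n n (lincomb n (insert j J) (\<lambda>i. if i \<in> E' then 1 else - 1) p) = sqnorm_n n (\<lambda>k. S k + s * p j k)"
  proof (rule sqnorm_n_cong)
    fix k assume k: "k < n"
    have "(\<Sum>i\<in>J. (if i \<in> E' then 1 else - 1) * p i k) = (\<Sum>i\<in>J. (if i \<in> E then 1 else - 1) * p i k)"
      using insert.hyps by (intro sum.cong) (auto simp: E'_def)
    then show "lincomb n (insert j J) (\<lambda>i. if i \<in> E' then 1 else - 1) p k = S k + s * p j k"
      using k insert.hyps jE by (auto simp: lincomb_def S_def s_def E'_def)
  qed
  also have "\<dots> \<ge> sqnorm_n n S + sqnorm_n n (p j)"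
    unfolding sqnorm_n_add by (auto simp: s_def)
  finally show ?case using E E' insert.hyps by (intro exI[of _ E']) (auto simp: S_def)
qed auto

lemma sqnorm_n_diff_le: "sqnorm_n n (\<lambda>k. x k - y k) \<le> 2 * sqnorm_n n x + 2 * sqnorm_n n y"
proof -
  have "(x k - y k)\<^sup>2 \<le> 2 * (x k)\<^sup>2 + 2 * (y k)\<^sup>2" for k
  proof -
    have "0 \<le> (x k + y k)\<^sup>2" by simp
    then show ?thesis by (simp add: power2_sum power2_diff)
  qed
  then have "(\<Sum>k<n. (x k - y k)\<^sup>2) \<le> (\<Sum>k<n. 2 * (x k)\<^sup>2 + 2 * (y k)\<^sup>2)" by (rule sum_mono)
  then show ?thesis by (simp add: sqnorm_n_def sum.distrib sum_distrib_left)
qed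

text \<open>Some signed sum over J has squared norm at least the sum of the squares. It is a
  difference of two subset sums, each of squared norm at most R, hence the factor 4.\<close>

lemma sum_sqnorm_le:
  assumes w: "subset_sums_bounded n N R w" and J: "J \<subseteq> {..N}" "card J \<le> Suc n"
  shows "(\<Sum>i\<in>J. sqnorm_n n (w i)) \<le> 4 * R"
proof -
  have fin: "finite J" using J finite_subset by blast
  obtain E where E: "E \<subseteq> J" "(\<Sum>i\<in>J. sqnorm_n n (w i)) \<le> sqnorm_n n (lincomb n J (\<lambda>i. if i \<in> E then 1 else - 1) w)"
    using signed_sum_ge[OF fin] by blast
  have "sqnorm_n n (lincomb n J (\<lambda>i. if i \<in> E then 1 else - 1) w)
      = sqnorm_n n (\<lambda>k. lincomb n E (\<lambda>_. 1) w k - lincomb n (J - E) (\<lambda>_. 1) w k)"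
  proof (rule sqnorm_n_cong)
    fix k assume k: "k < n"
    have "(\<Sum>i\<in>J. (if i \<in> E then 1 else - 1) * w i k)
        = (\<Sum>i\<in>J - E. (if i \<in> E then 1 else - 1) * w i k) + (\<Sum>i\<in>E. (if i \<in> E then 1 else - 1) * w i k)"
      using fin E by (intro sum.subset_diff) auto
    then show "lincomb n J (\<lambda>i. if i \<in> E then 1 else - 1) w k = lincomb n E (\<lambda>_. 1) w k - lincomb n (J - E) (\<lambda>_. 1) w k"
      using k by (simp add: lincomb_def sum_negf)
  qed
  also have "\<dots> \<le> 2 * sqnorm_n n (lincomb n E (\<lambda>_. 1) w) + 2 * sqnorm_n n (lincomb n (J - E) (\<lambda>_. 1) w)"
    by (rule sqnorm_n_diff_le)
  also have "\<dots> \<le> 2 * R + 2 * R"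
  proof (intro add_mono mult_left_mono)
    have "card E \<le> card J" "card (J - E) \<le> card J" using E fin by (auto intro: card_mono)
    then show "sqnorm_n n (lincomb n E (\<lambda>_. 1) w) \<le> R" "sqnorm_n n (lincomb n (J - E) (\<lambda>_. 1) w) \<le> R"
      using w J E unfolding subset_sums_bounded_def by (meson Diff_subset order_trans)+
  qed auto
  finally show ?thesis using E by simp
qed

section \<open>The volume of one random simplex\<close>

lemma gauss1_Icc_le: "emeasure gauss1 {a..b} \<le> ennreal (b - a)"
proof -
  have d: "std_normal_density x \<le> 1" for x
  proof -
    have "1 \<le> sqrt (2 * pi)" using pi_ge_two by (intro real_le_rsqrt) auto
    then have "1 / sqrt (2 * pi) * exp (- x\<^sup>2 / 2) \<le> 1 * 1" by (intro mult_mono) auto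
    then show ?thesis by (simp add: std_normal_density_def)
  qed
  have "emeasure gauss1 {a..b} = (\<integral>\<^sup>+x. ennreal (std_normal_density x) * indicator {a..b} x \<partial>lborel)"
    by (rule emeasure_density) auto
  also have "\<dots> \<le> (\<integral>\<^sup>+x. 1 * indicator {a..b} x \<partial>lborel)"
    using d by (intro nn_integral_mono mult_right_mono) (auto simp: ennreal_le_1)
  also have "\<dots> = emeasure lborel {a..b}" by simp
  also have "\<dots> \<le> ennreal (b - a)" by (cases "a \<le> b") auto
  finally show ?thesis .
qed

text \<open>Sectioned along coordinate k the slab becomes an interval of length 2 s, and the normal
  density is at most 1. Measuring the width by a single coordinate of u instead of its norm costs
  only polynomial factors later.\<close>

lemma emeasure_gauss_slab_le:
  assumes k: "k < n" and max: "\<And>j. j < n \<Longrightarrow> \<bar>u j\<bar> \<le> \<bar>u k\<bar>" and ne: "u k \<noteq> 0" and s: "0 \<le> s"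
  shows "emeasure (gauss_n n) {x\<in>space (gauss_n n). \<bar>dot n u x - t\<bar> \<le> s * \<bar>u k\<bar>} \<le> ennreal (2 * s)"
proof -
  interpret P: prob_space "PiM ({..<n} - {k}) (\<lambda>_. gauss1)" by (rule prob_space_PiM) (rule prob_space_gauss1)
  have "emeasure gauss1 {y\<in>space gauss1. \<bar>u k * y + b\<bar> \<le> s * \<bar>u k\<bar>} \<le> ennreal (2 * s)" for b
  proof -
    have "{y\<in>space gauss1. \<bar>u k * y + b\<bar> \<le> s * \<bar>u k\<bar>} \<subseteq> {- b / u k - s .. - b / u k + s}"
    proof
      fix y assume "y \<in> {y\<in>space gauss1. \<bar>u k * y + b\<bar> \<le> s * \<bar>u k\<bar>}"
      then have "\<bar>u k * (y + b / u k)\<bar> \<le> s * \<bar>u k\<bar>" using ne by (simp add: distrib_left)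
      then have "\<bar>y + b / u k\<bar> \<le> s" using ne by (simp add: abs_mult mult.commute)
      then show "y \<in> {- b / u k - s .. - b / u k + s}" by auto
    qed
    then have "emeasure gauss1 {y\<in>space gauss1. \<bar>u k * y + b\<bar> \<le> s * \<bar>u k\<bar>} \<le> emeasure gauss1 {- b / u k - s .. - b / u k + s}"
      by (rule emeasure_mono) simp
    also have "\<dots> \<le> ennreal (2 * s)" using gauss1_Icc_le[of "- b / u k - s" "- b / u k + s"] by simp
    finally show ?thesis .
  qed
  from emeasure_slab_le[where u=u, OF gauss1_product.product_sigma_finite_axioms _ k this, of t]
  show ?thesis using P.emeasure_space_1 by (simp add: gauss_n_def)
qed

text \<open>The parameter e treats both bodies at once: e = 1 gives the edges at vertex
  \<open>w 0\<close> of a simplex of sample points, e = 0 gives sample vectors themselves, the edges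
  at the origin for the symmetric body.\<close>

definition edges :: "real \<Rightarrow> (nat \<Rightarrow> nat \<Rightarrow> real) \<Rightarrow> nat \<Rightarrow> nat \<Rightarrow> real" where
  "edges e w j k = w (Suc j) k - e * w 0 k"

lemma lincomb_edges:
  assumes "n \<le> N"
  shows "lincomb n {..<n} c (edges e w) = lincomb n {..N} (\<lambda>i. if i = 0 then - e * (\<Sum>j<n. c j) else if i \<le> n then c (i - 1) else 0) w"
proof -
  let ?d = "\<lambda>i. if i = 0 then - e * (\<Sum>j<n. c j) else if i \<le> n then c (i - 1) else 0"
  have "(\<Sum>i\<le>N. ?d i * w i k) = (\<Sum>j<n. c j * edges e w j k)" for k
  proof -
    have "(\<Sum>i\<le>N. ?d i * w i k) = (\<Sum>i\<le>n. ?d i * w i k)"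
      using assms by (intro sum.mono_neutral_right) auto
    also have "\<dots> = ?d 0 * w 0 k + (\<Sum>j<n. ?d (Suc j) * w (Suc j) k)"
      unfolding lessThan_Suc_atMost[symmetric] by (rule sum.lessThan_Suc_shift)
    also have "\<dots> = - e * (\<Sum>j<n. c j) * w 0 k + (\<Sum>j<n. c j * w (Suc j) k)" by simp
    also have "\<dots> = (\<Sum>j<n. c j * edges e w j k)"
      by (simp add: edges_def algebra_simps sum_subtractf sum_distrib_left sum_negf)
    finally show ?thesis .
  qed
  then show ?thesis by (simp add: lincomb_def)
qed

abbreviation unit_box :: "nat \<Rightarrow> (nat \<Rightarrow> real) set" where
  "unit_box n \<equiv> PiE {..<n} (\<lambda>_. {0..1})"

lemma sets_box: "(\<And>k. k < n \<Longrightarrow> A k \<in> sets borel) \<Longrightarrow> PiE {..<n} A \<in> sets (lebesgue_n n)"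
  unfolding lebesgue_n_def by (rule sets_PiM_I_finite) auto

lemma measurable_edges:
  assumes "n \<le> N" "j < n" "k < n"
  shows "(\<lambda>w. edges e w j k) \<in> borel_measurable (gauss_space n N)"
  unfolding edges_def gauss_space_eq using assms
  by (intro borel_measurable_diff borel_measurable_times borel_measurable_const measurable_PiM_gauss_n_component) auto

text \<open>The combination is s times a standard Gaussian vector with s at least r, whatever e is:
  the coefficient of \<open>w 0\<close> can only increase s. Each coordinate falls into [0, 1] with
  probability at most 1 / s.\<close>

lemma edges_hit_box_prob:
  assumes nN: "n \<le> N" and r: "0 < r" "r\<^sup>2 \<le> sqnorm_n n c"
  shows "emeasure (gauss_space n N) {w\<in>space (gauss_space n N). lincomb n {..<n} c (edges e w) \<in> unit_box n} \<le> ennreal ((1 / r) ^ n)"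
proof -
  let ?G = "gauss_space n N"
  let ?d = "\<lambda>i. if i = 0 then - e * (\<Sum>j<n. c j) else if i \<le> n then c (i - 1) else 0"
  define s where "s = sqrt (\<Sum>i\<le>N. (?d i)\<^sup>2)"
  have "sqnorm_n n c = (\<Sum>j<n. (?d (Suc j))\<^sup>2)" by (simp add: sqnorm_n_def)
  also have "\<dots> = (\<Sum>i\<in>Suc ` {..<n}. (?d i)\<^sup>2)" by (simp add: sum.reindex)
  also have "\<dots> \<le> (\<Sum>i\<le>N. (?d i)\<^sup>2)" using nN by (intro sum_mono2) auto
  finally have "r\<^sup>2 \<le> (\<Sum>i\<le>N. (?d i)\<^sup>2)" using r by linarith
  then have s: "r \<le> s" unfolding s_def by (intro real_le_rsqrt) simp
  have Q: "unit_box n \<in> sets (lebesgue_n n)" by (rule sets_box) simp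
  have lm: "(\<lambda>w. lincomb n {..N} ?d w) \<in> measurable ?G (lebesgue_n n)"
    unfolding gauss_space_eq by (rule measurable_gauss_lincomb) simp
  have "emeasure ?G {w\<in>space ?G. lincomb n {..<n} c (edges e w) \<in> unit_box n}
      = emeasure ?G ((\<lambda>w. lincomb n {..N} ?d w) -` unit_box n \<inter> space ?G)"
    unfolding lincomb_edges[OF nN] by (rule arg_cong[where f="emeasure ?G"]) auto
  also have "\<dots> = (\<integral>\<^sup>+w. indicator ((\<lambda>w. lincomb n {..N} ?d w) -` unit_box n \<inter> space ?G) w \<partial>?G)"
    using measurable_sets[OF lm Q] by simp
  also have "\<dots> = (\<integral>\<^sup>+w. indicator (unit_box n) (lincomb n {..N} ?d w) \<partial>?G)"
    by (intro nn_integral_cong) (simp add: indicator_def)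
  also have "\<dots> = (\<integral>\<^sup>+z. indicator (unit_box n) (\<lambda>k\<in>{..<n}. s * z k) \<partial>gauss_n n)"
    unfolding gauss_space_eq s_def by (rule nn_integral_gauss_lincomb) (use Q in auto)
  also have "\<dots> = (\<integral>\<^sup>+z. indicator (PiE {..<n} (\<lambda>_. {0..1/s})) z \<partial>gauss_n n)"
  proof (intro nn_integral_cong)
    fix z assume z: "z \<in> space (gauss_n n)"
    have "0 \<le> s * y \<and> s * y \<le> 1 \<longleftrightarrow> 0 \<le> y \<and> y \<le> 1 / s" for y
      using s r by (auto simp: zero_le_mult_iff field_simps)
    then show "(indicator (unit_box n) (\<lambda>k\<in>{..<n}. s * z k) :: ennreal) = indicator (PiE {..<n} (\<lambda>_. {0..1/s})) z"
      using z by (auto simp: indicator_def PiE_iff space_gauss_n space_lebesgue_n)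
  qed
  also have "\<dots> = emeasure (gauss_n n) (PiE {..<n} (\<lambda>_. {0..1/s}))"
    by (intro nn_integral_indicator) (simp add: sets_gauss_n sets_box)
  also have "\<dots> = (\<Prod>k<n. emeasure gauss1 {0..1/s})"
    unfolding gauss_n_def by (rule gauss1_product.emeasure_PiM) auto
  also have "\<dots> = emeasure gauss1 {0..1/s} ^ n" by simp
  also have "\<dots> \<le> ennreal (1 / r) ^ n"
  proof -
    have "emeasure gauss1 {0..1/s} \<le> ennreal (1 / s)" using gauss1_Icc_le[of 0 "1/s"] by simp
    also have "\<dots> \<le> ennreal (1 / r)" using s r by (intro ennreal_leI divide_left_mono) auto
    finally have "emeasure gauss1 {0..1/s} ^ m \<le> ennreal (1 / r) ^ m" for m
      by (induction m) (auto intro!: mult_mono)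
    then show ?thesis .
  qed
  also have "\<dots> = ennreal ((1 / r) ^ n)" using r by (simp add: ennreal_power)
  finally show ?thesis .
qed

text \<open>Conditioning on all vectors but one: a normal vector to the other edges is chosen arbitrarily, without
  any measurability in the conditioning, since only the measure of each section matters.\<close>

lemma edge_event_prob_le:
  assumes n: "j < n" "n \<le> N" and s: "0 \<le> s" and A: "A \<in> sets (gauss_space n N)"
    and sec: "\<And>w u k. \<lbrakk>w \<in> A; k < n; u k \<noteq> 0; \<And>i. i < n \<Longrightarrow> \<bar>u i\<bar> \<le> \<bar>u k\<bar>;
      \<And>i. i < n \<Longrightarrow> i \<noteq> j \<Longrightarrow> dot n u (edges e w i) = 0\<rbrakk> \<Longrightarrow> \<bar>dot n u (edges e w j)\<bar> \<le> s * \<bar>u k\<bar>"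
  shows "emeasure (gauss_space n N) A \<le> ennreal (2 * s)"
proof -
  let ?I = "{..N} - {Suc j}"
  interpret P: prob_space "PiM ?I (\<lambda>_. gauss_n n)" by (rule prob_space_PiM) (rule prob_space_gauss_n)
  have ins: "{..N} = insert (Suc j) ?I" using n by auto
  have "emeasure (gauss_space n N) A = (\<integral>\<^sup>+w. indicator A w \<partial>gauss_space n N)" using A by simp
  also have "\<dots> = (\<integral>\<^sup>+w. (\<integral>\<^sup>+g. indicator A (w(Suc j := g)) \<partial>gauss_n n) \<partial>PiM ?I (\<lambda>_. gauss_n n))"
    using gauss_n_product.product_nn_integral_insert[of ?I "Suc j" "indicator A" n] A
    unfolding ins[symmetric] gauss_space_eq by simp
  also have "\<dots> \<le> (\<integral>\<^sup>+w. ennreal (2 * s) \<partial>PiM ?I (\<lambda>_. gauss_n n))"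
  proof (rule nn_integral_mono)
    fix w assume w: "w \<in> space (PiM ?I (\<lambda>_. gauss_n n))"
    \<comment> \<open>n - 1 orthogonality conditions in n unknowns. The edges involved do not depend
      on sample \<open>Suc j\<close>, so u is fixed while that sample is integrated over.\<close>
    obtain u where u: "\<exists>k\<in>{..<n}. u k \<noteq> 0" "\<forall>i\<in>{..<n} - {j}. (\<Sum>k<n. u k * edges e w i k) = 0"
      using homogeneous_system_nontrivial[of "{..<n} - {j}" "{..<n}" "\<lambda>k i. edges e w i k"] n by auto
    have fin: "finite ((\<lambda>k. \<bar>u k\<bar>) ` {..<n})" "(\<lambda>k. \<bar>u k\<bar>) ` {..<n} \<noteq> {}" using n by auto
    obtain k where k: "k < n" "\<bar>u k\<bar> = Max ((\<lambda>k. \<bar>u k\<bar>) ` {..<n})"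
      using Max_in[OF fin] by auto
    have max: "\<bar>u i\<bar> \<le> \<bar>u k\<bar>" if "i < n" for i unfolding k(2) using fin that by (intro Max_ge) auto
    have ne: "u k \<noteq> 0" using u(1) max by force
    have upd: "edges e (w(Suc j := g)) i = edges e w i" if "i \<noteq> j" for g i
      using that by (auto simp: edges_def)
    have "(\<integral>\<^sup>+g. indicator A (w(Suc j := g)) \<partial>gauss_n n)
        \<le> (\<integral>\<^sup>+g. indicator {x\<in>space (gauss_n n). \<bar>dot n u x - e * dot n u (w 0)\<bar> \<le> s * \<bar>u k\<bar>} g \<partial>gauss_n n)"
    proof (rule nn_integral_mono)
      fix g assume g: "g \<in> space (gauss_n n)"
      have "\<bar>dot n u g - e * dot n u (w 0)\<bar> \<le> s * \<bar>u k\<bar>" if "w(Suc j := g) \<in> A"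
      proof -
        have "\<bar>dot n u (edges e (w(Suc j := g)) j)\<bar> \<le> s * \<bar>u k\<bar>"
          using that k(1) ne max by (rule sec) (use u(2) in \<open>auto simp: upd dot_def\<close>)
        moreover have "dot n u (edges e (w(Suc j := g)) j) = dot n u g - e * dot n u (w 0)"
          by (simp add: dot_def edges_def right_diff_distrib sum_subtractf sum_distrib_left mult.left_commute)
        ultimately show ?thesis by simp
      qed
      then show "(indicator A (w(Suc j := g)) :: ennreal) \<le> indicator {x\<in>space (gauss_n n). \<bar>dot n u x - e * dot n u (w 0)\<bar> \<le> s * \<bar>u k\<bar>} g"
        using g by (auto simp: indicator_def)
    qed
    also have "\<dots> = emeasure (gauss_n n) {x\<in>space (gauss_n n). \<bar>dot n u x - e * dot n u (w 0)\<bar> \<le> s * \<bar>u k\<bar>}"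
      unfolding dot_def by (intro nn_integral_indicator) measurable
    also have "\<dots> \<le> ennreal (2 * s)" by (rule emeasure_gauss_slab_le[where u=u, OF k(1) max ne s])
    finally show "(\<integral>\<^sup>+g. indicator A (w(Suc j := g)) \<partial>gauss_n n) \<le> ennreal (2 * s)" .
  qed
  also have "\<dots> = ennreal (2 * s)" using P.emeasure_space_1 by simp
  finally show ?thesis .
qed

lemma dot_lincomb:
  "dot n u (lincomb n I c v) = (\<Sum>i\<in>I. c i * dot n u (v i))"
proof -
  have "dot n u (lincomb n I c v) = (\<Sum>k<n. \<Sum>i\<in>I. c i * (u k * v i k))"
    unfolding dot_def by (simp add: lincomb_def sum_distrib_left mult.left_commute)
  also have "\<dots> = (\<Sum>i\<in>I. c i * dot n u (v i))"
    unfolding dot_def sum_distrib_left by (rule sum.swap)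
  finally show ?thesis .
qed

lemma dot_cong: "(\<And>k. k < n \<Longrightarrow> x k = y k) \<Longrightarrow> dot n u x = dot n u y"
  by (simp add: dot_def)

text \<open>If edge j is a combination of the other edges, it is orthogonal to every normal of them:
  the event is a slab of width s = 0.\<close>

lemma edges_indep_AE:
  assumes n: "n \<le> N"
  shows "{w\<in>space (gauss_space n N). \<not> lin_indep n (edges e w)} \<in> null_sets (gauss_space n N)"
proof -
  let ?G = "gauss_space n N"
  define C where "C = (\<lambda>j m. {c :: nat \<Rightarrow> real. \<forall>i. c i \<in> (if i \<in> {..<n} - {j} then {-real m..real m} else {0})})"
  \<comment> \<open>The linear span is exhausted by countably many compact coefficient boxes, which
    makes the event measurable.\<close>
  define S where "S = (\<lambda>j. \<Union>m. {w\<in>space ?G. \<exists>c\<in>C j m. \<forall>k<n. edges e w j k = (\<Sum>i\<in>{..<n} - {j}. c i * edges e w i k)})"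
  have S: "S j \<in> sets ?G" if "j < n" for j
    unfolding S_def C_def
    by (intro sets.countable_UN image_subsetI sets_solution_set compact_coeff_box measurable_edges n) (use that in auto)
  have null: "S j \<in> null_sets ?G" if j: "j < n" for j
  proof -
    have "emeasure ?G (S j) \<le> ennreal (2 * 0)"
    proof (rule edge_event_prob_le[OF j n _ S[OF j], where e=e])
      fix w u k assume w: "w \<in> S j" and u: "\<And>i. i < n \<Longrightarrow> i \<noteq> j \<Longrightarrow> dot n u (edges e w i) = 0"
      from w obtain c where c: "\<forall>k<n. edges e w j k = (\<Sum>i\<in>{..<n} - {j}. c i * edges e w i k)"
        by (auto simp: S_def)
      have "dot n u (edges e w j) = dot n u (lincomb n ({..<n} - {j}) c (edges e w))"
        using c by (intro dot_cong) (simp add: lincomb_def)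
      also have "\<dots> = 0" unfolding dot_lincomb using u by simp
      finally show "\<bar>dot n u (edges e w j)\<bar> \<le> 0 * \<bar>u k\<bar>" by simp
    qed simp
    then show ?thesis using S[OF j] by (simp add: null_setsI)
  qed
  have "{w\<in>space ?G. \<not> lin_indep n (edges e w)} = (\<Union>j<n. S j)"
  proof (intro equalityI subsetI)
    fix w assume w: "w \<in> {w\<in>space ?G. \<not> lin_indep n (edges e w)}"
    then obtain c j where c: "\<forall>k<n. (\<Sum>i<n. c i * edges e w i k) = 0" "j < n" "c j \<noteq> 0"
      unfolding lin_indep_def by auto
    define d where "d = (\<lambda>i. if i \<in> {..<n} - {j} then - c i / c j else 0)"
    obtain m :: nat where m: "(\<Sum>i<n. \<bar>d i\<bar>) \<le> real m" using real_arch_simple by blast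
    have dm: "\<bar>d i\<bar> \<le> real m" if "i < n" for i
      using member_le_sum[of i "{..<n}" "\<lambda>i. \<bar>d i\<bar>"] that m by auto
    have "d \<in> C j m" unfolding C_def using dm by (force simp: d_def abs_le_iff)
    moreover have "edges e w j k = (\<Sum>i\<in>{..<n} - {j}. d i * edges e w i k)" if k: "k < n" for k
    proof -
      have "c j * edges e w j k + (\<Sum>i\<in>{..<n} - {j}. c i * edges e w i k) = 0"
        using c k sum.remove[of "{..<n}" j "\<lambda>i. c i * edges e w i k"] by auto
      then have "edges e w j k = - (\<Sum>i\<in>{..<n} - {j}. c i * edges e w i k) / c j"
        using c(3) by (simp add: field_simps add_eq_0_iff)
      also have "\<dots> = (\<Sum>i\<in>{..<n} - {j}. d i * edges e w i k)"
        by (simp add: d_def sum_divide_distrib sum_negf[symmetric])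
      finally show ?thesis .
    qed
    ultimately show "w \<in> (\<Union>j<n. S j)" using c(2) w by (auto simp: S_def)
  next
    fix w assume "w \<in> (\<Union>j<n. S j)"
    then obtain j c where j: "j < n" "w \<in> space ?G" "\<forall>k<n. edges e w j k = (\<Sum>i\<in>{..<n} - {j}. c i * edges e w i k)"
      by (auto simp: S_def)
    define d where "d = (\<lambda>i. if i = j then - 1 else c i)"
    have "(\<Sum>i<n. d i * edges e w i k) = 0" if k: "k < n" for k
    proof -
      have "(\<Sum>i<n. d i * edges e w i k) = d j * edges e w j k + (\<Sum>i\<in>{..<n} - {j}. d i * edges e w i k)"
        using j by (intro sum.remove) auto
      also have "(\<Sum>i\<in>{..<n} - {j}. d i * edges e w i k) = (\<Sum>i\<in>{..<n} - {j}. c i * edges e w i k)"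
        by (intro sum.cong) (auto simp: d_def)
      finally show ?thesis using j k by (simp add: d_def)
    qed
    moreover have "d j \<noteq> 0" by (simp add: d_def)
    ultimately have "\<not> lin_indep n (edges e w)" using j(1) unfolding lin_indep_def by blast
    then show "w \<in> {w\<in>space ?G. \<not> lin_indep n (edges e w)}" using j by simp
  qed
  also have "\<dots> \<in> null_sets ?G" using null by (intro null_sets_UN') auto
  finally show ?thesis .
qed

definition coeff_cube :: "nat \<Rightarrow> real \<Rightarrow> (nat \<Rightarrow> real) set" where
  "coeff_cube n R = {c. \<forall>i. c i \<in> (if i \<in> {..<n} then {-R..R} else {0})}"

text \<open>Cramer's rule without determinants: pairing x with a normal u of all edges but the j-th
  determines c j as a quotient. Its numerator is at most n times the largest |u k|, so |c j| > R
  confines edge j to a thin slab. A union bound over j gives the square of n.\<close>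

lemma edges_coeff_prob:
  assumes n: "n \<le> N" and R: "R > 0" and x: "x \<in> unit_box n"
  shows "emeasure (gauss_space n N) {w\<in>space (gauss_space n N).
    \<not> (\<exists>c\<in>coeff_cube n R. \<forall>k<n. x k = (\<Sum>i<n. c i * edges e w i k))} \<le> ennreal (2 * (real n)\<^sup>2 / R)"
proof -
  let ?G = "gauss_space n N"
  define Z where "Z = {w\<in>space ?G. \<not> lin_indep n (edges e w)}"
  have Z: "Z \<in> null_sets ?G" unfolding Z_def by (rule edges_indep_AE[OF n])
  \<comment> \<open>Only coefficient j is restricted to R. The others range over all reals,
    exhausted by the compact boxes indexed by m, so that the j-th event is measurable.\<close>
  define C where "C = (\<lambda>j m. PiE UNIV (\<lambda>i::nat. if i = j then {-R..R} else if i < n then {-real m..real m} else {0}))"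
  have C: "compact (C j m)" for j m unfolding C_def by (rule compact_PiE_UNIV) auto
  define V where "V = (\<lambda>j. \<Union>m. {w\<in>space ?G. \<exists>c\<in>C j m. \<forall>k<n. x k = (\<Sum>i<n. c i * edges e w i k)})"
  have V: "V j \<in> sets ?G" for j unfolding V_def
    by (intro sets.countable_UN image_subsetI sets_solution_set C measurable_edges n) auto
  define A where "A = (\<lambda>j. space ?G - Z - V j)"
  have A: "A j \<in> sets ?G" for j unfolding A_def using V Z by auto
  have pA: "emeasure ?G (A j) \<le> ennreal (2 * (real n / R))" if j: "j < n" for j
  proof (rule edge_event_prob_le[OF j n _ A, where e=e])
    fix w u k assume w: "w \<in> A j" and k: "k < n" "u k \<noteq> 0" "\<And>i. i < n \<Longrightarrow> \<bar>u i\<bar> \<le> \<bar>u k\<bar>"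
      and u: "\<And>i. i < n \<Longrightarrow> i \<noteq> j \<Longrightarrow> dot n u (edges e w i) = 0"
    have li: "lin_indep n (edges e w)" "w \<in> space ?G" "w \<notin> V j" using w by (auto simp: A_def Z_def)
    obtain b where b: "\<forall>k<n. (\<Sum>i<n. b i * edges e w i k) = x k" using lin_indep_surj[OF li(1), of x] by blast
    define c where "c = (\<lambda>i. if i < n then b i else 0)"
    have c: "\<forall>k<n. x k = (\<Sum>i<n. c i * edges e w i k)" using b by (simp add: c_def)
    have "\<bar>c j\<bar> > R"
    proof (rule ccontr)
      assume le: "\<not> \<bar>c j\<bar> > R"
      obtain m :: nat where m: "(\<Sum>i<n. \<bar>c i\<bar>) \<le> real m" using real_arch_simple by blast
      have "\<bar>c i\<bar> \<le> real m" if "i < n" for i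
        using member_le_sum[of i "{..<n}" "\<lambda>i. \<bar>c i\<bar>"] that m by auto
      then have "c \<in> C j m" using le j unfolding C_def by (force simp: PiE_iff abs_le_iff c_def)
      then have "w \<in> V j" using c li(2) by (auto simp: V_def)
      then show False using li by simp
    qed
    have "dot n u x = dot n u (lincomb n {..<n} c (edges e w))" using c by (intro dot_cong) (simp add: lincomb_def)
    also have "\<dots> = (\<Sum>i<n. c i * dot n u (edges e w i))" by (rule dot_lincomb)
    also have "\<dots> = c j * dot n u (edges e w j)"
      using u j sum.remove[of "{..<n}" j "\<lambda>i. c i * dot n u (edges e w i)"] by simp
    finally have "\<bar>c j\<bar> * \<bar>dot n u (edges e w j)\<bar> = \<bar>dot n u x\<bar>" by (simp add: abs_mult)
    moreover have "R * \<bar>dot n u (edges e w j)\<bar> \<le> \<bar>c j\<bar> * \<bar>dot n u (edges e w j)\<bar>"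
      using \<open>\<bar>c j\<bar> > R\<close> by (intro mult_right_mono) auto
    moreover have "\<bar>dot n u x\<bar> \<le> real n * \<bar>u k\<bar>"
    proof -
      have "\<bar>dot n u x\<bar> \<le> (\<Sum>i<n. \<bar>u i * x i\<bar>)" unfolding dot_def by (rule sum_abs)
      also have "\<dots> \<le> (\<Sum>i<n. \<bar>u k\<bar>)"
      proof (rule sum_mono)
        fix i assume i: "i \<in> {..<n}"
        then have "\<bar>x i\<bar> \<le> 1" using x by (force simp: PiE_iff)
        then have "\<bar>u i\<bar> * \<bar>x i\<bar> \<le> \<bar>u k\<bar> * 1" using k(3) i by (intro mult_mono) auto
        then show "\<bar>u i * x i\<bar> \<le> \<bar>u k\<bar>" by (simp add: abs_mult)
      qed
      finally show ?thesis by simp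
    qed
    ultimately have "R * \<bar>dot n u (edges e w j)\<bar> \<le> real n * \<bar>u k\<bar>" by linarith
    then show "\<bar>dot n u (edges e w j)\<bar> \<le> real n / R * \<bar>u k\<bar>" using R by (simp add: field_simps)
  qed (use R in simp)
  have sub: "{w\<in>space ?G. \<not> (\<exists>c\<in>coeff_cube n R. \<forall>k<n. x k = (\<Sum>i<n. c i * edges e w i k))} \<subseteq> Z \<union> (\<Union>j<n. A j)"
  proof
    fix w assume w: "w \<in> {w\<in>space ?G. \<not> (\<exists>c\<in>coeff_cube n R. \<forall>k<n. x k = (\<Sum>i<n. c i * edges e w i k))}"
    show "w \<in> Z \<union> (\<Union>j<n. A j)"
    proof (rule ccontr)
      assume neg: "w \<notin> Z \<union> (\<Union>j<n. A j)"
      then have li: "lin_indep n (edges e w)" using w by (auto simp: Z_def)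
      obtain b where b: "\<forall>k<n. (\<Sum>i<n. b i * edges e w i k) = x k" using lin_indep_surj[OF li, of x] by blast
      define c where "c = (\<lambda>i. if i < n then b i else 0)"
      have c: "\<forall>k<n. x k = (\<Sum>i<n. c i * edges e w i k)" using b by (simp add: c_def)
      have "c j \<in> {-R..R}" if j: "j < n" for j
      proof -
        have "w \<in> V j" using neg w j by (auto simp: A_def)
        then obtain m d where d: "d \<in> C j m" "\<forall>k<n. x k = (\<Sum>i<n. d i * edges e w i k)" by (auto simp: V_def)
        have "(\<Sum>i<n. (c i - d i) * edges e w i k) = 0" if "k < n" for k
          using c d(2) that by (simp add: left_diff_distrib sum_subtractf)
        then have "c j - d j = 0"
          using li[unfolded lin_indep_def, THEN spec, of "\<lambda>i. c i - d i"] j by simp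
        moreover have "d j \<in> {-R..R}" using d(1) unfolding C_def by (auto simp: PiE_iff dest: spec[of _ j])
        ultimately show ?thesis by simp
      qed
      then have "c \<in> coeff_cube n R" by (simp add: coeff_cube_def c_def)
      then show False using c w by blast
    qed
  qed
  have "emeasure ?G {w\<in>space ?G. \<not> (\<exists>c\<in>coeff_cube n R. \<forall>k<n. x k = (\<Sum>i<n. c i * edges e w i k))} \<le> emeasure ?G (Z \<union> (\<Union>j<n. A j))"
    using Z A by (intro emeasure_mono[OF sub]) auto
  also have "\<dots> \<le> emeasure ?G Z + emeasure ?G (\<Union>j<n. A j)"
    using Z A by (intro emeasure_subadditive) auto
  also have "\<dots> = emeasure ?G (\<Union>j<n. A j)" using Z by (simp add: null_setsD1)
  also have "\<dots> \<le> (\<Sum>j<n. emeasure ?G (A j))" using A by (intro emeasure_subadditive_finite) auto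
  also have "\<dots> \<le> (\<Sum>j<n. ennreal (2 * (real n / R)))" using pA by (intro sum_mono) auto
  also have "\<dots> = ennreal (2 * (real n)\<^sup>2 / R)"
    using R by (simp add: ennreal_of_nat_eq_real_of_nat ennreal_mult[symmetric] power2_eq_square algebra_simps)
  finally show ?thesis .
qed

section \<open>Markov's inequality and Euclidean balls\<close>

lemma Markov_strict:
  assumes [measurable]: "u \<in> borel_measurable M" and a: "(\<integral>\<^sup>+x. u x \<partial>M) \<le> ennreal a" and t: "0 < t" "0 \<le> a"
  shows "emeasure M {x\<in>space M. ennreal t < u x} \<le> ennreal (a / t)"
proof -
  let ?A = "{x\<in>space M. ennreal t < u x}"
  have "ennreal t * emeasure M ?A = (\<integral>\<^sup>+x. ennreal t * indicator ?A x \<partial>M)"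
    by (rule nn_integral_cmult_indicator[symmetric]) measurable
  also have "\<dots> \<le> (\<integral>\<^sup>+x. u x \<partial>M)" by (intro nn_integral_mono) (auto simp: indicator_def)
  also have "\<dots> \<le> ennreal a" by (rule a)
  finally have "ennreal (1 / t) * (ennreal t * emeasure M ?A) \<le> ennreal (1 / t) * ennreal a"
    by (rule mult_left_mono) simp
  moreover have "ennreal (1 / t) * (ennreal t * emeasure M ?A) = emeasure M ?A"
    using t by (simp add: mult.assoc[symmetric] ennreal_mult[symmetric])
  ultimately show ?thesis using t by (simp add: ennreal_mult[symmetric])
qed

text \<open>On the ball the indicator is at most exp (n / 2 - |x|^2 / (2 s^2)) with s = \<rho> /
  sqrt n, a product of one-dimensional Gaussians of integral sqrt (2 pi e) s; and sqrt (2 pi e) is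
  below 5.\<close>

lemma emeasure_euclidean_ball_le:
  assumes n: "1 \<le> n" and rho: "0 < \<rho>"
  shows "emeasure (lebesgue_n n) {x\<in>space (lebesgue_n n). sqnorm_n n x \<le> \<rho>\<^sup>2} \<le> ennreal ((5 * \<rho> / sqrt (real n)) ^ n)"
proof -
  let ?L = "lebesgue_n n" and ?B = "{x\<in>space (lebesgue_n n). sqnorm_n n x \<le> \<rho>\<^sup>2}"
  define s where "s = \<rho> / sqrt (real n)"
  have s: "s > 0" using rho n by (simp add: s_def)
  define q where "q = sqrt (2 * pi * s\<^sup>2) * exp (1 / 2)"
  have q: "q \<ge> 0" by (simp add: q_def)
  define g where "g = (\<lambda>y. ennreal (q * normal_density 0 s y))"
  have int: "(\<integral>\<^sup>+y. g y \<partial>lborel) = ennreal q"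
  proof -
    have "(\<integral>\<^sup>+y. g y \<partial>lborel) = (\<integral>\<^sup>+y. ennreal q * ennreal (normal_density 0 s y) \<partial>lborel)"
      by (simp add: g_def ennreal_mult q)
    also have "\<dots> = ennreal q * (\<integral>\<^sup>+y. ennreal (normal_density 0 s y) \<partial>lborel)"
      by (rule nn_integral_cmult) measurable
    also have "(\<integral>\<^sup>+y. ennreal (normal_density 0 s y) \<partial>lborel) = 1"
      using s by (subst nn_integral_eq_integral) auto
    finally show ?thesis by simp
  qed
  have gy: "g y = ennreal (exp (1 / 2 - y\<^sup>2 / (2 * s\<^sup>2)))" for y
    using s by (simp add: g_def q_def normal_density_def mult_exp_exp)
  have "emeasure ?L ?B = (\<integral>\<^sup>+x. indicator ?B x \<partial>?L)" by (rule nn_integral_indicator[symmetric]) measurable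
  also have "\<dots> \<le> (\<integral>\<^sup>+x. (\<Prod>k<n. g (x k)) \<partial>?L)"
  proof (rule nn_integral_mono)
    fix x assume x: "x \<in> space ?L"
    have "(\<Prod>k<n. g (x k)) = ennreal (\<Prod>k<n. exp (1 / 2 - (x k)\<^sup>2 / (2 * s\<^sup>2)))"
      unfolding gy by (rule prod_ennreal) simp
    also have "(\<Prod>k<n. exp (1 / 2 - (x k)\<^sup>2 / (2 * s\<^sup>2))) = exp (real n / 2 - sqnorm_n n x / (2 * s\<^sup>2))"
      by (simp add: exp_sum[symmetric] sum_subtractf sqnorm_n_def sum_divide_distrib)
    finally have p: "(\<Prod>k<n. g (x k)) = ennreal (exp (real n / 2 - sqnorm_n n x / (2 * s\<^sup>2)))" .
    have "1 \<le> exp (real n / 2 - sqnorm_n n x / (2 * s\<^sup>2))" if "sqnorm_n n x \<le> \<rho>\<^sup>2"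
    proof -
      have "sqnorm_n n x / (2 * s\<^sup>2) \<le> \<rho>\<^sup>2 / (2 * s\<^sup>2)" using that by (intro divide_right_mono) auto
      also have "\<dots> = real n / 2" using rho n by (simp add: s_def power_divide)
      finally show ?thesis by simp
    qed
    then show "indicator ?B x \<le> (\<Prod>k<n. g (x k))" unfolding p by (auto simp: indicator_def)
  qed
  also have "\<dots> = (\<Prod>k<n. \<integral>\<^sup>+y. g y \<partial>lborel)"
    unfolding lebesgue_n_def by (rule lborel_product.product_nn_integral_prod) (auto simp: g_def)
  also have "\<dots> = ennreal (q ^ n)" using q by (simp add: int ennreal_power)
  also have "\<dots> \<le> ennreal ((5 * s) ^ n)"
  proof (intro ennreal_leI power_mono q)
    have "2 * pi * exp 1 \<le> 2 * 4 * 3"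
      using pi_less_4 exp_le by (intro mult_mono) auto
    then have "sqrt (2 * pi) * exp (1 / 2) \<le> 5"
    proof -
      assume le: "2 * pi * exp 1 \<le> 2 * 4 * 3"
      have "(sqrt (2 * pi) * exp (1 / 2))\<^sup>2 = 2 * pi * exp 1"
        by (simp add: power_mult_distrib exp_double[symmetric])
      also have "\<dots> \<le> 5\<^sup>2" using le by simp
      finally show ?thesis by (rule power2_le_imp_le) simp
    qed
    then show "q \<le> 5 * s" using s by (simp add: q_def real_sqrt_mult mult_right_mono mult.commute mult.left_commute)
  qed
  finally show ?thesis by (simp add: s_def)
qed

text \<open>The coefficient cube lies in a ball of radius 2 ^ (5 n + 2), so that linearly many
  dyadic shells exhaust it although R is exponential in n.\<close>

lemma shell_count_bound:
  assumes n: "1 \<le> n" and R: "R = 4 * (real n)\<^sup>2 * exp (real n)"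
  shows "real n * R\<^sup>2 \<le> (2 ^ (5 * n + 2))\<^sup>2"
proof -
  have n2: "real n \<le> 2 ^ n" using of_nat_less_two_power[of n, where 'a=real] by simp
  have e4: "exp (real n) \<le> 4 ^ n"
    using exp_le power_mono[of "exp (1::real)" 4 n] by (simp add: exp_of_nat_mult[symmetric])
  have "sqrt (real n) * R \<le> 2 ^ n * (4 * (2 ^ n)\<^sup>2 * 4 ^ n)"
    unfolding R
  proof (intro mult_mono)
    have "sqrt (real n) \<le> real n" using n by (intro real_le_lsqrt) (auto simp: power2_eq_square)
    then show "sqrt (real n) \<le> 2 ^ n" using n2 by linarith
    show "(real n)\<^sup>2 \<le> (2 ^ n)\<^sup>2" using n2 by (intro power_mono) auto
  qed (use e4 in auto)
  also have "\<dots> = 2 ^ (5 * n + 2)"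
  proof -
    have "(4::real) ^ n = 2 ^ (2 * n)" by (simp add: power_mult)
    then show ?thesis by (simp add: power_add[symmetric] power_mult[symmetric] power2_eq_square algebra_simps)
  qed
  finally have "(sqrt (real n) * R)\<^sup>2 \<le> (2 ^ (5 * n + 2))\<^sup>2"
    using R by (intro power_mono) auto
  then show ?thesis by (simp add: power_mult_distrib)
qed

section \<open>Lower bound for the volume of a simplex with random edges\<close>

context
  fixes n N :: nat and e R :: real
  assumes n: "1 \<le> n" "n \<le> N" and R: "R = 4 * (real n)\<^sup>2 * exp (real n)"
begin

text \<open>For independent edges this is the volume of the part of the unit cube covered by the
  coefficient cube, divided by the modulus of the determinant; a small value forces a large
  determinant.\<close>

definition cube_time :: "(nat \<Rightarrow> nat \<Rightarrow> real) \<Rightarrow> ennreal" where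
  "cube_time w = (\<integral>\<^sup>+c. indicator (PiE {..<n} (\<lambda>_. {-R..R})) c * indicator (unit_box n) (lincomb n {..<n} c (edges e w)) \<partial>lebesgue_n n)"

text \<open>The volume of the part of the unit cube not covered by the image of the coefficient
  cube. R is chosen so that the bound 2 n^2 / R on the probability of missing a point equals exp
  (-n) / 2.\<close>

definition missed_volume :: "(nat \<Rightarrow> nat \<Rightarrow> real) \<Rightarrow> ennreal" where
  "missed_volume w = (\<integral>\<^sup>+x. indicator (unit_box n) x * indicator {x. \<not> (\<exists>c\<in>coeff_cube n R. \<forall>k<n. x k = (\<Sum>i<n. c i * edges e w i k))} x \<partial>lebesgue_n n)"

lemma R_pos: "R > 0" using n R by simp

lemma pair_space: "pair_sigma_finite (gauss_space n N) (lebesgue_n n)"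
  by (intro pair_sigma_finite.intro prob_space_imp_sigma_finite prob_space_gauss_space sigma_finite_lebesgue_n)

lemma measurable_cube_time_kernel:
  "(\<lambda>(w, c). indicator (PiE {..<n} (\<lambda>_. {-R..R})) c * indicator (unit_box n) (lincomb n {..<n} c (edges e w)) :: ennreal)
    \<in> borel_measurable (gauss_space n N \<Otimes>\<^sub>M lebesgue_n n)"
proof -
  let ?P = "gauss_space n N \<Otimes>\<^sub>M lebesgue_n n"
  have lc: "(\<lambda>z. lincomb n {..<n} (snd z) (edges e (fst z))) \<in> measurable ?P (lebesgue_n n)"
    by (rule measurable_lincomb_coeffs)
      (auto intro!: measurable_compose[OF measurable_fst measurable_edges] measurable_compose[OF measurable_snd measurable_lebesgue_n_component] n(2))
  have "(\<lambda>z. indicator (PiE {..<n} (\<lambda>_. {-R..R})) (snd z) * indicator (unit_box n) (lincomb n {..<n} (snd z) (edges e (fst z))) :: ennreal) \<in> borel_measurable ?P"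
    by (intro borel_measurable_times_ennreal measurable_compose[OF lc] measurable_compose[OF measurable_snd] borel_measurable_indicator sets_box) auto
  then show ?thesis by (simp add: case_prod_unfold)
qed

lemma measurable_missed_kernel:
  "(\<lambda>(w, x). indicator (unit_box n) x * indicator {x. \<not> (\<exists>c\<in>coeff_cube n R. \<forall>k<n. x k = (\<Sum>i<n. c i * edges e w i k))} x :: ennreal)
    \<in> borel_measurable (gauss_space n N \<Otimes>\<^sub>M lebesgue_n n)"
proof -
  let ?P = "gauss_space n N \<Otimes>\<^sub>M lebesgue_n n"
  define S where "S = {z\<in>space ?P. \<exists>c\<in>coeff_cube n R. \<forall>k<n. snd z k = (\<Sum>i<n. c i * edges e (fst z) i k)}"
  have S: "S \<in> sets ?P" unfolding S_def
    by (intro sets_solution_set measurable_compose[OF measurable_fst measurable_edges] measurable_compose[OF measurable_snd measurable_lebesgue_n_component] n(2))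
      (auto simp: coeff_cube_def compact_coeff_box[of "{..<n}", simplified])
  have "(\<lambda>z. indicator (unit_box n) (snd z) * indicator (space ?P - S) z :: ennreal) \<in> borel_measurable ?P"
    using S by (intro borel_measurable_times_ennreal measurable_compose[OF measurable_snd] borel_measurable_indicator sets_box) auto
  moreover have "(indicator (unit_box n) (snd z) * indicator (space ?P - S) z :: ennreal)
    = indicator (unit_box n) (snd z) * indicator {x. \<not> (\<exists>c\<in>coeff_cube n R. \<forall>k<n. x k = (\<Sum>i<n. c i * edges e (fst z) i k))} (snd z)" if "z \<in> space ?P" for z
    using that by (auto simp: indicator_def S_def)
  ultimately show ?thesis unfolding case_prod_unfold by (subst (asm) measurable_cong) auto
qed

lemma measurable_cube_time: "cube_time \<in> borel_measurable (gauss_space n N)"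
  unfolding cube_time_def
  by (rule sigma_finite_measure.borel_measurable_nn_integral[OF sigma_finite_lebesgue_n measurable_cube_time_kernel])

lemma measurable_missed_volume: "missed_volume \<in> borel_measurable (gauss_space n N)"
  unfolding missed_volume_def
  by (rule sigma_finite_measure.borel_measurable_nn_integral[OF sigma_finite_lebesgue_n measurable_missed_kernel])

lemma expected_missed_volume: "(\<integral>\<^sup>+w. missed_volume w \<partial>gauss_space n N) \<le> ennreal (exp (- real n) / 2)"
proof -
  let ?G = "gauss_space n N" and ?L = "lebesgue_n n"
  interpret P: pair_sigma_finite ?G ?L by (rule pair_space)
  let ?M = "\<lambda>x. {w\<in>space ?G. \<not> (\<exists>c\<in>coeff_cube n R. \<forall>k<n. x k = (\<Sum>i<n. c i * edges e w i k))}"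
  have M: "?M x \<in> sets ?G" for x
  proof -
    have "{w\<in>space ?G. \<exists>c\<in>coeff_cube n R. \<forall>k<n. x k = (\<Sum>i<n. c i * edges e w i k)} \<in> sets ?G"
      by (intro sets_solution_set measurable_edges n(2)) (auto simp: coeff_cube_def compact_coeff_box[of "{..<n}", simplified])
    moreover have "?M x = space ?G - {w\<in>space ?G. \<exists>c\<in>coeff_cube n R. \<forall>k<n. x k = (\<Sum>i<n. c i * edges e w i k)}" by auto
    ultimately show ?thesis by simp
  qed
  have "(\<integral>\<^sup>+w. missed_volume w \<partial>?G) = (\<integral>\<^sup>+x. (\<integral>\<^sup>+w. indicator (unit_box n) x * indicator {x. \<not> (\<exists>c\<in>coeff_cube n R. \<forall>k<n. x k = (\<Sum>i<n. c i * edges e w i k))} x \<partial>?G) \<partial>?L)"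
    unfolding missed_volume_def by (rule P.Fubini'[symmetric]) (rule measurable_missed_kernel)
  also have "\<dots> = (\<integral>\<^sup>+x. indicator (unit_box n) x * emeasure ?G (?M x) \<partial>?L)"
  proof (intro nn_integral_cong)
    fix x
    have "(\<integral>\<^sup>+w. indicator (unit_box n) x * indicator {x. \<not> (\<exists>c\<in>coeff_cube n R. \<forall>k<n. x k = (\<Sum>i<n. c i * edges e w i k))} x \<partial>?G)
        = (\<integral>\<^sup>+w. indicator (unit_box n) x * indicator (?M x) w \<partial>?G)"
      by (intro nn_integral_cong) (auto simp: indicator_def)
    also have "\<dots> = indicator (unit_box n) x * emeasure ?G (?M x)"
      by (rule nn_integral_cmult_indicator[OF M])
    finally show "(\<integral>\<^sup>+w. indicator (unit_box n) x * indicator {x. \<not> (\<exists>c\<in>coeff_cube n R. \<forall>k<n. x k = (\<Sum>i<n. c i * edges e w i k))} x \<partial>?G)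
      = indicator (unit_box n) x * emeasure ?G (?M x)" .
  qed
  also have "\<dots> \<le> (\<integral>\<^sup>+x. ennreal (2 * (real n)\<^sup>2 / R) * indicator (unit_box n) x \<partial>?L)"
    using edges_coeff_prob[OF n(2) R_pos] by (intro nn_integral_mono) (auto simp: indicator_def)
  also have "\<dots> = ennreal (2 * (real n)\<^sup>2 / R) * emeasure ?L (unit_box n)"
    by (rule nn_integral_cmult_indicator) (simp add: sets_box)
  also have "emeasure ?L (unit_box n) = 1"
    unfolding lebesgue_n_def by (subst lborel_product.emeasure_PiM) auto
  also have "2 * (real n)\<^sup>2 / R = exp (- real n) / 2"
    using n by (simp add: R exp_minus field_simps)
  finally show ?thesis by simp
qed

text \<open>On the shell 2 ^ (k - 1) < |c| \<le> 2 ^ k the box is hit with probability at most 2 ^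
  (-(k - 1) n), and the ball has volume at most (5 2 ^ k / sqrt n) ^ n. Each shell thus contributes
  (10 / sqrt n) ^ n, and the 5 n + 3 shells are at most 8 2 ^ n many.\<close>

lemma expected_cube_time: "(\<integral>\<^sup>+w. cube_time w \<partial>gauss_space n N) \<le> ennreal (8 * (20 / sqrt (real n)) ^ n)"
proof -
  let ?G = "gauss_space n N" and ?L = "lebesgue_n n"
  interpret P: pair_sigma_finite ?G ?L by (rule pair_space)
  interpret G: prob_space ?G by (rule prob_space_gauss_space)
  let ?C = "PiE {..<n} (\<lambda>_. {-R..R})"
  let ?H = "\<lambda>c. {w\<in>space ?G. lincomb n {..<n} c (edges e w) \<in> unit_box n}"
  define K where "K = 5 * n + 2"
  define B where "B = (\<lambda>k::nat. {x\<in>space ?L. sqnorm_n n x \<le> (2 ^ k)\<^sup>2})"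
  have B [measurable]: "B k \<in> sets ?L" for k unfolding B_def by measurable
  \<comment> \<open>The factor 2 ^ n accounts for the inner radius of shell k being 2 ^ (k - 1); at
    k = 0 the bound exceeds 1 and holds trivially.\<close>
  define q where "q = (\<lambda>k::nat. 2 ^ n * (1 / 2 ^ k) ^ n :: real)"
  have H: "?H c \<in> sets ?G" for c
  proof -
    have "(\<lambda>w. lincomb n {..<n} c (edges e w)) \<in> measurable ?G ?L"
      by (rule measurable_lincomb_coeffs) (auto intro!: measurable_edges n(2))
    from measurable_sets[OF this, of "unit_box n"] show ?thesis
      by (simp add: sets_box vimage_def Int_def conj_commute)
  qed
  have "(\<integral>\<^sup>+w. cube_time w \<partial>?G) = (\<integral>\<^sup>+c. (\<integral>\<^sup>+w. indicator ?C c * indicator (unit_box n) (lincomb n {..<n} c (edges e w)) \<partial>?G) \<partial>?L)"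
    unfolding cube_time_def by (rule P.Fubini'[symmetric]) (rule measurable_cube_time_kernel)
  also have "\<dots> = (\<integral>\<^sup>+c. indicator ?C c * emeasure ?G (?H c) \<partial>?L)"
  proof (intro nn_integral_cong)
    fix c
    have "(\<integral>\<^sup>+w. indicator ?C c * indicator (unit_box n) (lincomb n {..<n} c (edges e w)) \<partial>?G)
        = (\<integral>\<^sup>+w. indicator ?C c * indicator (?H c) w \<partial>?G)"
      by (intro nn_integral_cong) (auto simp: indicator_def)
    also have "\<dots> = indicator ?C c * emeasure ?G (?H c)" by (rule nn_integral_cmult_indicator[OF H])
    finally show "(\<integral>\<^sup>+w. indicator ?C c * indicator (unit_box n) (lincomb n {..<n} c (edges e w)) \<partial>?G)
        = indicator ?C c * emeasure ?G (?H c)" .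
  qed
  also have "\<dots> \<le> (\<integral>\<^sup>+c. (\<Sum>k\<le>K. ennreal (q k) * indicator (B k) c) \<partial>?L)"
  proof (rule nn_integral_mono)
    fix c assume c: "c \<in> space ?L"
    show "indicator ?C c * emeasure ?G (?H c) \<le> (\<Sum>k\<le>K. ennreal (q k) * indicator (B k) c)"
    proof (cases "c \<in> ?C")
      case True
      have "sqnorm_n n c \<le> (\<Sum>i<n. R\<^sup>2)" unfolding sqnorm_n_def
      proof (rule sum_mono)
        fix i assume "i \<in> {..<n}"
        then have "\<bar>c i\<bar> \<le> R" using True by (force simp: PiE_iff)
        then have "\<bar>c i\<bar>\<^sup>2 \<le> R\<^sup>2" by (intro power_mono) auto
        then show "(c i)\<^sup>2 \<le> R\<^sup>2" by simp
      qed
      also have "\<dots> \<le> (2 ^ K)\<^sup>2" using shell_count_bound[OF n(1) R] by (simp add: K_def)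
      finally have cK: "c \<in> B K" using c by (simp add: B_def)
      define k where "k = (LEAST k. c \<in> B k)"
      have k: "c \<in> B k" "k \<le> K" unfolding k_def using cK by (auto intro: LeastI Least_le)
      have "emeasure ?G (?H c) \<le> ennreal (q k)"
      proof (cases k)
        case 0
        have "emeasure ?G (?H c) \<le> 1" by (rule G.emeasure_le_1)
        also have "\<dots> \<le> ennreal (q k)" using 0 by (simp add: q_def)
        finally show ?thesis .
      next
        case (Suc j)
        then have "c \<notin> B j" using not_less_Least[of j "\<lambda>k. c \<in> B k"] by (simp add: k_def[symmetric])
        then have "(2 ^ j)\<^sup>2 \<le> sqnorm_n n c" using c by (simp add: B_def)
        then have "emeasure ?G (?H c) \<le> ennreal ((1 / 2 ^ j) ^ n)"
          by (intro edges_hit_box_prob n(2)) auto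
        also have "(1 / 2 ^ j) ^ n = q k" unfolding q_def Suc by (simp add: power_mult_distrib[symmetric])
        finally show ?thesis .
      qed
      then have "indicator ?C c * emeasure ?G (?H c) \<le> ennreal (q k) * indicator (B k) c"
        using True k by simp
      also have "\<dots> \<le> (\<Sum>k\<le>K. ennreal (q k) * indicator (B k) c)"
        using k(2) by (intro member_le_sum) auto
      finally show ?thesis .
    qed simp
  qed
  also have "\<dots> = (\<Sum>k\<le>K. ennreal (q k) * emeasure ?L (B k))"
    by (subst nn_integral_sum) (auto simp: nn_integral_cmult_indicator)
  also have "\<dots> \<le> (\<Sum>k\<le>K. ennreal ((10 / sqrt (real n)) ^ n))"
  proof (rule sum_mono)
    fix k
    have "ennreal (q k) * emeasure ?L (B k) \<le> ennreal (q k) * ennreal ((5 * 2 ^ k / sqrt (real n)) ^ n)"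
      unfolding B_def using n by (intro mult_left_mono emeasure_euclidean_ball_le) auto
    also have "\<dots> = ennreal (q k * (5 * 2 ^ k / sqrt (real n)) ^ n)"
      by (rule ennreal_mult[symmetric]) (auto simp: q_def)
    also have "q k * (5 * 2 ^ k / sqrt (real n)) ^ n = (10 / sqrt (real n)) ^ n"
      unfolding q_def by (simp add: power_mult_distrib[symmetric])
    finally show "ennreal (q k) * emeasure ?L (B k) \<le> ennreal ((10 / sqrt (real n)) ^ n)" .
  qed
  also have "\<dots> = ennreal (real (K + 1) * (10 / sqrt (real n)) ^ n)"
    by (subst sum_ennreal) auto
  also have "\<dots> \<le> ennreal (8 * (20 / sqrt (real n)) ^ n)"
  proof (rule ennreal_leI)
    have "real n \<le> 2 ^ n" using of_nat_less_two_power[of n, where 'a=real] by simp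
    moreover have "(1::real) \<le> 2 ^ n" by simp
    moreover have "real (K + 1) = 5 * real n + 3" by (simp add: K_def)
    ultimately have "real (K + 1) \<le> 8 * 2 ^ n" by linarith
    then have "real (K + 1) * (10 / sqrt (real n)) ^ n \<le> (8 * 2 ^ n) * (10 / sqrt (real n)) ^ n"
      by (intro mult_right_mono) auto
    also have "\<dots> = 8 * (20 / sqrt (real n)) ^ n" by (simp add: mult.assoc power_mult_distrib[symmetric])
    finally show "real (K + 1) * (10 / sqrt (real n)) ^ n \<le> 8 * (20 / sqrt (real n)) ^ n" .
  qed
  finally show ?thesis .
qed

text \<open>At least half of the unit cube is covered, so r / 2 is at most \<open>cube_time\<close>,
  where r is the inverse modulus of the determinant; hence r \<le> 2 D. A translate of the image of
  the standard simplex lies in K, so K has volume at least that of the standard simplex divided by 2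
  D.\<close>

lemma volume_of_good_edges:
  assumes w: "lin_indep n (edges e w)" "missed_volume w \<le> ennreal (1 / 2)"
      "cube_time w \<le> ennreal (exp (real n) * (8 * (20 / sqrt (real n)) ^ n))"
    and K: "K \<in> sets (lebesgue_n n)"
      "\<And>c. c \<in> corner n \<Longrightarrow> (\<lambda>k\<in>{..<n}. p k + lincomb n {..<n} c (edges e w) k) \<in> K"
  shows "ennreal ((1 / (960 * sqrt (real n))) ^ n) \<le> emeasure (lebesgue_n n) K"
proof -
  let ?L = "lebesgue_n n" and ?T = "\<lambda>c. lincomb n {..<n} c (edges e w)"
  let ?hit = "\<lambda>x. \<exists>c\<in>coeff_cube n R. \<forall>k<n. x k = (\<Sum>i<n. c i * edges e w i k)"
  define D where "D = exp (real n) * (8 * (20 / sqrt (real n)) ^ n)"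
  have D: "D > 0" using n by (simp add: D_def)
  obtain r where r: "r > 0" "\<And>f. f \<in> borel_measurable ?L \<Longrightarrow> (\<integral>\<^sup>+c. f (?T c) \<partial>?L) = ennreal r * (\<integral>\<^sup>+x. f x \<partial>?L)"
    using nn_integral_linear_substitution[OF w(1)] by blast
  define S where "S = {x\<in>space ?L. ?hit x}"
  have S: "S \<in> sets ?L" unfolding S_def
    by (intro sets_solution_set) (auto simp: coeff_cube_def compact_coeff_box[of "{..<n}", simplified])
  have Q: "unit_box n \<in> sets ?L" by (simp add: sets_box)
  have QS: "unit_box n \<inter> S \<in> sets ?L" using Q S by auto
  have "1 = emeasure ?L (unit_box n)"
    unfolding lebesgue_n_def by (subst lborel_product.emeasure_PiM) auto
  also have "\<dots> = (\<integral>\<^sup>+x. indicator (unit_box n) x \<partial>?L)" using Q by simp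
  also have "\<dots> = (\<integral>\<^sup>+x. indicator (unit_box n \<inter> S) x + indicator (unit_box n) x * indicator {x. \<not> ?hit x} x \<partial>?L)"
    by (intro nn_integral_cong) (auto simp: indicator_def S_def space_lebesgue_n PiE_iff)
  also have "\<dots> = emeasure ?L (unit_box n \<inter> S) + missed_volume w"
  proof -
    have "(\<lambda>x. indicator (unit_box n) x * indicator {x. \<not> ?hit x} x :: ennreal) \<in> borel_measurable ?L"
    proof (subst measurable_cong)
      show "(indicator (unit_box n) x * indicator {x. \<not> ?hit x} x :: ennreal) = indicator (unit_box n) x * indicator (space ?L - S) x" if "x \<in> space ?L" for x
        using that by (auto simp: indicator_def S_def)
      show "(\<lambda>x. indicator (unit_box n) x * indicator (space ?L - S) x :: ennreal) \<in> borel_measurable ?L"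
        using Q S by (intro borel_measurable_times_ennreal borel_measurable_indicator) auto
    qed
    then show ?thesis unfolding missed_volume_def using QS by (subst nn_integral_add) auto
  qed
  also have "\<dots> \<le> emeasure ?L (unit_box n \<inter> S) + ennreal (1 / 2)" using w(2) by (intro add_left_mono)
  finally have "1 \<le> emeasure ?L (unit_box n \<inter> S) + ennreal (1 / 2)" .
  then have half: "ennreal (1 / 2) \<le> emeasure ?L (unit_box n \<inter> S)"
  proof (cases "emeasure ?L (unit_box n \<inter> S)")
    case (real a)
    assume "1 \<le> emeasure ?L (unit_box n \<inter> S) + ennreal (1 / 2)"
    then have "ennreal 1 \<le> ennreal a + ennreal (1 / 2)" unfolding real(2) ennreal_1 .
    also have "\<dots> = ennreal (a + 1 / 2)" using real(1) by (intro ennreal_plus[symmetric]) auto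
    finally have "ennreal 1 \<le> ennreal (a + 1 / 2)" .
    then have "1 \<le> a + 1 / 2" using real(1) by (subst (asm) ennreal_le_iff) auto
    then show ?thesis unfolding real(2) by (intro ennreal_leI) simp
  qed simp
  have "ennreal r * ennreal (1 / 2) \<le> ennreal r * (\<integral>\<^sup>+x. indicator (unit_box n \<inter> S) x \<partial>?L)"
    using half QS by (intro mult_left_mono) auto
  also have "\<dots> = (\<integral>\<^sup>+c. indicator (unit_box n \<inter> S) (?T c) \<partial>?L)" by (rule r(2)[symmetric]) (use QS in simp)
  also have "\<dots> \<le> cube_time w" unfolding cube_time_def
  proof (rule nn_integral_mono)
    fix c assume c: "c \<in> space ?L"
    have "c \<in> PiE {..<n} (\<lambda>_. {-R..R})" if TS: "?T c \<in> S"
    proof -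
      obtain d where d: "d \<in> coeff_cube n R" "\<forall>k<n. ?T c k = (\<Sum>i<n. d i * edges e w i k)"
        using TS by (auto simp: S_def)
      have "(\<Sum>i<n. (c i - d i) * edges e w i k) = 0" if "k < n" for k
        using d(2) that by (simp add: lincomb_def left_diff_distrib sum_subtractf)
      then have "c i - d i = 0" if "i < n" for i
        using w(1)[unfolded lin_indep_def, THEN spec, of "\<lambda>i. c i - d i"] that by simp
      then have "c i = d i" if "i < n" for i using that by simp
      then show ?thesis using c d(1) by (auto simp: PiE_iff space_lebesgue_n coeff_cube_def split: if_splits)
    qed
    then show "(indicator (unit_box n \<inter> S) (?T c) :: ennreal) \<le> indicator (PiE {..<n} (\<lambda>_. {-R..R})) c * indicator (unit_box n) (?T c)"
      by (auto simp: indicator_def)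
  qed
  also have "\<dots> \<le> ennreal D" using w(3) by (simp add: D_def)
  finally have "ennreal r * ennreal (1 / 2) \<le> ennreal D" .
  moreover have "ennreal r * ennreal (1 / 2) = ennreal (r * (1 / 2))" using r(1) by (intro ennreal_mult[symmetric]) auto
  ultimately have "ennreal (r * (1 / 2)) \<le> ennreal D" by (simp only:)
  then have rD: "r \<le> 2 * D" using D by (simp add: ennreal_le_iff)
  \<comment> \<open>The standard simplex contains a cube of side 1 / n; compared with the exact
    volume 1 / n! this loses only an exponential factor.\<close>
  have "ennreal ((1 / real n) ^ n) = (\<Prod>k<n. emeasure lborel {0..1 / real n})" by (simp add: ennreal_power)
  also have "\<dots> = emeasure ?L (PiE {..<n} (\<lambda>_. {0..1 / real n}))"
    unfolding lebesgue_n_def by (rule lborel_product.emeasure_PiM[symmetric]) auto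
  also have "\<dots> \<le> emeasure ?L (corner n)"
  proof (rule emeasure_mono[OF _ sets_corner], safe)
    fix c assume c: "c \<in> PiE {..<n} (\<lambda>_. {0..1 / real n})"
    have "(\<Sum>i<n. c i) \<le> (\<Sum>i<n. 1 / real n)" using c by (intro sum_mono) (auto simp: PiE_iff)
    then show "c \<in> corner n" using c n by (auto simp: corner_def PiE_iff space_lebesgue_n)
  qed
  also have "\<dots> = (\<integral>\<^sup>+c. indicator (corner n) c \<partial>?L)" by simp
  also have "\<dots> \<le> (\<integral>\<^sup>+c. indicator K (\<lambda>k\<in>{..<n}. p k + ?T c k) \<partial>?L)"
    using K(2) by (intro nn_integral_mono) (auto simp: indicator_def)
  also have "\<dots> = ennreal r * (\<integral>\<^sup>+x. indicator K (\<lambda>k\<in>{..<n}. p k + x k) \<partial>?L)"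
  proof (rule r(2), rule measurable_compose[where N="?L"])
    show "(\<lambda>x. \<lambda>k\<in>{..<n}. p k + x k) \<in> measurable ?L ?L" by (rule measurable_into_lebesgue_n) auto
  qed (use K in simp)
  also have "\<dots> = ennreal r * emeasure ?L K"
    using K(1) by (subst nn_integral_lebesgue_n_translate) auto
  also have "\<dots> \<le> ennreal (2 * D) * emeasure ?L K" using rD by (intro mult_right_mono ennreal_leI) auto
  finally have "ennreal (1 / (2 * D)) * ennreal ((1 / real n) ^ n) \<le> ennreal (1 / (2 * D)) * (ennreal (2 * D) * emeasure ?L K)"
    by (rule mult_left_mono) simp
  also have "\<dots> = emeasure ?L K" using D by (simp add: mult.assoc[symmetric] ennreal_mult[symmetric])
  finally have "ennreal (1 / (2 * D)) * ennreal ((1 / real n) ^ n) \<le> emeasure ?L K" .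
  then have "ennreal (1 / (2 * D) * (1 / real n) ^ n) \<le> emeasure ?L K"
    using D by (subst ennreal_mult) auto
  moreover have "(1 / (960 * sqrt (real n))) ^ n \<le> 1 / (2 * D) * (1 / real n) ^ n"
  proof -
    have e3: "exp (real n) \<le> 3 ^ n"
      using exp_le power_mono[of "exp (1::real)" 3 n] by (simp add: exp_of_nat_mult[symmetric])
    have s16: "(16::real) \<le> 16 ^ n" using n power_increasing[of 1 n "16::real"] by simp
    \<comment> \<open>Origin of 960: the factors 16, 3 > e and 20 are collected under one n-th
      power.\<close>
    have "2 * D * (real n) ^ n = 16 * exp (real n) * ((20 / sqrt (real n)) ^ n * real n ^ n)" by (simp add: D_def)
    also have "(20 / sqrt (real n)) ^ n * real n ^ n = (20 * sqrt (real n)) ^ n"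
    proof -
      have "20 / sqrt (real n) * real n = 20 * sqrt (real n)" using n by (simp add: field_simps)
      then show ?thesis by (simp only: power_mult_distrib[symmetric])
    qed
    also have "16 * exp (real n) * (20 * sqrt (real n)) ^ n \<le> 16 ^ n * 3 ^ n * (20 * sqrt (real n)) ^ n"
      using e3 s16 by (intro mult_right_mono mult_mono) auto
    also have "\<dots> = (960 * sqrt (real n)) ^ n" by (simp only: power_mult_distrib[symmetric]) simp
    finally have "2 * D * (real n) ^ n \<le> (960 * sqrt (real n)) ^ n" .
    moreover have "0 < 2 * D * (real n) ^ n" using D n by simp
    ultimately have "1 / (960 * sqrt (real n)) ^ n \<le> 1 / (2 * D * (real n) ^ n)" by (intro divide_left_mono) auto
    then show ?thesis by (simp add: power_divide)
  qed
  ultimately show ?thesis by (meson ennreal_leI order_trans)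
qed

end

text \<open>Three bad events are removed: dependent edges, missed volume above 1 / 2 and cube time
  above exp n times its mean bound. Markov's inequality gives exp (-n) for each of the last two. The
  event is fixed before p and K, so it serves any body containing the simplex.\<close>

lemma simplex_volume_prob:
  assumes n: "1 \<le> n" "n \<le> N"
  shows "\<exists>A\<in>sets (gauss_space n N). emeasure (gauss_space n N) (space (gauss_space n N) - A) \<le> ennreal (2 * exp (- real n)) \<and>
    (\<forall>w\<in>A. \<forall>p. \<forall>K\<in>sets (lebesgue_n n). (\<forall>c\<in>corner n. (\<lambda>k\<in>{..<n}. p k + lincomb n {..<n} c (edges e w) k) \<in> K) \<longrightarrow>
      ennreal ((1 / (960 * sqrt (real n))) ^ n) \<le> emeasure (lebesgue_n n) K)"
proof -
  let ?G = "gauss_space n N"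
  define R where "R = 4 * (real n)\<^sup>2 * exp (real n)"
  define D where "D = 8 * (20 / sqrt (real n)) ^ n"
  have D: "D > 0" using n by (simp add: D_def)
  define A1 where "A1 = {w\<in>space ?G. \<not> lin_indep n (edges e w)}"
  define A2 where "A2 = {w\<in>space ?G. ennreal (1 / 2) < missed_volume n e R w}"
  define A3 where "A3 = {w\<in>space ?G. ennreal (exp (real n) * D) < cube_time n e R w}"
  have A1: "A1 \<in> null_sets ?G" unfolding A1_def by (rule edges_indep_AE[OF n(2)])
  have m2 [measurable]: "missed_volume n e R \<in> borel_measurable ?G" by (rule measurable_missed_volume[OF n R_def])
  have m3 [measurable]: "cube_time n e R \<in> borel_measurable ?G" by (rule measurable_cube_time[OF n R_def])
  have A2: "A2 \<in> sets ?G" "emeasure ?G A2 \<le> ennreal (exp (- real n))"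
    using Markov_strict[OF m2 expected_missed_volume[OF n R_def], of "1 / 2"] unfolding A2_def by simp_all
  have ec: "(\<integral>\<^sup>+w. cube_time n e R w \<partial>?G) \<le> ennreal D"
    using expected_cube_time[OF n R_def] unfolding D_def .
  have "D / (exp (real n) * D) = exp (- real n)" using D by (simp add: exp_minus field_simps)
  then have A3: "A3 \<in> sets ?G" "emeasure ?G A3 \<le> ennreal (exp (- real n))"
    using Markov_strict[OF m3 ec, of "exp (real n) * D"] D unfolding A3_def by simp_all
  define A where "A = space ?G - (A1 \<union> A2 \<union> A3)"
  have "emeasure ?G (space ?G - A) \<le> emeasure ?G (A1 \<union> (A2 \<union> A3))"
    using A1 A2 A3 by (intro emeasure_mono) (auto simp: A_def)
  also have "\<dots> \<le> emeasure ?G A1 + emeasure ?G (A2 \<union> A3)"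
    using A1 A2 A3 by (intro emeasure_subadditive) auto
  also have "\<dots> \<le> 0 + (emeasure ?G A2 + emeasure ?G A3)"
    using A1 A2 A3 by (intro add_mono emeasure_subadditive) (auto simp: null_setsD1)
  also have "\<dots> \<le> ennreal (exp (- real n)) + ennreal (exp (- real n))"
    unfolding add_0 using A2 A3 by (intro add_mono)
  also have "\<dots> = ennreal (2 * exp (- real n))" by (subst ennreal_plus[symmetric]) auto
  finally have "emeasure ?G (space ?G - A) \<le> ennreal (2 * exp (- real n))" .
  moreover have "A \<in> sets ?G" unfolding A_def using A1 A2 A3 by auto
  moreover have "ennreal ((1 / (960 * sqrt (real n))) ^ n) \<le> emeasure (lebesgue_n n) K"
    if "w \<in> A" "K \<in> sets (lebesgue_n n)" "\<forall>c\<in>corner n. (\<lambda>k\<in>{..<n}. p k + lincomb n {..<n} c (edges e w) k) \<in> K" for w p K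
    by (rule volume_of_good_edges[OF n R_def, of e w K p])
       (use that in \<open>auto simp: A_def A1_def A2_def A3_def D_def not_less\<close>)
  ultimately show ?thesis by blast
qed

section \<open>Wendel's symmetry argument\<close>

lemma continuous_on_sqnorm_lincomb:
  "continuous_on UNIV (\<lambda>c::nat \<Rightarrow> real. sqnorm_n n (lincomb n J c v))"
proof -
  have "continuous_on UNIV (\<lambda>c::nat \<Rightarrow> real. \<Sum>k<n. (\<Sum>i\<in>J. c i * v i k)\<^sup>2)"
    by (intro continuous_on_sum continuous_on_power continuous_on_mult continuous_on_const continuous_on_product_coordinates)
  then show ?thesis by (simp add: sqnorm_n_def lincomb_def)
qed

text \<open>Minimise the norm over the compact set of convex combinations. A minimiser equal to zero
  gives the first alternative; a nonzero minimiser p has inner product at least |p|^2 with every v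
  i.\<close>

lemma Gordan:
  fixes v :: "nat \<Rightarrow> nat \<Rightarrow> real"
  assumes J: "finite J"
  shows "(\<exists>c\<in>weights J. \<forall>k<n. (\<Sum>i\<in>J. c i * v i k) = 0) \<or> (\<exists>u. \<forall>i\<in>J. dot n u (v i) > 0)"
proof (cases "J = {}")
  case True then show ?thesis by simp
next
  case False
  let ?W = "{c\<in>weights J. \<forall>i. i \<notin> J \<longrightarrow> c i = 0}" and ?f = "\<lambda>c. sqnorm_n n (lincomb n J c v)"
  obtain j where j: "j \<in> J" using False by auto
  have "(\<lambda>i. if i = j then 1 else 0) \<in> ?W" using j J by (auto simp: weights_def)
  then have ne: "?W \<noteq> {}" by blast
  have cont: "continuous_on ?W ?f" by (rule continuous_on_subset[OF continuous_on_sqnorm_lincomb]) simp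
  obtain c where c: "c \<in> ?W" "\<forall>d\<in>?W. ?f c \<le> ?f d"
    using continuous_attains_inf[OF compact_weights[OF J] ne cont] by (elim bexE)
  define p where "p = lincomb n J c v"
  show ?thesis
  proof (cases "sqnorm_n n p = 0")
    case True
    then have "\<forall>k<n. p k = 0" by (simp add: sqnorm_n_def sum_nonneg_eq_0_iff Ball_def)
    then show ?thesis using c(1) by (auto simp: p_def lincomb_def)
  next
    case False
    then have pos: "sqnorm_n n p > 0" by (simp add: less_le)
    have "dot n p (v i) > 0" if i: "i \<in> J" for i
    proof -
      define y where "y = (\<lambda>k. v i k - p k)"
      define a where "a = dot n p y"
      define s where "s = sqnorm_n n y"
      have s: "s \<ge> 0" by (simp add: s_def)
      \<comment> \<open>Compares p with the points of the segment from p to v i, which are convex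
        combinations too; the derivative at t = 0 is 2 a.\<close>
      have quad: "0 \<le> 2 * t * a + t\<^sup>2 * s" if t: "0 \<le> t" "t \<le> 1" for t
      proof -
        define d where "d = (\<lambda>l. (1 - t) * c l + (if l = i then t else 0))"
        have sum_d: "(\<Sum>l\<in>J. d l * g l) = (1 - t) * (\<Sum>l\<in>J. c l * g l) + t * g i" for g
          using i J by (simp add: d_def distrib_right sum.distrib sum_distrib_left mult.assoc if_distrib[of "\<lambda>x. x * _"] cong: if_cong)
        have "d \<in> ?W" using c(1) t i sum_d[of "\<lambda>_. 1"] by (auto simp: weights_def d_def)
        then have "sqnorm_n n p \<le> ?f d" unfolding p_def using c(2) by (rule bspec[rotated])
        also have "?f d = sqnorm_n n (\<lambda>k. p k + t * y k)"
          by (rule sqnorm_n_cong) (simp add: lincomb_def p_def y_def sum_d algebra_simps)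
        finally show ?thesis unfolding sqnorm_n_add by (simp add: a_def s_def)
      qed
      have "a \<ge> 0"
      proof (rule ccontr)
        assume neg: "\<not> a \<ge> 0"
        \<comment> \<open>If a were negative, a step of this size would shorten p; s + 1 keeps the
          denominator positive when s = 0.\<close>
        define t where "t = min 1 (- a / (s + 1))"
        have t: "0 < t" "t \<le> 1" using neg s by (auto simp: t_def divide_neg_pos)
        have "t \<le> - a / (s + 1)" by (simp add: t_def)
        then have "t * (s + 1) \<le> - a" using s by (subst (asm) pos_le_divide_eq) auto
        then have "t * s < - a" using t by (simp add: distrib_left)
        then have "2 * a + t * s < 0" using neg by simp
        then have "t * (2 * a + t * s) < 0" using t by (simp add: mult_pos_neg)
        then show False using quad[of t] t by (simp add: power2_eq_square algebra_simps)
      qed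
      moreover have "a = dot n p (v i) - sqnorm_n n p"
        by (simp add: a_def y_def dot_def sqnorm_n_def right_diff_distrib sum_subtractf power2_eq_square)
      ultimately show ?thesis using pos by simp
    qed
    then show ?thesis by blast
  qed
qed

definition refl_n :: "nat \<Rightarrow> (nat \<Rightarrow> real) \<Rightarrow> (nat \<Rightarrow> real) \<Rightarrow> (nat \<Rightarrow> real)" where
  "refl_n n \<theta> g = (\<lambda>k\<in>{..<n}. 2 * dot n \<theta> g * \<theta> k - g k)"

definition proj_n :: "nat \<Rightarrow> (nat \<Rightarrow> real) \<Rightarrow> (nat \<Rightarrow> real) \<Rightarrow> (nat \<Rightarrow> real)" where
  "proj_n n \<theta> g k = g k - dot n \<theta> g * \<theta> k"

lemma dot_refl:
  assumes "sqnorm_n n \<theta> = 1"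
  shows "dot n \<theta> (refl_n n \<theta> g) = dot n \<theta> g"
proof -
  define d where "d = dot n \<theta> g"
  have "dot n \<theta> (refl_n n \<theta> g) = (\<Sum>k<n. \<theta> k * (2 * d * \<theta> k - g k))"
    unfolding dot_def[of n \<theta> "refl_n n \<theta> g"] by (simp add: refl_n_def d_def)
  also have "\<dots> = 2 * d * sqnorm_n n \<theta> - dot n \<theta> g"
    by (simp add: dot_def sqnorm_n_def right_diff_distrib sum_subtractf sum_distrib_left power2_eq_square mult_ac)
  finally have "dot n \<theta> (refl_n n \<theta> g) = 2 * d * sqnorm_n n \<theta> - dot n \<theta> g" .
  then show ?thesis using assms by (simp add: d_def)
qed

text \<open>For unit \<theta> the map \<open>refl_n\<close> keeps the component along \<theta> and
  negates the orthogonal one: sample points stay on their side of x while the signs of their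
  projections change.\<close>

lemma proj_refl:
  assumes "sqnorm_n n \<theta> = 1" "k < n"
  shows "proj_n n \<theta> (refl_n n \<theta> g) k = - proj_n n \<theta> g k"
  unfolding proj_n_def dot_refl[OF assms(1)] using assms(2) by (simp add: refl_n_def)

lemma refl_refl:
  assumes "sqnorm_n n \<theta> = 1" "g \<in> extensional {..<n}"
  shows "refl_n n \<theta> (refl_n n \<theta> g) = g"
proof
  fix k show "refl_n n \<theta> (refl_n n \<theta> g) k = g k"
    unfolding refl_n_def[of n \<theta> "refl_n n \<theta> g"] dot_refl[OF assms(1)]
    using assms(2) by (auto simp: refl_n_def extensional_def)
qed

lemma sqnorm_refl:
  assumes "sqnorm_n n \<theta> = 1"
  shows "sqnorm_n n (refl_n n \<theta> g) = sqnorm_n n g"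
proof -
  define d where "d = dot n \<theta> g"
  have "sqnorm_n n (refl_n n \<theta> g) = sqnorm_n n (\<lambda>k. g k + (- 2 * d) * \<theta> k)"
    by (simp add: sqnorm_n_def refl_n_def d_def power2_commute)
  also have "\<dots> = sqnorm_n n g + 2 * (- 2 * d) * dot n g \<theta> + (- 2 * d)\<^sup>2 * sqnorm_n n \<theta>" by (rule sqnorm_n_add)
  also have "dot n g \<theta> = d" by (simp add: d_def dot_def mult.commute)
  finally show ?thesis using assms by (simp add: power2_eq_square)
qed

lemma measurable_refl [measurable]: "refl_n n \<theta> \<in> measurable (lebesgue_n n) (lebesgue_n n)"
proof (rule measurable_into_lebesgue_n)
  fix k assume "k < n"
  then show "(\<lambda>x. refl_n n \<theta> x k) \<in> borel_measurable (lebesgue_n n)"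
    unfolding refl_n_def dot_def by simp
qed (simp add: refl_n_def)

text \<open>The Jacobian factor of an involution squares to one.\<close>

lemma nn_integral_lebesgue_refl:
  assumes \<theta>: "sqnorm_n n \<theta> = 1" and f: "f \<in> borel_measurable (lebesgue_n n)"
  shows "(\<integral>\<^sup>+x. f (refl_n n \<theta> x) \<partial>lebesgue_n n) = (\<integral>\<^sup>+x. f x \<partial>lebesgue_n n)"
proof -
  let ?L = "lebesgue_n n"
  define h where "h = (\<lambda>i k. 2 * \<theta> i * \<theta> k - (if i = k then 1 else (0::real)))"
  have T: "lincomb n {..<n} c h = refl_n n \<theta> c" for c
  proof
    fix k
    have "(\<Sum>i<n. c i * h i k) = 2 * dot n \<theta> c * \<theta> k - c k" if "k < n"
    proof -
      have "(\<Sum>i<n. c i * h i k) = (\<Sum>i<n. 2 * (\<theta> i * c i) * \<theta> k - (if i = k then c i else 0))"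
        by (intro sum.cong refl) (simp add: h_def algebra_simps)
      also have "\<dots> = 2 * dot n \<theta> c * \<theta> k - c k"
        using that by (simp add: sum_subtractf dot_def sum_distrib_left sum_distrib_right)
      finally show ?thesis .
    qed
    then show "lincomb n {..<n} c h k = refl_n n \<theta> c k" by (simp add: lincomb_def refl_n_def)
  qed
  have "lin_indep n h" unfolding lin_indep_def
  proof (intro allI impI)
    fix c i assume c: "\<forall>k<n. (\<Sum>i<n. c i * h i k) = 0" and i: "i < n"
    let ?c = "restrict c {..<n}"
    have "refl_n n \<theta> ?c k = 0" if "k < n" for k
      using T[of ?c] c that by (auto simp: lincomb_def fun_eq_iff dest: spec[of _ k])
    then have "refl_n n \<theta> (refl_n n \<theta> ?c) i = 0"
      using i by (simp add: refl_n_def[of n \<theta> "refl_n n \<theta> ?c"] dot_def)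
    then show "c i = 0" using refl_refl[OF \<theta>, of ?c] i by simp
  qed
  then obtain r where r: "r > 0" "\<And>f. f \<in> borel_measurable ?L \<Longrightarrow> (\<integral>\<^sup>+c. f (refl_n n \<theta> c) \<partial>?L) = ennreal r * (\<integral>\<^sup>+x. f x \<partial>?L)"
    using nn_integral_linear_substitution[of n h] unfolding T by blast
  define Q where "Q = unit_box n"
  have Q: "Q \<in> sets ?L" "emeasure ?L Q = 1" unfolding Q_def
    by (simp_all add: sets_box) (simp add: lebesgue_n_def lborel_product.emeasure_PiM)
  have "1 = (\<integral>\<^sup>+x. indicator Q x \<partial>?L)" using Q by simp
  also have "\<dots> = (\<integral>\<^sup>+x. indicator Q (refl_n n \<theta> (refl_n n \<theta> x)) \<partial>?L)"
    by (intro nn_integral_cong) (simp add: refl_refl[OF \<theta>] space_lebesgue_n PiE_iff)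
  also have "\<dots> = ennreal r * (\<integral>\<^sup>+x. indicator Q (refl_n n \<theta> x) \<partial>?L)"
    by (rule r(2)) (use Q in measurable)
  also have "\<dots> = ennreal r * (ennreal r * (\<integral>\<^sup>+x. indicator Q x \<partial>?L))"
    by (subst r(2)) (use Q in auto)
  also have "\<dots> = ennreal (r * r)" using Q r(1) by (simp add: ennreal_mult)
  finally have "r * r = 1" using r(1) by (metis ennreal_1 ennreal_inj less_imp_le mult_nonneg_nonneg zero_le_one)
  then have "r = 1" using r(1) by (metis abs_of_pos abs_square_eq_1 power2_eq_square)
  then show ?thesis using r(2)[OF f] by simp
qed

lemma gauss_n_density:
  "gauss_n n = density (lebesgue_n n) (\<lambda>x. \<Prod>k<n. ennreal (std_normal_density (x k)))"
  unfolding gauss_n_def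
proof (rule gauss1_product.PiM_eqI[symmetric])
  show "sets (density (lebesgue_n n) (\<lambda>x. \<Prod>k<n. ennreal (std_normal_density (x k)))) = sets (PiM {..<n} (\<lambda>_. gauss1))"
    using sets_gauss_n[of n] by (simp add: gauss_n_def)
  fix A :: "nat \<Rightarrow> real set" assume A: "\<And>i. i \<in> {..<n} \<Longrightarrow> A i \<in> sets gauss1"
  have m: "(\<lambda>x. \<Prod>k<n. ennreal (std_normal_density (x k))) \<in> borel_measurable (lebesgue_n n)"
    by (intro borel_measurable_prod_ennreal) auto
  have "emeasure (density (lebesgue_n n) (\<lambda>x. \<Prod>k<n. ennreal (std_normal_density (x k)))) (PiE {..<n} A)
      = (\<integral>\<^sup>+x. (\<Prod>k<n. ennreal (std_normal_density (x k))) * indicator (PiE {..<n} A) x \<partial>lebesgue_n n)"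
    using A by (intro emeasure_density m sets_box) auto
  also have "\<dots> = (\<integral>\<^sup>+x. (\<Prod>k<n. ennreal (std_normal_density (x k)) * indicator (A k) (x k)) \<partial>lebesgue_n n)"
  proof (intro nn_integral_cong)
    fix x assume x: "x \<in> space (lebesgue_n n)"
    have "(indicator (PiE {..<n} A) x :: ennreal) = (\<Prod>k<n. indicator (A k) (x k))"
    proof (cases "x \<in> PiE {..<n} A")
      case True then show ?thesis by (auto simp: PiE_iff)
    next
      case False
      then obtain k where "k < n" "x k \<notin> A k" using x by (auto simp: PiE_iff space_lebesgue_n)
      then have "(\<Prod>k<n. indicator (A k) (x k) :: ennreal) = 0" by (intro prod_zero bexI[of _ k]) auto
      then show ?thesis using False by simp
    qed
    then show "(\<Prod>k<n. ennreal (std_normal_density (x k))) * indicator (PiE {..<n} A) x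
        = (\<Prod>k<n. ennreal (std_normal_density (x k)) * indicator (A k) (x k))" by (simp add: prod.distrib)
  qed
  also have "\<dots> = (\<Prod>k<n. \<integral>\<^sup>+y. ennreal (std_normal_density y) * indicator (A k) y \<partial>lborel)"
    unfolding lebesgue_n_def using A by (intro lborel_product.product_nn_integral_prod) auto
  also have "\<dots> = (\<Prod>k\<in>{..<n}. emeasure gauss1 (A k))"
    using A by (intro prod.cong refl emeasure_density[symmetric]) auto
  finally show "emeasure (density (lebesgue_n n) (\<lambda>x. \<Prod>k<n. ennreal (std_normal_density (x k)))) (PiE {..<n} A)
    = (\<Prod>k\<in>{..<n}. emeasure gauss1 (A k))" .
qed simp

text \<open>The Gaussian density depends only on the norm, which the reflection preserves, as it
  does Lebesgue measure.\<close>

lemma nn_integral_gauss_refl: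
  assumes \<theta>: "sqnorm_n n \<theta> = 1" and f: "f \<in> borel_measurable (lebesgue_n n)"
  shows "(\<integral>\<^sup>+x. f (refl_n n \<theta> x) \<partial>gauss_n n) = (\<integral>\<^sup>+x. f x \<partial>gauss_n n)"
proof -
  let ?d = "\<lambda>x. \<Prod>k<n. ennreal (std_normal_density (x k))"
  have m: "?d \<in> borel_measurable (lebesgue_n n)" by (intro borel_measurable_prod_ennreal) auto
  have "?d x = ennreal ((1 / sqrt (2 * pi)) ^ n * exp (- sqnorm_n n x / 2))" for x
  proof -
    have "?d x = ennreal (\<Prod>k<n. std_normal_density (x k))" by (rule prod_ennreal) simp
    also have "(\<Prod>k<n. std_normal_density (x k)) = (1 / sqrt (2 * pi)) ^ n * exp (- sqnorm_n n x / 2)"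
      unfolding std_normal_density_def prod.distrib
      by (simp add: exp_sum[symmetric] sqnorm_n_def sum_negf sum_divide_distrib)
    finally show ?thesis .
  qed
  then have inv: "?d (refl_n n \<theta> x) = ?d x" for x by (simp add: sqnorm_refl[OF \<theta>])
  have fm: "(\<lambda>x. f (refl_n n \<theta> x)) \<in> borel_measurable (lebesgue_n n)" by (rule measurable_compose[OF measurable_refl f])
  have "(\<integral>\<^sup>+x. f (refl_n n \<theta> x) \<partial>gauss_n n) = (\<integral>\<^sup>+x. ?d x * f (refl_n n \<theta> x) \<partial>lebesgue_n n)"
    unfolding gauss_n_density by (rule nn_integral_density[OF m fm])
  also have "\<dots> = (\<integral>\<^sup>+x. ?d (refl_n n \<theta> x) * f (refl_n n \<theta> x) \<partial>lebesgue_n n)" by (simp only: inv)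
  also have "\<dots> = (\<integral>\<^sup>+x. ?d x * f x \<partial>lebesgue_n n)"
    by (rule nn_integral_lebesgue_refl[OF \<theta>, of "\<lambda>x. ?d x * f x"]) (intro borel_measurable_times_ennreal m f)
  also have "\<dots> = (\<integral>\<^sup>+x. f x \<partial>gauss_n n)"
    unfolding gauss_n_density by (rule nn_integral_density[OF m f, symmetric])
  finally show ?thesis .
qed

definition flip :: "nat \<Rightarrow> nat \<Rightarrow> (nat \<Rightarrow> real) \<Rightarrow> nat set \<Rightarrow> (nat \<Rightarrow> nat \<Rightarrow> real) \<Rightarrow> (nat \<Rightarrow> nat \<Rightarrow> real)" where
  "flip n N \<theta> E w = (\<lambda>i\<in>{..N}. if i \<in> E then refl_n n \<theta> (w i) else w i)"

lemma measurable_flip: "flip n N \<theta> E \<in> measurable (gauss_space n N) (gauss_space n N)"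
  unfolding flip_def gauss_space_eq
proof (rule measurable_restrict)
  fix i assume i: "i \<in> {..N}"
  have c: "(\<lambda>w. w i) \<in> measurable (PiM {..N} (\<lambda>_. gauss_n n)) (gauss_n n)"
    using i by (rule measurable_component_singleton)
  have "refl_n n \<theta> \<in> measurable (gauss_n n) (gauss_n n)" using measurable_refl by (simp cong: measurable_cong_sets add: sets_gauss_n)
  from measurable_compose[OF c this] c
  show "(\<lambda>w. if i \<in> E then refl_n n \<theta> (w i) else w i) \<in> measurable (PiM {..N} (\<lambda>_. gauss_n n)) (gauss_n n)"
    by (cases "i \<in> E") auto
qed

text \<open>Averaging over all sets E of flipped samples takes the place of random signs: the sample
  itself is held fixed and only subsets E are counted.\<close>

lemma distr_flip:
  assumes \<theta>: "sqnorm_n n \<theta> = 1"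
  shows "distr (gauss_space n N) (gauss_space n N) (flip n N \<theta> E) = gauss_space n N"
  unfolding gauss_space_eq
proof (rule gauss_n_product.PiM_eqI)
  let ?P = "PiM {..N} (\<lambda>_. gauss_n n)"
  fix A :: "nat \<Rightarrow> (nat \<Rightarrow> real) set" assume A: "\<And>i. i \<in> {..N} \<Longrightarrow> A i \<in> sets (gauss_n n)"
  define A' where "A' = (\<lambda>i. if i \<in> E then refl_n n \<theta> -` A i \<inter> space (gauss_n n) else A i)"
  have rm: "refl_n n \<theta> \<in> measurable (gauss_n n) (gauss_n n)" using measurable_refl by (simp cong: measurable_cong_sets add: sets_gauss_n)
  have A': "A' i \<in> sets (gauss_n n)" if "i \<in> {..N}" for i using A[OF that] measurable_sets[OF rm] by (auto simp: A'_def)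
  have pre: "flip n N \<theta> E -` PiE {..N} A \<inter> space ?P = PiE {..N} A'"
  proof -
    have sub: "A i \<subseteq> space (gauss_n n)" if "i \<in> {..N}" for i using A[OF that] by (rule sets.sets_into_space)
    have "(w i \<in> space (gauss_n n) \<and> flip n N \<theta> E w i \<in> A i) \<longleftrightarrow> w i \<in> A' i" if "i \<in> {..N}" for w i
      using sub[OF that] that by (auto simp: flip_def A'_def)
    moreover have "flip n N \<theta> E w \<in> extensional {..N}" for w by (simp add: flip_def)
    ultimately show ?thesis unfolding space_PiM vimage_def PiE_iff by blast
  qed
  have "emeasure (distr ?P ?P (flip n N \<theta> E)) (PiE {..N} A) = emeasure ?P (PiE {..N} A')"
    using measurable_flip[of n N \<theta> E] A pre unfolding gauss_space_eq by (subst emeasure_distr) (auto intro!: sets_PiM_I_finite)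
  also have "\<dots> = (\<Prod>i\<in>{..N}. emeasure (gauss_n n) (A' i))" by (rule gauss_n_product.emeasure_PiM) (auto intro: A')
  also have "\<dots> = (\<Prod>i\<in>{..N}. emeasure (gauss_n n) (A i))"
  proof (rule prod.cong[OF refl])
    fix i assume i: "i \<in> {..N}"
    have "emeasure (gauss_n n) (refl_n n \<theta> -` A i \<inter> space (gauss_n n)) = (\<integral>\<^sup>+x. indicator (refl_n n \<theta> -` A i \<inter> space (gauss_n n)) x \<partial>gauss_n n)"
      using measurable_sets[OF rm A[OF i]] by simp
    also have "\<dots> = (\<integral>\<^sup>+x. indicator (A i) (refl_n n \<theta> x) \<partial>gauss_n n)"
      by (intro nn_integral_cong) (simp add: indicator_def)
    also have "\<dots> = (\<integral>\<^sup>+x. indicator (A i) x \<partial>gauss_n n)"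
      by (rule nn_integral_gauss_refl[OF \<theta>]) (use A[OF i] in \<open>simp add: sets_gauss_n\<close>)
    also have "\<dots> = emeasure (gauss_n n) (A i)" using A[OF i] by simp
    finally show "emeasure (gauss_n n) (A' i) = emeasure (gauss_n n) (A i)" by (simp add: A'_def)
  qed
  finally show "emeasure (distr ?P ?P (flip n N \<theta> E)) (PiE {..N} A) = (\<Prod>i\<in>{..N}. emeasure (gauss_n n) (A i))" .
qed auto

section \<open>Counting the flips whose hull misses a given point\<close>

lemma card_traces_le:
  assumes I: "finite I" and J: "J \<subseteq> I" and P: "P \<subseteq> Pow J"
  shows "real (card {E. E \<subseteq> I \<and> E \<inter> J \<in> P}) \<le> real (card P) * 2 ^ (card I - card J)"
proof -
  have finP: "finite P" using I J P by (meson finite_Pow_iff finite_subset)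
  have finJ: "finite J" using I J finite_subset by blast
  have "{E. E \<subseteq> I \<and> E \<inter> J \<in> P} \<subseteq> (\<lambda>(D, F). D \<union> F) ` (P \<times> Pow (I - J))"
  proof
    fix E assume E: "E \<in> {E. E \<subseteq> I \<and> E \<inter> J \<in> P}"
    then have "E = (\<lambda>(D, F). D \<union> F) (E \<inter> J, E - J)" "(E \<inter> J, E - J) \<in> P \<times> Pow (I - J)" by auto
    then show "E \<in> (\<lambda>(D, F). D \<union> F) ` (P \<times> Pow (I - J))" by (rule image_eqI)
  qed
  then have "card {E. E \<subseteq> I \<and> E \<inter> J \<in> P} \<le> card ((\<lambda>(D, F). D \<union> F) ` (P \<times> Pow (I - J)))"
    using I finP by (intro card_mono) auto
  also have "\<dots> \<le> card (P \<times> Pow (I - J))" using I finP by (intro card_image_le) auto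
  also have "\<dots> = card P * 2 ^ (card I - card J)"
    using I J finJ by (simp add: card_cartesian_product card_Pow card_Diff_subset)
  finally have "card {E. E \<subseteq> I \<and> E \<inter> J \<in> P} \<le> card P * 2 ^ (card I - card J)" .
  then have "real (card {E. E \<subseteq> I \<and> E \<inter> J \<in> P}) \<le> real (card P * 2 ^ (card I - card J))" by (rule of_nat_mono)
  then show ?thesis by simp
qed

lemma dot_proj_cong: "(\<And>k. k < n \<Longrightarrow> y k = - z k) \<Longrightarrow> dot n u y = - dot n u z"
  by (simp add: dot_def sum_negf)

text \<open>A convex combination whose projection orthogonal to \<theta> vanishes lies on the line
  through \<theta>. The combination over J1 has height s1 \<ge> \<rho>, the one over J2 has height
  s2 \<le> \<rho>, and x, at height \<rho>, lies between them.\<close>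

lemma mem_chull_of_balanced:
  fixes v :: "nat \<Rightarrow> nat \<Rightarrow> real"
  assumes I: "finite I" and J: "J1 \<subseteq> I" "J2 \<subseteq> I" and x: "x \<in> space (lebesgue_n n)" "\<And>k. k < n \<Longrightarrow> x k = \<rho> * \<theta> k"
    and c1: "c1 \<in> weights J1" "\<forall>k<n. (\<Sum>i\<in>J1. c1 i * proj_n n \<theta> (v i) k) = 0"
    and c2: "c2 \<in> weights J2" "\<forall>k<n. (\<Sum>i\<in>J2. c2 i * proj_n n \<theta> (v i) k) = 0"
    and J1: "\<And>i. i \<in> J1 \<Longrightarrow> \<rho> \<le> dot n \<theta> (v i)" and J2: "\<And>i. i \<in> J2 \<Longrightarrow> dot n \<theta> (v i) \<le> \<rho>"
  shows "x \<in> chull n I v"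
proof -
  define s1 where "s1 = (\<Sum>i\<in>J1. c1 i * dot n \<theta> (v i))"
  define s2 where "s2 = (\<Sum>i\<in>J2. c2 i * dot n \<theta> (v i))"
  have k1: "(\<Sum>i\<in>J1. c1 i * v i k) = s1 * \<theta> k" if "k < n" for k
    using c1(2) that by (simp add: proj_n_def right_diff_distrib sum_subtractf s1_def sum_distrib_right mult.assoc)
  have k2: "(\<Sum>i\<in>J2. c2 i * v i k) = s2 * \<theta> k" if "k < n" for k
    using c2(2) that by (simp add: proj_n_def right_diff_distrib sum_subtractf s2_def sum_distrib_right mult.assoc)
  have "\<rho> = (\<Sum>i\<in>J1. c1 i * \<rho>)" using c1(1) by (simp add: sum_distrib_right[symmetric] weights_def)
  also have "\<dots> \<le> s1" unfolding s1_def using c1(1) J1 by (intro sum_mono mult_left_mono) (auto simp: weights_def)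
  finally have s1: "\<rho> \<le> s1" .
  have "s2 \<le> (\<Sum>i\<in>J2. c2 i * \<rho>)" unfolding s2_def using c2(1) J2 by (intro sum_mono mult_left_mono) (auto simp: weights_def)
  also have "\<dots> = \<rho>" using c2(1) by (simp add: sum_distrib_right[symmetric] weights_def)
  finally have s2: "s2 \<le> \<rho>" .
  obtain t where t: "0 \<le> t" "t \<le> 1" "(1 - t) * s1 + t * s2 = \<rho>"
  proof (cases "s1 = s2")
    case True
    then show ?thesis using that[of 0] s1 s2 by simp
  next
    case False
    then have d: "s1 - s2 > 0" using s1 s2 by simp
    define t where "t = (s1 - \<rho>) / (s1 - s2)"
    have "t * (s1 - s2) = s1 - \<rho>" using d by (simp add: t_def)
    then have "(1 - t) * s1 + t * s2 = \<rho>" by (simp add: algebra_simps)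
    moreover have "0 \<le> t" "t \<le> 1" using d s1 s2 by (auto simp: t_def)
    ultimately show ?thesis using that by blast
  qed
  define d where "d = (\<lambda>i. (1 - t) * (if i \<in> J1 then c1 i else 0) + t * (if i \<in> J2 then c2 i else 0))"
  have sum_d: "(\<Sum>i\<in>I. d i * f i) = (1 - t) * (\<Sum>i\<in>J1. c1 i * f i) + t * (\<Sum>i\<in>J2. c2 i * f i)" for f
  proof -
    have "(\<Sum>i\<in>I. d i * f i) = (1 - t) * (\<Sum>i\<in>I. (if i \<in> J1 then c1 i else 0) * f i) + t * (\<Sum>i\<in>I. (if i \<in> J2 then c2 i else 0) * f i)"
      by (simp add: d_def distrib_right sum.distrib sum_distrib_left mult.assoc)
    also have "(\<Sum>i\<in>I. (if i \<in> J1 then c1 i else 0) * f i) = (\<Sum>i\<in>J1. c1 i * f i)"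
      using I J by (intro sum.mono_neutral_cong_right) auto
    also have "(\<Sum>i\<in>I. (if i \<in> J2 then c2 i else 0) * f i) = (\<Sum>i\<in>J2. c2 i * f i)"
      using I J by (intro sum.mono_neutral_cong_right) auto
    finally show ?thesis .
  qed
  have "d \<in> weights I"
    using sum_d[of "\<lambda>_. 1"] c1(1) c2(1) t by (auto simp: weights_def d_def)
  moreover have "x = lincomb n I d v"
  proof
    fix k show "x k = lincomb n I d v k"
    proof (cases "k < n")
      case True
      have "(\<Sum>i\<in>I. d i * v i k) = ((1 - t) * s1 + t * s2) * \<theta> k"
        unfolding sum_d k1[OF True] k2[OF True] by (simp add: algebra_simps)
      then show ?thesis using True x(2) t(3) by (simp add: lincomb_def)
    next
      case False then show ?thesis using x(1) by (simp add: lincomb_def space_lebesgue_n PiE_iff extensional_def)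
    qed
  qed
  ultimately show ?thesis by (auto simp: chull_def)
qed

text \<open>Flips leave the index sets J1 and J2 unchanged. If the flipped hull misses x, Gordan's
  alternative yields, for one of the two, a functional positive on all flipped projections. The
  trace of E there is a half-space pattern of the unflipped projections, of which there are
  few.\<close>

lemma card_bad_flips_le:
  fixes n N :: nat
  assumes \<theta>: "sqnorm_n n \<theta> = 1" and x: "x \<in> space (lebesgue_n n)" "\<And>k. k < n \<Longrightarrow> x k = \<rho> * \<theta> k"
  defines "J1 \<equiv> \<lambda>w. {i\<in>{1..N}. \<rho> \<le> dot n \<theta> (w i)}" and "J2 \<equiv> \<lambda>w. {i\<in>{1..N}. dot n \<theta> (w i) \<le> \<rho>}"
  shows "real (card {E. E \<subseteq> {1..N} \<and> x \<notin> chull n {1..N} (flip n N \<theta> E w)})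
    \<le> 2 ^ N * (2 ^ n * ((3 / 4) ^ card (J1 w) + (3 / 4) ^ card (J2 w)))"
proof -
  define pat where "pat = (\<lambda>J. {D. D \<subseteq> J \<and> (\<exists>u. (\<forall>i\<in>D. dot n u (proj_n n \<theta> (w i)) < 0) \<and> (\<forall>i\<in>J - D. dot n u (proj_n n \<theta> (w i)) > 0))})"
  define tr where "tr = (\<lambda>J. {E. E \<subseteq> {1..N} \<and> E \<inter> J \<in> pat J})"
  have cnt: "real (card (tr J)) \<le> 2 ^ N * (2 ^ n * (3 / 4) ^ card J)" if J: "J \<subseteq> {1..N}" for J
  proof -
    have fin: "finite J" using J finite_subset by blast
    have cJ: "card J \<le> N" using card_mono[OF _ J] by simp
    have "real (card (tr J)) \<le> real (card (pat J)) * 2 ^ (card {1..N} - card J)"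
      unfolding tr_def by (rule card_traces_le[OF _ J]) (auto simp: pat_def)
    also have "\<dots> \<le> (2 ^ n * (3 / 2) ^ card J) * 2 ^ (N - card J)"
      unfolding pat_def using card_halfspace_patterns_le[OF fin, of n "\<lambda>i. proj_n n \<theta> (w i)"] by (simp add: mult_right_mono)
    also have "(2::real) ^ (N - card J) = 2 ^ N / 2 ^ card J" using cJ by (simp add: power_diff)
    also have "(2 ^ n * (3 / 2) ^ card J) * (2 ^ N / 2 ^ card J) = 2 ^ N * (2 ^ n * (3 / 4 :: real) ^ card J)"
      by (simp add: power_divide power_mult_distrib[symmetric] field_simps)
    finally show ?thesis .
  qed
  have "{E. E \<subseteq> {1..N} \<and> x \<notin> chull n {1..N} (flip n N \<theta> E w)} \<subseteq> tr (J1 w) \<union> tr (J2 w)"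
  proof
    fix E assume E: "E \<in> {E. E \<subseteq> {1..N} \<and> x \<notin> chull n {1..N} (flip n N \<theta> E w)}"
    define v where "v = flip n N \<theta> E w"
    have dv: "dot n \<theta> (v i) = dot n \<theta> (w i)" if "i \<in> {1..N}" for i
      using that by (simp add: v_def flip_def dot_refl[OF \<theta>])
    have pv: "dot n u (proj_n n \<theta> (v i)) = (if i \<in> E then - dot n u (proj_n n \<theta> (w i)) else dot n u (proj_n n \<theta> (w i)))"
      if "i \<in> {1..N}" for i u
      using that dot_proj_cong[of n "proj_n n \<theta> (refl_n n \<theta> (w i))" "proj_n n \<theta> (w i)" u] proj_refl[OF \<theta>]
      by (simp add: v_def flip_def)
    \<comment> \<open>Positivity after flipping means that u is negative on the unflipped
      projections exactly for the indices of J in E.\<close>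
    have sep: "E \<in> tr J" if J: "J \<subseteq> {1..N}" and no: "\<not> (\<exists>c\<in>weights J. \<forall>k<n. (\<Sum>i\<in>J. c i * proj_n n \<theta> (v i) k) = 0)" for J
    proof -
      have "finite J" using J finite_subset by blast
      from Gordan[OF this, of n "\<lambda>i. proj_n n \<theta> (v i)"] no
      obtain u where u: "\<forall>i\<in>J. dot n u (proj_n n \<theta> (v i)) > 0" by blast
      have "E \<inter> J \<in> pat J" unfolding pat_def
      proof (intro CollectI conjI exI[of _ u] ballI)
        fix i assume i: "i \<in> E \<inter> J"
        then have "i \<in> {1..N}" using J by auto
        from pv[OF this, of u] u i show "dot n u (proj_n n \<theta> (w i)) < 0" by auto
      next
        fix i assume i: "i \<in> J - E \<inter> J"
        then have "i \<in> {1..N}" using J by auto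
        from pv[OF this, of u] u i show "dot n u (proj_n n \<theta> (w i)) > 0" by auto
      qed simp
      then show ?thesis using E by (simp add: tr_def)
    qed
    have J: "J1 w \<subseteq> {1..N}" "J2 w \<subseteq> {1..N}" by (auto simp: J1_def J2_def)
    show "E \<in> tr (J1 w) \<union> tr (J2 w)"
    proof (rule ccontr)
      assume neg: "E \<notin> tr (J1 w) \<union> tr (J2 w)"
      then obtain c1 where c1: "c1 \<in> weights (J1 w)" "\<forall>k<n. (\<Sum>i\<in>J1 w. c1 i * proj_n n \<theta> (v i) k) = 0"
        using sep[OF J(1)] by blast
      obtain c2 where c2: "c2 \<in> weights (J2 w)" "\<forall>k<n. (\<Sum>i\<in>J2 w. c2 i * proj_n n \<theta> (v i) k) = 0"
        using neg sep[OF J(2)] by blast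
      have "x \<in> chull n {1..N} v"
        by (rule mem_chull_of_balanced[OF _ J x c1 c2]) (auto simp: J1_def J2_def dv)
      then show False using E by (simp add: v_def)
    qed
  qed
  then have "card {E. E \<subseteq> {1..N} \<and> x \<notin> chull n {1..N} (flip n N \<theta> E w)} \<le> card (tr (J1 w) \<union> tr (J2 w))"
    by (intro card_mono) (auto simp: tr_def)
  also have "\<dots> \<le> card (tr (J1 w)) + card (tr (J2 w))" by (rule card_Un_le)
  finally have "real (card {E. E \<subseteq> {1..N} \<and> x \<notin> chull n {1..N} (flip n N \<theta> E w)}) \<le> real (card (tr (J1 w))) + real (card (tr (J2 w)))"
    by (simp flip: of_nat_add)
  also have "\<dots> \<le> 2 ^ N * (2 ^ n * (3 / 4) ^ card (J1 w)) + 2 ^ N * (2 ^ n * (3 / 4) ^ card (J2 w))"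
    by (intro add_mono cnt) (auto simp: J1_def J2_def)
  finally show ?thesis by (simp add: distrib_left)
qed

section \<open>Probability of missing a fixed point\<close>

lemma gauss1_unit_interval_ge:
  assumes "0 \<le> r" "\<And>y. a \<le> y \<Longrightarrow> y \<le> a + 1 \<Longrightarrow> \<bar>y\<bar> \<le> r + 1"
  shows "ennreal (exp (- r\<^sup>2 - 3)) \<le> emeasure gauss1 {a..a + 1}"
proof -
  \<comment> \<open>Both losses are absorbed in the 3: (r + 1)^2 / 2 \<le> r^2 + 1, and 1 / sqrt (2
    pi) is at least exp (-2).\<close>
  have d: "exp (- r\<^sup>2 - 3) \<le> std_normal_density y" if "a \<le> y" "y \<le> a + 1" for y
  proof -
    have "y\<^sup>2 \<le> (r + 1)\<^sup>2" using assms that by (metis abs_le_square_iff abs_of_nonneg add_nonneg_nonneg zero_le_one)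
    also have "\<dots> \<le> 2 * r\<^sup>2 + 2"
    proof -
      have "0 \<le> (r - 1)\<^sup>2" by simp
      then show ?thesis by (simp add: power2_sum power2_diff)
    qed
    finally have "- r\<^sup>2 - 1 \<le> - y\<^sup>2 / 2" by simp
    then have e: "exp (- r\<^sup>2 - 1) \<le> exp (- y\<^sup>2 / 2)" by simp
    have "exp (- 2) \<le> 1 / sqrt (2 * pi)"
    proof -
      have "3 \<le> exp (2::real)" using exp_ge_add_one_self[of 2] by simp
      then have "3\<^sup>2 \<le> (exp (2::real))\<^sup>2" by (intro power_mono) auto
      moreover have "2 * pi \<le> 3\<^sup>2" using pi_less_4 by simp
      ultimately have "sqrt (2 * pi) \<le> exp 2" by (intro real_le_lsqrt) auto
      then show ?thesis using pi_gt_zero by (simp add: exp_minus field_simps)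
    qed
    then have "exp (- 2) * exp (- r\<^sup>2 - 1) \<le> 1 / sqrt (2 * pi) * exp (- y\<^sup>2 / 2)"
      using e by (intro mult_mono) auto
    moreover have "exp (- 2) * exp (- r\<^sup>2 - 1) = exp (- r\<^sup>2 - 3)"
      unfolding exp_add[symmetric] by (rule arg_cong[where f=exp]) simp
    ultimately show ?thesis by (simp add: std_normal_density_def)
  qed
  have "ennreal (exp (- r\<^sup>2 - 3)) = (\<integral>\<^sup>+y. ennreal (exp (- r\<^sup>2 - 3)) * indicator {a..a + 1} y \<partial>lborel)"
    by (subst nn_integral_cmult_indicator) auto
  also have "\<dots> \<le> (\<integral>\<^sup>+y. ennreal (std_normal_density y) * indicator {a..a + 1} y \<partial>lborel)"
    using d by (intro nn_integral_mono) (auto simp: indicator_def intro!: ennreal_leI)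
  also have "\<dots> = emeasure gauss1 {a..a + 1}" by (rule emeasure_density[symmetric]) auto
  finally show ?thesis .
qed


text \<open>By independence the expectation is (1 - q / 4) ^ N, where q \<ge> p is the measure of A.
  It replaces a separate estimate for the number of samples in A. Sample 0 is not counted and
  contributes a factor 1.\<close>

lemma nn_integral_power_card_le:
  assumes A: "A \<in> sets (gauss_n n)" and p: "ennreal p \<le> emeasure (gauss_n n) A" "0 \<le> p"
  shows "(\<integral>\<^sup>+w. ennreal ((3 / 4) ^ card {i\<in>{1..N}. w i \<in> A}) \<partial>gauss_space n N) \<le> ennreal (exp (- real N * p / 4))"
proof -
  interpret G: prob_space "gauss_n n" by (rule prob_space_gauss_n)
  define g where "g = (\<lambda>(i::nat) (y::nat \<Rightarrow> real). if i \<in> {1..N} \<and> y \<in> A then ennreal (3 / 4) else 1)"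
  have gm: "g i \<in> borel_measurable (gauss_n n)" for i
    using A by (cases "i \<in> {1..N}") (auto simp: g_def intro!: measurable_If)
  have "ennreal ((3 / 4) ^ card {i\<in>{1..N}. w i \<in> A}) = (\<Prod>i\<in>{..N}. g i (w i))" for w
  proof -
    have "(\<Prod>i\<in>{..N}. g i (w i)) = (\<Prod>i\<in>{i\<in>{1..N}. w i \<in> A}. ennreal (3 / 4))"
      by (intro prod.mono_neutral_cong_right) (auto simp: g_def)
    also have "\<dots> = ennreal ((3 / 4) ^ card {i\<in>{1..N}. w i \<in> A})"
      by (simp only: prod_constant) (simp add: ennreal_power)
    finally show ?thesis by simp
  qed
  then have "(\<integral>\<^sup>+w. ennreal ((3 / 4) ^ card {i\<in>{1..N}. w i \<in> A}) \<partial>gauss_space n N) = (\<integral>\<^sup>+w. (\<Prod>i\<in>{..N}. g i (w i)) \<partial>gauss_space n N)"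
    by simp
  also have "\<dots> = (\<Prod>i\<in>{..N}. integral\<^sup>N (gauss_n n) (g i))"
    unfolding gauss_space_eq by (rule gauss_n_product.product_nn_integral_prod) (auto simp: gm)
  also have "\<dots> = (\<Prod>i\<in>{1..N}. integral\<^sup>N (gauss_n n) (g i))"
  proof (rule prod.mono_neutral_right)
    show "\<forall>i\<in>{..N} - {1..N}. integral\<^sup>N (gauss_n n) (g i) = 1"
      using G.emeasure_space_1 by (auto simp: g_def)
  qed auto
  also have "\<dots> \<le> ennreal (exp (- p / 4)) ^ N"
  proof -
    have one: "integral\<^sup>N (gauss_n n) (g i) \<le> ennreal (exp (- p / 4))" if i: "i \<in> {1..N}" for i
    proof -
      define q where "q = measure (gauss_n n) A"
      have q: "p \<le> q" "q \<le> 1" "0 \<le> q" using p by (auto simp: q_def G.emeasure_eq_measure)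
      have "integral\<^sup>N (gauss_n n) (g i) = (\<integral>\<^sup>+y. ennreal (3 / 4) * indicator A y + indicator (space (gauss_n n) - A) y \<partial>gauss_n n)"
        using i by (intro nn_integral_cong) (auto simp: g_def indicator_def)
      also have "\<dots> = ennreal (3 / 4) * emeasure (gauss_n n) A + emeasure (gauss_n n) (space (gauss_n n) - A)"
        using A by (subst nn_integral_add) (auto simp: nn_integral_cmult_indicator)
      also have "\<dots> = ennreal (3 / 4 * q) + ennreal (1 - q)"
        unfolding G.emeasure_eq_measure G.prob_compl[OF A] q_def[symmetric] using q by (subst ennreal_mult) auto
      also have "\<dots> = ennreal (3 / 4 * q + (1 - q))" using q by (intro ennreal_plus[symmetric]) auto
      also have "\<dots> \<le> ennreal (exp (- p / 4))"
      proof (rule ennreal_leI)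
        have "3 / 4 * q + (1 - q) \<le> 1 + (- p / 4)" using q by simp
        also have "\<dots> \<le> exp (- p / 4)" by (rule exp_ge_add_one_self)
        finally show "3 / 4 * q + (1 - q) \<le> exp (- p / 4)" .
      qed
      finally show ?thesis .
    qed
    have "(\<Prod>i\<in>S. integral\<^sup>N (gauss_n n) (g i)) \<le> ennreal (exp (- p / 4)) ^ card S" if "finite S" "S \<subseteq> {1..N}" for S
      using that
    proof (induction S rule: finite_induct)
      case (insert i S)
      then show ?case using one[of i] by (simp add: mult_mono)
    qed simp
    from this[of "{1..N}"] show ?thesis by simp
  qed
  also have "\<dots> = ennreal (exp (- real N * p / 4))"
    by (simp add: ennreal_power exp_of_nat_mult[symmetric])
  finally show ?thesis .
qed

lemma emeasure_gauss_halfspace: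
  assumes \<theta>: "sqnorm_n n \<theta> = 1" and S: "S \<in> sets borel"
  shows "{g\<in>space (gauss_n n). dot n \<theta> g \<in> S} \<in> sets (gauss_n n)"
    "emeasure (gauss_n n) {g\<in>space (gauss_n n). dot n \<theta> g \<in> S} = emeasure gauss1 S"
proof -
  have dm: "dot n \<theta> \<in> borel_measurable (gauss_n n)" unfolding dot_def by measurable
  then show m: "{g\<in>space (gauss_n n). dot n \<theta> g \<in> S} \<in> sets (gauss_n n)" using S by measurable
  have "emeasure (gauss_n n) {g\<in>space (gauss_n n). dot n \<theta> g \<in> S} = (\<integral>\<^sup>+g. indicator {g\<in>space (gauss_n n). dot n \<theta> g \<in> S} g \<partial>gauss_n n)"
    using m by simp
  also have "\<dots> = (\<integral>\<^sup>+g. indicator S (\<Sum>k\<in>{..<n}. \<theta> k * g k) \<partial>PiM {..<n} (\<lambda>_. gauss1))"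
    unfolding gauss_n_def by (intro nn_integral_cong) (auto simp: indicator_def dot_def)
  also have "\<dots> = (\<integral>\<^sup>+z. indicator S (sqrt (\<Sum>k\<in>{..<n}. (\<theta> k)\<^sup>2) * z) \<partial>gauss1)"
    by (rule nn_integral_gauss_linear_form) (use S in auto)
  also have "\<dots> = (\<integral>\<^sup>+z. indicator S z \<partial>gauss1)" using \<theta> by (simp add: sqnorm_n_def)
  also have "\<dots> = emeasure gauss1 S" using S by simp
  finally show "emeasure (gauss_n n) {g\<in>space (gauss_n n). dot n \<theta> g \<in> S} = emeasure gauss1 S" .
qed

lemma sets_miss: "{w\<in>space (gauss_space n N). x \<notin> chull n {1..N} w} \<in> sets (gauss_space n N)"
proof (cases "x \<in> space (lebesgue_n n)")
  case True
  have "{w\<in>space (gauss_space n N). x \<in> chull n {1..N} w} \<in> sets (gauss_space n N)"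
    unfolding gauss_space_eq using True
    by (intro sets_mem_chull measurable_PiM_gauss_n_component) auto
  moreover have "{w\<in>space (gauss_space n N). x \<notin> chull n {1..N} w} = space (gauss_space n N) - {w\<in>space (gauss_space n N). x \<in> chull n {1..N} w}"
    by auto
  ultimately show ?thesis by simp
next
  case False
  then have "x \<notin> chull n {1..N} w" for w by (auto simp: chull_def)
  then show ?thesis by simp
qed

text \<open>The law is invariant under flips, so the probability of a miss equals the mean fraction
  of bad flips of a fixed sample. This reduces everything to the numbers of samples on either side
  of x. Only samples 1 to N enter, so the bound serves both bodies.\<close>

lemma miss_prob_le:
  assumes n: "1 \<le> n" and x: "x \<in> space (lebesgue_n n)" and r: "0 \<le> r" "sqnorm_n n x \<le> r\<^sup>2"
  shows "emeasure (gauss_space n N) {w\<in>space (gauss_space n N). x \<notin> chull n {1..N} w}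
    \<le> ennreal (2 ^ n * 2 * exp (- real N * exp (- r\<^sup>2 - 3) / 4))"
proof -
  let ?G = "gauss_space n N"
  define \<rho> where "\<rho> = sqrt (sqnorm_n n x)"
  have rho: "0 \<le> \<rho>" "\<rho> \<le> r" "\<rho>\<^sup>2 = sqnorm_n n x" using r by (auto simp: \<rho>_def intro: real_le_lsqrt)
  \<comment> \<open>For x = 0 any unit direction will do; it exists because n \<ge> 1.\<close>
  obtain \<theta> where \<theta>: "sqnorm_n n \<theta> = 1" "\<And>k. k < n \<Longrightarrow> x k = \<rho> * \<theta> k"
  proof (cases "\<rho> = 0")
    case True
    then have "x k = 0" if "k < n" for k using rho that by (simp add: sqnorm_n_def sum_nonneg_eq_0_iff)
    moreover have "sqnorm_n n (\<lambda>k. if k = 0 then 1 else 0) = 1"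
      using n by (simp add: sqnorm_n_def if_distrib[of "\<lambda>x. x\<^sup>2"] cong: if_cong)
    ultimately show ?thesis using that[of "\<lambda>k. if k = 0 then 1 else 0"] True by auto
  next
    case False
    have "sqnorm_n n (\<lambda>k. x k / \<rho>) = sqnorm_n n x / \<rho>\<^sup>2"
      by (simp add: sqnorm_n_def power_divide sum_divide_distrib)
    then have "sqnorm_n n (\<lambda>k. x k / \<rho>) = 1" using False unfolding rho(3)[symmetric] by simp
    then show ?thesis using that[of "\<lambda>k. x k / \<rho>"] False by simp
  qed
  define A1 where "A1 = {g\<in>space (gauss_n n). dot n \<theta> g \<in> {\<rho>..}}"
  define A2 where "A2 = {g\<in>space (gauss_n n). dot n \<theta> g \<in> {..\<rho>}}"
  define p where "p = exp (- r\<^sup>2 - 3)"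
  have A: "A1 \<in> sets (gauss_n n)" "A2 \<in> sets (gauss_n n)"
    unfolding A1_def A2_def by (auto intro!: emeasure_gauss_halfspace(1)[OF \<theta>(1)] simp del: atLeast_iff atMost_iff)
  have "ennreal p \<le> emeasure gauss1 {\<rho>..\<rho> + 1}" unfolding p_def
    by (rule gauss1_unit_interval_ge) (use r rho in auto)
  also have "\<dots> \<le> emeasure gauss1 {\<rho>..}" by (rule emeasure_mono) auto
  also have "\<dots> = emeasure (gauss_n n) A1" unfolding A1_def by (rule emeasure_gauss_halfspace(2)[OF \<theta>(1), symmetric]) simp
  finally have p1: "ennreal p \<le> emeasure (gauss_n n) A1" .
  \<comment> \<open>The near side of x contains the interval [-1, 0], as \<rho> \<ge> 0, and p
    bounds its mass from below as well.\<close>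
  have "ennreal p \<le> emeasure gauss1 {-1..-1 + 1}" unfolding p_def
    by (rule gauss1_unit_interval_ge) (use r rho in auto)
  also have "\<dots> \<le> emeasure gauss1 {..\<rho>}" using rho by (intro emeasure_mono) auto
  also have "\<dots> = emeasure (gauss_n n) A2" unfolding A2_def by (rule emeasure_gauss_halfspace(2)[OF \<theta>(1), symmetric]) simp
  finally have p2: "ennreal p \<le> emeasure (gauss_n n) A2" .
  define Bad where "Bad = {w\<in>space ?G. x \<notin> chull n {1..N} w}"
  have Bad: "Bad \<in> sets ?G" unfolding Bad_def by (rule sets_miss)
  have fl: "emeasure ?G Bad = (\<integral>\<^sup>+w. indicator Bad (flip n N \<theta> E w) \<partial>?G)" for E
  proof -
    have "emeasure ?G Bad = (\<integral>\<^sup>+w. indicator Bad w \<partial>distr ?G ?G (flip n N \<theta> E))"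
      using Bad by (simp add: distr_flip[OF \<theta>(1)])
    also have "\<dots> = (\<integral>\<^sup>+w. indicator Bad (flip n N \<theta> E w) \<partial>?G)"
      by (rule nn_integral_distr[OF measurable_flip]) (use Bad in simp)
    finally show ?thesis .
  qed
  define c1 where "c1 = (\<lambda>w::nat \<Rightarrow> nat \<Rightarrow> real. ennreal ((3 / 4) ^ card {i\<in>{1..N}. w i \<in> A1}))"
  define c2 where "c2 = (\<lambda>w::nat \<Rightarrow> nat \<Rightarrow> real. ennreal ((3 / 4) ^ card {i\<in>{1..N}. w i \<in> A2}))"
  have cm: "(\<lambda>w. ennreal ((3 / 4) ^ card {i\<in>{1..N}. w i \<in> S})) \<in> borel_measurable ?G" if S: "S \<in> sets (gauss_n n)" for S
  proof -
    have "(\<lambda>w. \<Prod>i\<in>{1..N}. (if w i \<in> S then ennreal (3 / 4) else 1)) \<in> borel_measurable ?G"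
    proof (intro borel_measurable_prod_ennreal)
      fix i assume "i \<in> {1..N}"
      then have "(\<lambda>w. w i) \<in> measurable ?G (gauss_n n)" unfolding gauss_space_eq by (intro measurable_component_singleton) auto
      from measurable_sets[OF this S] show "(\<lambda>w. if w i \<in> S then ennreal (3 / 4) else 1) \<in> borel_measurable ?G"
        by (intro measurable_If) (auto simp: vimage_def Int_def conj_commute)
    qed
    moreover have "(\<Prod>i\<in>{1..N}. (if w i \<in> S then ennreal (3 / 4) else 1)) = ennreal ((3 / 4) ^ card {i\<in>{1..N}. w i \<in> S})" for w :: "nat \<Rightarrow> nat \<Rightarrow> real"
    proof -
      have "(\<Prod>i\<in>{1..N}. (if w i \<in> S then ennreal (3 / 4) else 1)) = (\<Prod>i\<in>{i\<in>{1..N}. w i \<in> S}. ennreal (3 / 4))"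
        by (intro prod.mono_neutral_cong_right) auto
      also have "\<dots> = ennreal (3 / 4) ^ card {i\<in>{1..N}. w i \<in> S}" by (rule prod_constant)
      also have "\<dots> = ennreal ((3 / 4) ^ card {i\<in>{1..N}. w i \<in> S})" by (rule ennreal_power) simp
      finally show ?thesis .
    qed
    ultimately show ?thesis by (simp only:)
  qed
  have c1m: "c1 \<in> borel_measurable ?G" unfolding c1_def by (rule cm[OF A(1)])
  have c2m: "c2 \<in> borel_measurable ?G" unfolding c2_def by (rule cm[OF A(2)])
  \<comment> \<open>Sums the same probability over all 2 ^ N flips, so that the count of bad flips
    can be applied under the integral.\<close>
  have "ennreal (2 ^ N) * emeasure ?G Bad = (\<Sum>E\<in>Pow {1..N}. emeasure ?G Bad)"
    by (simp add: card_Pow ennreal_power[symmetric])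
  also have "\<dots> = (\<Sum>E\<in>Pow {1..N}. \<integral>\<^sup>+w. indicator Bad (flip n N \<theta> E w) \<partial>?G)" using fl by simp
  also have "\<dots> = (\<integral>\<^sup>+w. (\<Sum>E\<in>Pow {1..N}. indicator Bad (flip n N \<theta> E w)) \<partial>?G)"
    using Bad by (intro nn_integral_sum[symmetric] measurable_compose[OF measurable_flip]) auto
  also have "\<dots> \<le> (\<integral>\<^sup>+w. ennreal (2 ^ N) * (ennreal (2 ^ n) * (c1 w + c2 w)) \<partial>?G)"
  proof (rule nn_integral_mono)
    fix w assume w: "w \<in> space ?G"
    have ws: "w i \<in> space (gauss_n n)" if "i \<in> {1..N}" for i
      using w that by (auto simp: gauss_space_eq space_PiM PiE_iff)
    have J: "{i\<in>{1..N}. w i \<in> A1} = {i\<in>{1..N}. \<rho> \<le> dot n \<theta> (w i)}" "{i\<in>{1..N}. w i \<in> A2} = {i\<in>{1..N}. dot n \<theta> (w i) \<le> \<rho>}"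
      using ws by (auto simp: A1_def A2_def)
    have sp: "flip n N \<theta> E w \<in> space ?G" for E using measurable_space[OF measurable_flip w] .
    have "(\<Sum>E\<in>Pow {1..N}. indicator Bad (flip n N \<theta> E w) :: ennreal) = (\<Sum>E\<in>{E. E \<subseteq> {1..N} \<and> x \<notin> chull n {1..N} (flip n N \<theta> E w)}. 1)"
      using sp by (intro sum.mono_neutral_cong_right) (auto simp: Bad_def indicator_def)
    also have "\<dots> = ennreal (real (card {E. E \<subseteq> {1..N} \<and> x \<notin> chull n {1..N} (flip n N \<theta> E w)}))"
      by (simp add: ennreal_of_nat_eq_real_of_nat)
    also have "\<dots> \<le> ennreal (2 ^ N * (2 ^ n * ((3 / 4) ^ card {i\<in>{1..N}. \<rho> \<le> dot n \<theta> (w i)} + (3 / 4) ^ card {i\<in>{1..N}. dot n \<theta> (w i) \<le> \<rho>})))"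
      by (intro ennreal_leI card_bad_flips_le[OF \<theta>(1) x \<theta>(2)])
    also have "\<dots> = ennreal (2 ^ N) * (ennreal (2 ^ n) * (c1 w + c2 w))"
      unfolding c1_def c2_def J by (simp add: ennreal_mult)
    finally show "(\<Sum>E\<in>Pow {1..N}. indicator Bad (flip n N \<theta> E w)) \<le> ennreal (2 ^ N) * (ennreal (2 ^ n) * (c1 w + c2 w))" .
  qed
  also have "\<dots> = ennreal (2 ^ N) * (ennreal (2 ^ n) * ((\<integral>\<^sup>+w. c1 w \<partial>?G) + (\<integral>\<^sup>+w. c2 w \<partial>?G)))"
    using c1m c2m by (simp add: nn_integral_cmult nn_integral_add)
  also have "\<dots> \<le> ennreal (2 ^ N) * (ennreal (2 ^ n) * (ennreal (exp (- real N * p / 4)) + ennreal (exp (- real N * p / 4))))"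
    unfolding c1_def c2_def using A p1 p2
    by (intro mult_left_mono add_mono nn_integral_power_card_le) (auto simp: p_def)
  finally have "ennreal (1 / 2 ^ N) * (ennreal (2 ^ N) * emeasure ?G Bad)
      \<le> ennreal (1 / 2 ^ N) * (ennreal (2 ^ N) * (ennreal (2 ^ n) * (ennreal (exp (- real N * p / 4)) + ennreal (exp (- real N * p / 4)))))"
    by (rule mult_left_mono) simp
  moreover have "ennreal (1 / 2 ^ N) * (ennreal (2 ^ N) * y) = y" for y
  proof -
    have "ennreal (1 / 2 ^ N) * (ennreal (2 ^ N) * y) = ennreal (1 / 2 ^ N * 2 ^ N) * y"
      unfolding mult.assoc[symmetric] by (subst ennreal_mult[of "1 / 2 ^ N"]) auto
    then show ?thesis by simp
  qed
  ultimately have "emeasure ?G Bad \<le> ennreal (2 ^ n) * (ennreal (exp (- real N * p / 4)) + ennreal (exp (- real N * p / 4)))"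
    by simp
  also have "\<dots> = ennreal (2 ^ n) * ennreal (exp (- real N * p / 4) + exp (- real N * p / 4))"
    by (subst ennreal_plus) auto
  also have "\<dots> = ennreal (2 ^ n * (exp (- real N * p / 4) + exp (- real N * p / 4)))"
    by (rule ennreal_mult[symmetric]) auto
  finally show ?thesis unfolding Bad_def p_def by (simp add: mult.assoc)
qed

text \<open>With r^2 = L / 2 one gets N exp (-r^2) = n sqrt (N / n) \<ge> 216 n; this explains 46656
  = 216^2. As exp (-3) \<ge> 1 / 27 and 216 / 27 / 4 = 2, the exponent is at most -2 n, which beats
  2 ^ n \<le> exp n.\<close>

lemma sample_density_bound:
  assumes n: "1 \<le> n" and N: "46656 * n \<le> N"
  defines "L \<equiv> ln (real N / real n)"
  shows "2 ^ n * 2 * exp (- real N * exp (- (sqrt (L / 2))\<^sup>2 - 3) / 4) \<le> 2 * exp (- real n)" "1 \<le> L"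
proof -
  have pos: "real n > 0" "real N > 0" using n N by auto
  have NR: "46656 * real n \<le> real N" using N by (metis of_nat_le_iff of_nat_mult of_nat_numeral)
  have q: "46656 \<le> real N / real n" using NR pos by (simp add: field_simps)
  have "exp 1 \<le> real N / real n" using q exp_le by linarith
  then have "exp 1 \<le> exp L" using pos by (simp add: L_def)
  then show L1: "1 \<le> L" by simp
  have "exp (L / 2) = sqrt (real N / real n)"
  proof -
    have "(exp (L / 2))\<^sup>2 = real N / real n" using pos by (simp add: exp_double[symmetric] L_def)
    then show ?thesis by (metis exp_ge_zero real_sqrt_unique)
  qed
  then have "real N * exp (- (L / 2)) = real N / sqrt (real N / real n)" by (simp add: exp_minus field_simps)
  also have "\<dots> = real n * sqrt (real N / real n)"
  proof -
    have "real N = real n * (sqrt (real N / real n) * sqrt (real N / real n))" using pos by simp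
    then show ?thesis using pos by (metis nonzero_mult_div_cancel_right mult.assoc real_sqrt_gt_zero divide_pos_pos less_irrefl)
  qed
  finally have eq: "real N * exp (- (L / 2)) = real n * sqrt (real N / real n)" .
  have "216 \<le> sqrt (real N / real n)"
    using real_sqrt_le_mono[OF q] real_sqrt_unique[of 216 46656] by simp
  then have "real n * 216 \<le> real N * exp (- (L / 2))" unfolding eq using pos by simp
  moreover have "1 / 27 \<le> exp (- 3 :: real)"
  proof -
    have "exp (3::real) = exp 1 ^ 3" by (simp add: exp_of_nat_mult[symmetric])
    also have "\<dots> \<le> 3 ^ 3" using exp_le by (intro power_mono) auto
    finally show ?thesis by (simp add: exp_minus field_simps)
  qed
  ultimately have "(real n * 216) * (1 / 27) \<le> (real N * exp (- (L / 2))) * exp (- 3)"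
    by (rule mult_mono) (use pos in auto)
  also have "\<dots> = real N * exp (- (sqrt (L / 2))\<^sup>2 - 3)"
    using L1 by (simp add: mult.assoc exp_add[symmetric])
  finally have "- real N * exp (- (sqrt (L / 2))\<^sup>2 - 3) / 4 \<le> - 2 * real n" by simp
  then have "exp (- real N * exp (- (sqrt (L / 2))\<^sup>2 - 3) / 4) \<le> exp (- 2 * real n)" by simp
  moreover have "(2::real) ^ n \<le> exp (real n)"
    using power_mono[of 2 "exp (1::real)" n] exp_ge_add_one_self[of 1] by (simp add: exp_of_nat_mult[symmetric])
  ultimately have "2 ^ n * exp (- real N * exp (- (sqrt (L / 2))\<^sup>2 - 3) / 4) \<le> exp (real n) * exp (- 2 * real n)"
    by (intro mult_mono) auto
  also have "\<dots> = exp (- real n)" by (simp add: exp_add[symmetric])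
  finally show "2 ^ n * 2 * exp (- real N * exp (- (sqrt (L / 2))\<^sup>2 - 3) / 4) \<le> 2 * exp (- real n)" by simp
qed

text \<open>The cube of half-side r / sqrt n lies in the ball of radius r, where each point is
  missed with probability at most 2 exp (-n). Fubini bounds the expected uncovered volume, and
  Markov's inequality leaves half of the cube covered.\<close>

lemma chull_volume_prob_many_points:
  assumes n: "1 \<le> n" and N: "46656 * n \<le> N"
  defines "r \<equiv> sqrt (ln (real N / real n) / 2)"
  shows "\<exists>A\<in>sets (gauss_space n N). emeasure (gauss_space n N) (space (gauss_space n N) - A) \<le> ennreal (4 * exp (- real n)) \<and>
    (\<forall>w\<in>A. ennreal ((r / sqrt (real n)) ^ n) \<le> emeasure (lebesgue_n n) (chull n {1..N} w))"
proof -
  let ?G = "gauss_space n N" and ?L = "lebesgue_n n"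
  interpret P: pair_sigma_finite ?G ?L by (rule pair_space[OF n]) (use N in auto)
  define b where "b = r / sqrt (real n)"
  have r: "r > 0" using sample_density_bound(2)[OF n N] by (simp add: r_def)
  have b: "b > 0" using r n by (simp add: b_def)
  define Q where "Q = (PiE {..<n} (\<lambda>_. {-b..b}) :: (nat \<Rightarrow> real) set)"
  have Q: "Q \<in> sets ?L" unfolding Q_def by (rule sets_box) simp
  define V where "V = (2 * b) ^ n"
  have V: "V > 0" using b by (simp add: V_def)
  have vQ: "emeasure ?L Q = ennreal V"
    unfolding Q_def lebesgue_n_def using b by (subst lborel_product.emeasure_PiM) (auto simp: V_def ennreal_power)
  have Qr: "sqnorm_n n x \<le> r\<^sup>2" if "x \<in> Q" for x
  proof -
    have "sqnorm_n n x \<le> (\<Sum>k<n. b\<^sup>2)" unfolding sqnorm_n_def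
    proof (rule sum_mono)
      fix k assume "k \<in> {..<n}"
      then have "\<bar>x k\<bar> \<le> b" using that by (force simp: Q_def PiE_iff)
      then have "\<bar>x k\<bar>\<^sup>2 \<le> b\<^sup>2" by (intro power_mono) auto
      then show "(x k)\<^sup>2 \<le> b\<^sup>2" by simp
    qed
    also have "\<dots> = r\<^sup>2" using n by (simp add: b_def power_divide)
    finally show ?thesis .
  qed
  define u where "u = (\<lambda>w. \<integral>\<^sup>+x. indicator Q x * indicator {x. x \<notin> chull n {1..N} w} x \<partial>?L)"
  have kernel: "(\<lambda>(w, x). indicator Q x * indicator {x. x \<notin> chull n {1..N} w} x :: ennreal) \<in> borel_measurable (?G \<Otimes>\<^sub>M ?L)"
  proof -
    define S where "S = {z\<in>space (?G \<Otimes>\<^sub>M ?L). snd z \<in> chull n {1..N} (fst z)}"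
    have comp: "(\<lambda>w. w i k) \<in> borel_measurable ?G" if "i \<in> {1..N}" "k < n" for i k
      unfolding gauss_space_eq by (rule measurable_PiM_gauss_n_component) (use that in auto)
    have S: "S \<in> sets (?G \<Otimes>\<^sub>M ?L)" unfolding S_def
      by (intro sets_mem_chull measurable_compose[OF measurable_fst comp] measurable_snd) auto
    have "(\<lambda>z. indicator Q (snd z) * indicator (space (?G \<Otimes>\<^sub>M ?L) - S) z :: ennreal) \<in> borel_measurable (?G \<Otimes>\<^sub>M ?L)"
      using S Q by (intro borel_measurable_times_ennreal measurable_compose[OF measurable_snd] borel_measurable_indicator) auto
    moreover have "(indicator Q (snd z) * indicator (space (?G \<Otimes>\<^sub>M ?L) - S) z :: ennreal)
        = indicator Q (snd z) * indicator {x. x \<notin> chull n {1..N} (fst z)} (snd z)" if "z \<in> space (?G \<Otimes>\<^sub>M ?L)" for z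
      using that by (auto simp: indicator_def S_def)
    ultimately show ?thesis unfolding case_prod_unfold by (subst (asm) measurable_cong) auto
  qed
  have um [measurable]: "u \<in> borel_measurable ?G" unfolding u_def
    by (rule sigma_finite_measure.borel_measurable_nn_integral[OF sigma_finite_lebesgue_n kernel])
  have "(\<integral>\<^sup>+w. u w \<partial>?G) = (\<integral>\<^sup>+x. (\<integral>\<^sup>+w. indicator Q x * indicator {x. x \<notin> chull n {1..N} w} x \<partial>?G) \<partial>?L)"
    unfolding u_def by (rule P.Fubini'[symmetric]) (rule kernel)
  also have "\<dots> \<le> (\<integral>\<^sup>+x. ennreal (2 * exp (- real n)) * indicator Q x \<partial>?L)"
  proof (rule nn_integral_mono)
    fix x assume x: "x \<in> space ?L"
    have "(\<integral>\<^sup>+w. indicator Q x * indicator {x. x \<notin> chull n {1..N} w} x \<partial>?G)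
        = (\<integral>\<^sup>+w. indicator Q x * indicator {w\<in>space ?G. x \<notin> chull n {1..N} w} w \<partial>?G)"
      by (intro nn_integral_cong) (auto simp: indicator_def)
    also have "\<dots> = indicator Q x * emeasure ?G {w\<in>space ?G. x \<notin> chull n {1..N} w}"
      by (rule nn_integral_cmult_indicator[OF sets_miss])
    also have "\<dots> \<le> ennreal (2 * exp (- real n)) * indicator Q x"
    proof (cases "x \<in> Q")
      case True
      have "emeasure ?G {w\<in>space ?G. x \<notin> chull n {1..N} w} \<le> ennreal (2 ^ n * 2 * exp (- real N * exp (- r\<^sup>2 - 3) / 4))"
        by (rule miss_prob_le[OF n x _ Qr[OF True]]) (use r in simp)
      also have "\<dots> \<le> ennreal (2 * exp (- real n))"
        unfolding r_def by (intro ennreal_leI sample_density_bound(1)[OF n N])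
      finally show ?thesis using True by simp
    qed simp
    finally show "(\<integral>\<^sup>+w. indicator Q x * indicator {x. x \<notin> chull n {1..N} w} x \<partial>?G) \<le> ennreal (2 * exp (- real n)) * indicator Q x" .
  qed
  also have "\<dots> = ennreal (2 * exp (- real n)) * ennreal V"
    unfolding vQ[symmetric] by (rule nn_integral_cmult_indicator[OF Q])
  also have "\<dots> = ennreal (2 * exp (- real n) * V)" using V by (intro ennreal_mult[symmetric]) auto
  finally have Eu: "(\<integral>\<^sup>+w. u w \<partial>?G) \<le> ennreal (2 * exp (- real n) * V)" .
  define A where "A = {w\<in>space ?G. u w \<le> ennreal (V / 2)}"
  have A: "A \<in> sets ?G" unfolding A_def by measurable
  have "space ?G - A = {w\<in>space ?G. ennreal (V / 2) < u w}" by (auto simp: A_def not_le)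
  then have "emeasure ?G (space ?G - A) \<le> ennreal (2 * exp (- real n) * V / (V / 2))"
    using Markov_strict[OF um Eu, of "V / 2"] V by simp
  also have "2 * exp (- real n) * V / (V / 2) = 4 * exp (- real n)" using V by (simp add: field_simps)
  finally have pA: "emeasure ?G (space ?G - A) \<le> ennreal (4 * exp (- real n))" .
  have vol: "ennreal (b ^ n) \<le> emeasure ?L (chull n {1..N} w)" if w: "w \<in> A" for w
  proof -
    let ?K = "chull n {1..N} w"
    have K: "?K \<in> sets ?L" by (rule sets_chull) simp
    have "ennreal V = (\<integral>\<^sup>+x. indicator Q x \<partial>?L)" using Q vQ by simp
    also have "\<dots> \<le> (\<integral>\<^sup>+x. indicator ?K x + indicator Q x * indicator {x. x \<notin> ?K} x \<partial>?L)"
      by (intro nn_integral_mono) (auto simp: indicator_def)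
    also have "\<dots> = emeasure ?L ?K + u w"
    proof -
      have "(\<lambda>x. indicator Q x * indicator {x. x \<notin> ?K} x :: ennreal) \<in> borel_measurable ?L"
      proof (subst measurable_cong)
        show "(indicator Q x * indicator {x. x \<notin> ?K} x :: ennreal) = indicator Q x * indicator (space ?L - ?K) x" if "x \<in> space ?L" for x
          using that by (auto simp: indicator_def)
        show "(\<lambda>x. indicator Q x * indicator (space ?L - ?K) x :: ennreal) \<in> borel_measurable ?L"
          using Q K by (intro borel_measurable_times_ennreal borel_measurable_indicator) auto
      qed
      then show ?thesis unfolding u_def using K by (subst nn_integral_add) auto
    qed
    also have "\<dots> \<le> emeasure ?L ?K + ennreal (V / 2)" using w by (intro add_left_mono) (simp add: A_def)
    finally have le: "ennreal V \<le> emeasure ?L ?K + ennreal (V / 2)" .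
    \<comment> \<open>The cube has volume (2 b) ^ n, so for n \<ge> 1 half of it is still at least b
      ^ n; no constant is lost.\<close>
    have "b ^ n \<le> V / 2"
    proof -
      have "(2::real) \<le> 2 ^ n" using n power_increasing[of 1 n "2::real"] by simp
      then have "2 * b ^ n \<le> 2 ^ n * b ^ n" using b by (intro mult_right_mono) auto
      then show ?thesis by (simp add: V_def power_mult_distrib)
    qed
    moreover have "ennreal (V / 2) \<le> emeasure ?L ?K"
    proof (cases "emeasure ?L ?K")
      case (real a)
      have "ennreal V \<le> ennreal (a + V / 2)" using le V real(1) unfolding real(2) by (subst ennreal_plus) auto
      then have "V \<le> a + V / 2" using V real(1) by (subst (asm) ennreal_le_iff) auto
      then show ?thesis unfolding real(2) by (intro ennreal_leI) simp
    qed simp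
    ultimately show ?thesis by (meson ennreal_leI order_trans)
  qed
  show ?thesis using A pA vol by (auto simp: b_def)
qed

section \<open>Isotropic constants of the random polytopes\<close>

lemma det_n_identity: "det_n n (\<lambda>i j. if i = j then 1 else 0) = 1"
proof -
  have "(\<Prod>i<n. if i = p i then 1 else (0::real)) = (if p = id then 1 else 0)" if p: "p permutes {..<n}" for p
  proof (cases "p = id")
    case False
    then obtain i where "p i \<noteq> i" by (auto simp: fun_eq_iff)
    moreover from this have "i \<in> {..<n}" using p by (metis permutes_not_in)
    ultimately have "(\<Prod>i<n. if i = p i then 1 else (0::real)) = 0"
      by (intro prod_zero bexI[of _ i]) auto
    then show ?thesis using False by simp
  qed simp
  then have "det_n n (\<lambda>i j. if i = j then 1 else 0) = (\<Sum>p | p permutes {..<n}. if p = id then of_int (sign p) else 0)"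
    unfolding det_n_def by (intro sum.cong refl) auto
  also have "\<dots> = 1" using finite_permutations[of "{..<n}"] permutes_id[of "{..<n}"]
    by (simp add: sum.delta' sign_id)
  finally show ?thesis .
qed

text \<open>Evaluates the infimum at the identity map. The normalising power of the volume m splits
  as m times m to the power 2 / n, and the second factor is at least V^2.\<close>

lemma isotropic_const_le:
  assumes n: "1 \<le> n" and K: "K \<in> sets (lebesgue_n n)" "emeasure (lebesgue_n n) K < \<infinity>"
    and M: "0 \<le> M" "(\<integral>\<^sup>+x. ennreal (sqnorm_n n x) * indicator K x \<partial>lebesgue_n n) \<le> ennreal M * emeasure (lebesgue_n n) K"
    and V: "0 < V" "ennreal (V ^ n) \<le> emeasure (lebesgue_n n) K"
  shows "0 < measure (lebesgue_n n) K" "isotropic_const n K \<le> sqrt (M / V\<^sup>2 / real n)"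
proof -
  let ?L = "lebesgue_n n"
  define m where "m = measure ?L K"
  have em: "emeasure ?L K = ennreal m" unfolding m_def using K(2) by (intro emeasure_eq_ennreal_measure) auto
  have Vm: "V ^ n \<le> m" using V unfolding em by (simp add: ennreal_le_iff m_def)
  have m: "0 < m" using Vm V zero_less_power[of V n] by linarith
  then show "0 < measure ?L K" by (simp add: m_def)
  define I where "I = (\<lambda>i j::nat. if i = j then 1 else (0::real))"
  define F where "F = (\<lambda>Ab. (LINT x:K|?L. sqnorm_n n (aff_n n (fst Ab) (snd Ab) x)) / m powr (1 + 2 / real n))"
  have Fnn: "0 \<le> F Ab" for Ab unfolding F_def set_lebesgue_integral_def
    by (intro divide_nonneg_nonneg integral_nonneg_AE) auto
  have "F (I, \<lambda>_. 0) \<le> M / V\<^sup>2"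
  proof -
    have aff: "sqnorm_n n (aff_n n I (\<lambda>_. 0) x) = sqnorm_n n x" for x
      by (rule sqnorm_n_cong) (simp add: aff_n_def I_def if_distrib[of "\<lambda>y. y * _"] cong: if_cong)
    have "(LINT x:K|?L. sqnorm_n n (aff_n n I (\<lambda>_. 0) x)) = (LINT x|?L. sqnorm_n n x * indicator K x)"
      unfolding set_lebesgue_integral_def aff by (simp add: mult.commute)
    also have "\<dots> = enn2real (\<integral>\<^sup>+x. ennreal (sqnorm_n n x * indicator K x) \<partial>?L)"
      using K by (intro integral_eq_nn_integral) auto
    also have "(\<integral>\<^sup>+x. ennreal (sqnorm_n n x * indicator K x) \<partial>?L) = (\<integral>\<^sup>+x. ennreal (sqnorm_n n x) * indicator K x \<partial>?L)"
      by (intro nn_integral_cong) (auto simp: indicator_def)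
    also have "enn2real \<dots> \<le> enn2real (ennreal (M * m))"
    proof (rule enn2real_mono)
      show "(\<integral>\<^sup>+x. ennreal (sqnorm_n n x) * indicator K x \<partial>?L) \<le> ennreal (M * m)"
        using M m unfolding em by (simp add: ennreal_mult)
    qed simp
    also have "\<dots> = M * m" using M m by simp
    finally have num: "(LINT x:K|?L. sqnorm_n n (aff_n n I (\<lambda>_. 0) x)) \<le> M * m" .
    have den: "m * V\<^sup>2 \<le> m powr (1 + 2 / real n)"
    proof -
      have "(V ^ n) powr (2 / real n) = (V powr real n) powr (2 / real n)" using V by (simp only: powr_realpow)
      also have "\<dots> = V powr (real n * (2 / real n))" by (rule powr_powr)
      also have "real n * (2 / real n) = real 2" using n by simp
      also have "V powr real 2 = V\<^sup>2" using V by (simp only: powr_realpow)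
      finally have "V\<^sup>2 = (V ^ n) powr (2 / real n)" by (rule sym)
      also have "\<dots> \<le> m powr (2 / real n)" using Vm V by (intro powr_mono2) auto
      finally show ?thesis using m by (simp add: powr_add)
    qed
    have "F (I, \<lambda>_. 0) \<le> (M * m) / m powr (1 + 2 / real n)"
      unfolding F_def fst_conv snd_conv using num by (intro divide_right_mono) auto
    also have "\<dots> \<le> (M * m) / (m * V\<^sup>2)"
      using den M m V by (intro divide_left_mono) auto
    also have "\<dots> = M / V\<^sup>2" using m by simp
    finally show ?thesis .
  qed
  \<comment> \<open>An infimum of reals lies below each value only if the family is bounded below;
    here 0 is a bound.\<close>
  moreover have "(INF Ab \<in> {(A, b). \<bar>det_n n A\<bar> = 1}. F Ab) \<le> F (I, \<lambda>_. 0)"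
    by (rule cINF_lower) (auto intro!: bdd_belowI2[of _ 0] Fnn simp: I_def det_n_identity)
  ultimately have "(INF Ab \<in> {(A, b). \<bar>det_n n A\<bar> = 1}. F Ab) / real n \<le> M / V\<^sup>2 / real n"
    by (intro divide_right_mono) auto
  then show "isotropic_const n K \<le> sqrt (M / V\<^sup>2 / real n)"
    unfolding isotropic_const_def F_def m_def by (rule real_sqrt_le_mono)
qed

section \<open>Convex hulls as sets of convex combinations\<close>

lemma conv_n_eq_chull:
  assumes I: "finite I" and v: "\<And>i. i \<in> I \<Longrightarrow> v i \<in> space (lebesgue_n n)"
  shows "conv_n n (v ` I) = chull n I v"
proof
  let ?cvx = "\<lambda>C. \<forall>x\<in>C. \<forall>y\<in>C. \<forall>t\<in>{0..1::real}. restrict (\<lambda>k. (1 - t) * x k + t * y k) {..<n} \<in> C"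
  show "conv_n n (v ` I) \<subseteq> chull n I v" unfolding conv_n_def
  proof (rule Inter_lower, intro CollectI conjI ballI)
    show "v ` I \<subseteq> chull n I v"
    proof
      fix x assume "x \<in> v ` I"
      then obtain j where j: "j \<in> I" "x = v j" by auto
      let ?c = "\<lambda>i. if i = j then 1 else (0::real)"
      have "?c \<in> weights I" using j I by (simp add: weights_def)
      moreover have "x = lincomb n I ?c v"
        using j I v[OF j(1)] by (auto simp: lincomb_def fun_eq_iff if_distrib[of "\<lambda>y. y * _"] space_lebesgue_n PiE_iff extensional_def cong: if_cong)
      ultimately show "x \<in> chull n I v" by (auto simp: chull_def)
    qed
    show "chull n I v \<subseteq> PiE {..<n} (\<lambda>_. UNIV)"
      unfolding space_lebesgue_n[symmetric] by (auto simp: chull_def)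
    fix x y t assume "x \<in> chull n I v" "y \<in> chull n I v" and t: "t \<in> {0..1::real}"
    then obtain c d where c: "c \<in> weights I" "x = lincomb n I c v" and d: "d \<in> weights I" "y = lincomb n I d v"
      by (auto simp: chull_def)
    let ?e = "\<lambda>i. (1 - t) * c i + t * d i"
    have "?e \<in> weights I" using c(1) d(1) t by (auto simp: weights_def sum.distrib sum_distrib_left[symmetric])
    moreover have "restrict (\<lambda>k. (1 - t) * x k + t * y k) {..<n} = lincomb n I ?e v"
      unfolding c(2) d(2) by (auto simp: lincomb_def fun_eq_iff distrib_right sum.distrib sum_distrib_left mult.assoc)
    ultimately show "restrict (\<lambda>k. (1 - t) * x k + t * y k) {..<n} \<in> chull n I v" by (auto simp: chull_def)
  qed
  show "chull n I v \<subseteq> conv_n n (v ` I)" unfolding conv_n_def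
  proof (rule Inter_greatest, elim CollectE conjE)
    fix C assume C: "v ` I \<subseteq> C" "?cvx C"
    \<comment> \<open>Adds one vertex at a time: with weight t < 1 on the new vertex the others are
      rescaled by 1 / (1 - t); for t = 1 all other weights vanish.\<close>
    have "lincomb n J c v \<in> C" if "finite J" "J \<subseteq> I" "c \<in> weights J" for J c
      using that
    proof (induction J arbitrary: c rule: finite_induct)
      case empty then show ?case by (simp add: weights_def)
    next
      case (insert j J)
      define t where "t = c j"
      have s: "t + (\<Sum>i\<in>J. c i) = 1" "0 \<le> t" "\<And>i. i \<in> J \<Longrightarrow> 0 \<le> c i"
        using insert by (auto simp: weights_def t_def)
      have vj: "v j \<in> C" using C insert by auto
      show ?case
      proof (cases "t = 1")
        case True
        then have "\<forall>i\<in>J. c i = 0" using s insert.hyps by (simp add: sum_nonneg_eq_0_iff)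
        then have "lincomb n (insert j J) c v = v j"
          using True insert v[of j] by (auto simp: lincomb_def fun_eq_iff t_def space_lebesgue_n PiE_iff extensional_def)
        then show ?thesis using vj by simp
      next
        case False
        have t1: "t < 1" using False s sum_nonneg[of J c] by auto
        define d where "d = (\<lambda>i. c i / (1 - t))"
        have "d \<in> weights J" using s t1 by (auto simp: weights_def d_def sum_divide_distrib[symmetric])
        then have x: "lincomb n J d v \<in> C" using insert by auto
        have "restrict (\<lambda>k. (1 - t) * lincomb n J d v k + t * v j k) {..<n} \<in> C"
          using C(2) x vj s t1 by auto
        also have "restrict (\<lambda>k. (1 - t) * lincomb n J d v k + t * v j k) {..<n} = lincomb n (insert j J) c v"
        proof -
          have "(1 - t) * (\<Sum>i\<in>J. d i * v i k) = (\<Sum>i\<in>J. c i * v i k)" for k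
            using t1 by (simp add: d_def sum_distrib_left)
          then show ?thesis using insert.hyps by (auto simp: lincomb_def fun_eq_iff t_def)
        qed
        finally show ?thesis .
      qed
    qed
    then show "chull n I v \<subseteq> C" using I by (auto simp: chull_def)
  qed
qed

text \<open>Indexing by pairs keeps the two signs of a sample point apart as indices, so that the
  symmetric body is again a hull of an indexed family.\<close>

definition sym_points :: "nat \<Rightarrow> (nat \<Rightarrow> nat \<Rightarrow> real) \<Rightarrow> nat \<times> bool \<Rightarrow> nat \<Rightarrow> real" where
  "sym_points n w = (\<lambda>(i, s). if s then w i else vneg n (w i))"

lemma sym_points_image:
  "(\<lambda>i. w i) ` {1..N} \<union> (\<lambda>i. vneg n (w i)) ` {1..N} = sym_points n w ` ({1..N} \<times> UNIV)"
proof (intro equalityI subsetI)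
  fix x assume "x \<in> (\<lambda>i. w i) ` {1..N} \<union> (\<lambda>i. vneg n (w i)) ` {1..N}"
  then consider i where "i \<in> {1..N}" "x = w i" | i where "i \<in> {1..N}" "x = vneg n (w i)" by blast
  then show "x \<in> sym_points n w ` ({1..N} \<times> UNIV)"
  proof cases
    case 1 then show ?thesis by (intro image_eqI[of _ _ "(fst (i, True), True)"]) (auto simp: sym_points_def)
  next
    case 2 then show ?thesis by (intro image_eqI[of _ _ "(fst (i, True), False)"]) (auto simp: sym_points_def)
  qed
qed (auto simp: sym_points_def)

lemma vertex_moment_le:
  assumes n: "1 \<le> n" and R: "0 \<le> R" "sqnorm_n n (lincomb n B (\<lambda>_. 1) v) \<le> 4 * R" "(\<Sum>i\<in>B. sqnorm_n n (v i)) \<le> 8 * R"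
  shows "vertex_moment n B v \<le> 12 * R / (real n)\<^sup>2"
proof -
  have "vertex_moment n B v \<le> 12 * R / ((real n + 1) * (real n + 2))"
    unfolding vertex_moment_def using R by (intro divide_right_mono) auto
  also have "\<dots> \<le> 12 * R / (real n)\<^sup>2"
    using n R unfolding power2_eq_square by (intro divide_left_mono mult_mono) auto
  finally show ?thesis .
qed

lemma vertex_moment_points:
  assumes n: "1 \<le> n" and w: "subset_sums_bounded n N R w" and R: "0 \<le> R" and B: "B \<subseteq> {0..N}" "card B = Suc n"
  shows "vertex_moment n B w \<le> 12 * R / (real n)\<^sup>2"
proof (rule vertex_moment_le[OF n R])
  have B': "B \<subseteq> {..N}" using B by auto
  have "sqnorm_n n (lincomb n B (\<lambda>_. 1) w) \<le> R" using w B B' unfolding subset_sums_bounded_def by auto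
  then show "sqnorm_n n (lincomb n B (\<lambda>_. 1) w) \<le> 4 * R" using R by linarith
  show "(\<Sum>i\<in>B. sqnorm_n n (w i)) \<le> 8 * R" using sum_sqnorm_le[OF w B'] B R by auto
qed

text \<open>Split the chosen vertices by sign; each part consists of at most n + 1 samples. The
  vertex sum is a difference of two subset sums, at most 4 R in square, and each part adds at most 4
  R of squared norms.\<close>

lemma vertex_moment_sym_points:
  assumes n: "1 \<le> n" and w: "subset_sums_bounded n N R w" and R: "0 \<le> R" and B: "B \<subseteq> {1..N} \<times> UNIV" "card B = Suc n"
  shows "vertex_moment n B (sym_points n w) \<le> 12 * R / (real n)\<^sup>2"
proof (rule vertex_moment_le[OF n R])
  have finB: "finite B" using B(1) finite_subset[of B "{1..N} \<times> (UNIV :: bool set)"] by simp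
  define P where "P = (\<lambda>s. {i. (i, s) \<in> B})"
  have PN: "P s \<subseteq> {..N}" for s using B by (auto simp: P_def)
  have finP: "finite (P s)" for s using PN finite_subset by blast
  have inj: "inj_on (\<lambda>i. (i, s)) (P s)" for s by (auto simp: inj_on_def)
  have card: "card (P s) \<le> Suc n" for s
  proof -
    have "(\<lambda>i. (i, s)) ` P s \<subseteq> B" by (auto simp: P_def)
    from card_mono[OF finB this] show ?thesis using B by (simp add: card_image[OF inj])
  qed
  have Bdec: "B = (\<lambda>i. (i, True)) ` P True \<union> (\<lambda>i. (i, False)) ` P False"
  proof (intro equalityI subsetI)
    fix z assume z: "z \<in> B"
    obtain i s where "z = (i, s)" by (cases z)
    then show "z \<in> (\<lambda>i. (i, True)) ` P True \<union> (\<lambda>i. (i, False)) ` P False" using z by (cases s) (auto simp: P_def)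
  qed (auto simp: P_def)
  have sumB: "(\<Sum>z\<in>B. f z) = (\<Sum>i\<in>P True. f (i, True)) + (\<Sum>i\<in>P False. f (i, False))" for f :: "_ \<Rightarrow> real"
  proof -
    have "(\<Sum>z\<in>B. f z) = (\<Sum>z\<in>(\<lambda>i. (i, True)) ` P True. f z) + (\<Sum>z\<in>(\<lambda>i. (i, False)) ` P False. f z)"
      by (subst Bdec, rule sum.union_disjoint) (use finP in auto)
    then show ?thesis by (simp add: sum.reindex[OF inj])
  qed
  have bd: "sqnorm_n n (lincomb n (P s) (\<lambda>_. 1) w) \<le> R" for s
    using w PN card unfolding subset_sums_bounded_def by blast
  have "sqnorm_n n (lincomb n B (\<lambda>_. 1) (sym_points n w))
      = sqnorm_n n (\<lambda>k. lincomb n (P True) (\<lambda>_. 1) w k - lincomb n (P False) (\<lambda>_. 1) w k)"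
    by (rule sqnorm_n_cong) (simp add: lincomb_def sumB sym_points_def vneg_def sum_negf)
  also have "\<dots> \<le> 2 * sqnorm_n n (lincomb n (P True) (\<lambda>_. 1) w) + 2 * sqnorm_n n (lincomb n (P False) (\<lambda>_. 1) w)"
    by (rule sqnorm_n_diff_le)
  also have "\<dots> \<le> 4 * R" using bd[of True] bd[of False] by linarith
  finally show "sqnorm_n n (lincomb n B (\<lambda>_. 1) (sym_points n w)) \<le> 4 * R" .
  have neg: "sqnorm_n n (vneg n y) = sqnorm_n n y" for y by (simp add: sqnorm_n_def vneg_def)
  have "(\<Sum>i\<in>P s. sqnorm_n n (w i)) \<le> 4 * R" for s by (rule sum_sqnorm_le[OF w PN card])
  from this[of True] this[of False] show "(\<Sum>z\<in>B. sqnorm_n n (sym_points n w z)) \<le> 8 * R"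
    unfolding sumB by (simp add: sym_points_def neg)
qed

section \<open>Simplices contained in the two bodies\<close>

lemma simplex_in_points:
  assumes n: "1 \<le> n" "n \<le> N" and c: "c \<in> corner n"
  shows "(\<lambda>k\<in>{..<n}. w 0 k + lincomb n {..<n} c (edges 1 w) k) \<in> chull n {0..N} w"
proof -
  have c': "\<And>j. j < n \<Longrightarrow> 0 \<le> c j" "(\<Sum>j<n. c j) \<le> 1" using c by (auto simp: corner_def)
  define d where "d = (\<lambda>i. if i = 0 then 1 - (\<Sum>j<n. c j) else if i \<le> n then c (i - 1) else 0)"
  have sum_d: "(\<Sum>i\<in>{0..N}. d i * f i) = (1 - (\<Sum>j<n. c j)) * f 0 + (\<Sum>j<n. c j * f (Suc j))" for f :: "nat \<Rightarrow> real"
  proof -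
    have "(\<Sum>i\<in>{0..N}. d i * f i) = (\<Sum>i\<le>n. d i * f i)"
      using n by (intro sum.mono_neutral_right) (auto simp: d_def)
    also have "\<dots> = d 0 * f 0 + (\<Sum>j<n. d (Suc j) * f (Suc j))"
      unfolding lessThan_Suc_atMost[symmetric] by (rule sum.lessThan_Suc_shift)
    finally show ?thesis by (simp add: d_def)
  qed
  have "0 \<le> d i" for i using c'(1)[of "i - 1"] c'(2) by (auto simp: d_def)
  then have "d \<in> weights {0..N}" using sum_d[of "\<lambda>_. 1"] by (simp add: weights_def)
  moreover have "(\<lambda>k\<in>{..<n}. w 0 k + lincomb n {..<n} c (edges 1 w) k) = lincomb n {0..N} d w"
    by (auto simp: fun_eq_iff lincomb_def sum_d edges_def algebra_simps sum_subtractf sum_distrib_left)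
  ultimately show ?thesis by (auto simp: chull_def)
qed

text \<open>The base vertex is the origin, which is not a sample point: the leftover weight is
  divided equally between the first sample and its negative, and these two parts cancel.\<close>

lemma simplex_in_sym_points:
  assumes n: "1 \<le> n" "n \<le> N" and c: "c \<in> corner n"
  shows "(\<lambda>k\<in>{..<n}. 0 + lincomb n {..<n} c (edges 0 w) k) \<in> chull n ({1..N} \<times> UNIV) (sym_points n w)"
proof -
  have c': "\<And>j. j < n \<Longrightarrow> 0 \<le> c j" "(\<Sum>j<n. c j) \<le> 1" using c by (auto simp: corner_def)
  define e where "e = (1 - (\<Sum>j<n. c j)) / 2"
  define d where "d = (\<lambda>(i::nat, s). (if s \<and> i \<le> n then c (i - 1) else 0) + (if i = 1 then e else 0))"
  have sum_d: "(\<Sum>z\<in>{1..N} \<times> UNIV. d z * f z) = (\<Sum>j<n. c j * f (Suc j, True)) + e * (f (1, True) + f (1, False))" for f :: "nat \<times> bool \<Rightarrow> real"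
  proof -
    have "(\<Sum>z\<in>{1..N} \<times> UNIV. d z * f z) = (\<Sum>i\<in>{1..N}. \<Sum>s\<in>UNIV. d (i, s) * f (i, s))"
      by (simp add: sum.cartesian_product)
    also have "\<dots> = (\<Sum>i\<in>{1..N}. (if i \<le> n then c (i - 1) * f (i, True) else 0) + (if i = 1 then e * (f (1, True) + f (1, False)) else 0))"
      by (intro sum.cong refl) (auto simp: d_def UNIV_bool algebra_simps)
    also have "\<dots> = (\<Sum>i\<in>{1..N}. if i \<le> n then c (i - 1) * f (i, True) else 0) + e * (f (1, True) + f (1, False))"
      using n by (simp add: sum.distrib)
    also have "(\<Sum>i\<in>{1..N}. if i \<le> n then c (i - 1) * f (i, True) else 0) = (\<Sum>i\<in>Suc ` {..<n}. c (i - 1) * f (i, True))"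
    proof (rule sum.mono_neutral_cong_right)
      show "\<forall>i\<in>{1..N} - Suc ` {..<n}. (if i \<le> n then c (i - 1) * f (i, True) else 0) = 0"
      proof
        fix i assume i: "i \<in> {1..N} - Suc ` {..<n}"
        have "\<not> i \<le> n"
        proof
          assume "i \<le> n"
          then have "i = Suc (i - 1)" "i - 1 \<in> {..<n}" using i by auto
          then show False using i by blast
        qed
        then show "(if i \<le> n then c (i - 1) * f (i, True) else 0) = 0" by simp
      qed
    qed (use n in auto)
    also have "\<dots> = (\<Sum>j<n. c j * f (Suc j, True))" by (simp add: sum.reindex)
    finally show ?thesis .
  qed
  have "0 \<le> d z" if "z \<in> {1..N} \<times> UNIV" for z
    using that c'(1)[of "fst z - 1"] c'(2) by (cases z) (auto simp: d_def e_def)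
  then have "d \<in> weights ({1..N} \<times> UNIV)" using sum_d[of "\<lambda>_. 1"] by (simp add: weights_def e_def field_simps)
  moreover have "(\<lambda>k\<in>{..<n}. 0 + lincomb n {..<n} c (edges 0 w) k) = lincomb n ({1..N} \<times> UNIV) d (sym_points n w)"
  proof -
    have "(\<Sum>z\<in>{1..N} \<times> UNIV. d z * sym_points n w z k) = (\<Sum>j<n. c j * w (Suc j) k)" if "k < n" for k
      unfolding sum_d using that by (simp add: sym_points_def vneg_def)
    then show ?thesis by (auto simp: fun_eq_iff lincomb_def edges_def simp del: One_nat_def)
  qed
  ultimately show ?thesis by (auto simp: chull_def)
qed

lemma chull_sub_sym_points: "chull n {1..N} w \<subseteq> chull n ({1..N} \<times> UNIV) (sym_points n w)"
proof -
  have b: "bij_betw (\<lambda>i. (i, True)) {1..N} ({1..N} \<times> {True})" by (auto simp: bij_betw_def inj_on_def)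
  have "chull n {1..N} w = chull n ({1..N} \<times> {True}) (sym_points n w)"
    unfolding chull_reindex[OF b] by (simp add: sym_points_def)
  also have "\<dots> \<subseteq> chull n ({1..N} \<times> UNIV) (sym_points n w)" by (rule chull_mono) auto
  finally show ?thesis .
qed

lemma chull_isotropic_const_le:
  assumes n: "1 \<le> n" and I: "finite I" and R: "0 \<le> R"
    and mom: "\<And>B. B \<subseteq> I \<Longrightarrow> card B = Suc n \<Longrightarrow> vertex_moment n B v \<le> 12 * R / (real n)\<^sup>2"
    and V: "0 < V" "ennreal (V ^ n) \<le> emeasure (lebesgue_n n) (chull n I v)"
  shows "0 < measure (lebesgue_n n) (chull n I v)"
    "isotropic_const n (chull n I v) \<le> sqrt (12 * R / (real n)\<^sup>2 / V\<^sup>2 / real n)"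
proof -
  have le: "(\<integral>\<^sup>+x. ennreal (sqnorm_n n x) * indicator (chull n I v) x \<partial>lebesgue_n n)
      \<le> ennreal (12 * R / (real n)\<^sup>2) * emeasure (lebesgue_n n) (chull n I v)"
    by (rule chull_second_moment_le[OF I mom])
  have M: "0 \<le> 12 * R / (real n)\<^sup>2" using R by simp
  show "0 < measure (lebesgue_n n) (chull n I v)"
    "isotropic_const n (chull n I v) \<le> sqrt (12 * R / (real n)\<^sup>2 / V\<^sup>2 / real n)"
    by (rule isotropic_const_le[OF n sets_chull[OF I] emeasure_chull_finite[OF I] M le V])+
qed

text \<open>One V per regime, with the ratio of moment bound to n V^2 controlled by a common
  constant, the sum of the bounds of both regimes. For many points V^2 is proportional to L / n;
  otherwise L is at most ln 46656 and V is of order 1 / sqrt n.\<close>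

lemma volume_event:
  assumes n: "1 \<le> n" "n \<le> N"
  defines "L \<equiv> ln (real N / real n)"
  shows "\<exists>A V. A \<in> sets (gauss_space n N) \<and> 0 < V \<and>
    emeasure (gauss_space n N) (space (gauss_space n N) - A) \<le> ennreal (4 * exp (- real n)) \<and>
    12 * ((real n)\<^sup>2 * (16 * L + 32)) / (real n)\<^sup>2 / V\<^sup>2 / real n \<le> 12 * (16 * ln 46656 + 32) * 960\<^sup>2 + 1152 \<and>
    (\<forall>w\<in>A. ennreal (V ^ n) \<le> emeasure (lebesgue_n n) (chull n {0..N} w) \<and>
      ennreal (V ^ n) \<le> emeasure (lebesgue_n n) (chull n ({1..N} \<times> UNIV) (sym_points n w)))"
proof (cases "46656 * n \<le> N")
  case True
  define r where "r = sqrt (L / 2)"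
  have L: "1 \<le> L" unfolding L_def by (rule sample_density_bound(2)[OF n(1) True])
  obtain A where A: "A \<in> sets (gauss_space n N)" "emeasure (gauss_space n N) (space (gauss_space n N) - A) \<le> ennreal (4 * exp (- real n))"
    "\<And>w. w \<in> A \<Longrightarrow> ennreal ((r / sqrt (real n)) ^ n) \<le> emeasure (lebesgue_n n) (chull n {1..N} w)"
    using chull_volume_prob_many_points[OF n(1) True] unfolding r_def L_def by blast
  define V where "V = r / sqrt (real n)"
  have V: "0 < V" using L n by (simp add: V_def r_def)
  have "12 * ((real n)\<^sup>2 * (16 * L + 32)) / (real n)\<^sup>2 / V\<^sup>2 / real n = 24 * (16 * L + 32) / L"
    using n L by (simp add: V_def r_def power_divide field_simps)
  \<comment> \<open>1152 = 24 (16 + 32), using L \<ge> 1 to absorb the additive 32.\<close>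
  also have "\<dots> \<le> 1152" using L by (simp add: field_simps)
  also have "\<dots> \<le> 12 * (16 * ln 46656 + 32) * 960\<^sup>2 + 1152" by simp
  finally have num: "12 * ((real n)\<^sup>2 * (16 * L + 32)) / (real n)\<^sup>2 / V\<^sup>2 / real n \<le> 12 * (16 * ln 46656 + 32) * 960\<^sup>2 + 1152" .
  have "ennreal (V ^ n) \<le> emeasure (lebesgue_n n) (chull n {0..N} w)"
    "ennreal (V ^ n) \<le> emeasure (lebesgue_n n) (chull n ({1..N} \<times> UNIV) (sym_points n w))" if w: "w \<in> A" for w
  proof -
    have "ennreal (V ^ n) \<le> emeasure (lebesgue_n n) (chull n {1..N} w)" unfolding V_def by (rule A(3)[OF w])
    also have "\<dots> \<le> emeasure (lebesgue_n n) (chull n {0..N} w)"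
      by (intro emeasure_mono chull_mono sets_chull) auto
    finally show "ennreal (V ^ n) \<le> emeasure (lebesgue_n n) (chull n {0..N} w)" .
    have "ennreal (V ^ n) \<le> emeasure (lebesgue_n n) (chull n {1..N} w)" unfolding V_def by (rule A(3)[OF w])
    also have "\<dots> \<le> emeasure (lebesgue_n n) (chull n ({1..N} \<times> UNIV) (sym_points n w))"
      by (intro emeasure_mono chull_sub_sym_points sets_chull) auto
    finally show "ennreal (V ^ n) \<le> emeasure (lebesgue_n n) (chull n ({1..N} \<times> UNIV) (sym_points n w))" .
  qed
  then show ?thesis using A V num by blast
next
  case False
  let ?G = "gauss_space n N"
  define V where "V = 1 / (960 * sqrt (real n))"
  have V: "0 < V" using n by (simp add: V_def)
  obtain A1 where A1: "A1 \<in> sets ?G" "emeasure ?G (space ?G - A1) \<le> ennreal (2 * exp (- real n))"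
    "\<forall>w\<in>A1. \<forall>p. \<forall>K\<in>sets (lebesgue_n n). (\<forall>c\<in>corner n. (\<lambda>k\<in>{..<n}. p k + lincomb n {..<n} c (edges 1 w) k) \<in> K) \<longrightarrow>
      ennreal (V ^ n) \<le> emeasure (lebesgue_n n) K"
    using simplex_volume_prob[OF n, of 1] unfolding V_def by (elim bexE conjE)
  obtain A2 where A2: "A2 \<in> sets ?G" "emeasure ?G (space ?G - A2) \<le> ennreal (2 * exp (- real n))"
    "\<forall>w\<in>A2. \<forall>p. \<forall>K\<in>sets (lebesgue_n n). (\<forall>c\<in>corner n. (\<lambda>k\<in>{..<n}. p k + lincomb n {..<n} c (edges 0 w) k) \<in> K) \<longrightarrow>
      ennreal (V ^ n) \<le> emeasure (lebesgue_n n) K"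
    using simplex_volume_prob[OF n, of 0] unfolding V_def by (elim bexE conjE)
  have "emeasure ?G (space ?G - A1 \<inter> A2) \<le> emeasure ?G ((space ?G - A1) \<union> (space ?G - A2))"
    using A1(1) A2(1) by (intro emeasure_mono) auto
  also have "\<dots> \<le> emeasure ?G (space ?G - A1) + emeasure ?G (space ?G - A2)"
    using A1(1) A2(1) by (intro emeasure_subadditive) auto
  also have "\<dots> \<le> ennreal (2 * exp (- real n)) + ennreal (2 * exp (- real n))"
    by (intro add_mono A1(2) A2(2))
  also have "\<dots> = ennreal (4 * exp (- real n))" by (subst ennreal_plus[symmetric]) auto
  finally have prob: "emeasure ?G (space ?G - A1 \<inter> A2) \<le> ennreal (4 * exp (- real n))" .
  have "L \<le> ln 46656" unfolding L_def
  proof (rule ln_mono)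
    have "real N \<le> real (46656 * n)" using False by (intro of_nat_mono) simp
    then show "real N / real n \<le> 46656" using n by (simp add: field_simps)
  qed (use n in auto)
  then have "12 * (16 * L + 32) * 960\<^sup>2 \<le> 12 * (16 * ln 46656 + 32) * 960\<^sup>2" by simp
  moreover have "12 * ((real n)\<^sup>2 * (16 * L + 32)) / (real n)\<^sup>2 / V\<^sup>2 / real n = 12 * (16 * L + 32) * 960\<^sup>2"
    using n by (simp add: V_def power_divide power_mult_distrib field_simps)
  ultimately have num: "12 * ((real n)\<^sup>2 * (16 * L + 32)) / (real n)\<^sup>2 / V\<^sup>2 / real n \<le> 12 * (16 * ln 46656 + 32) * 960\<^sup>2 + 1152"
    by linarith
  have v1: "ennreal (V ^ n) \<le> emeasure (lebesgue_n n) (chull n {0..N} w)" if w: "w \<in> A1 \<inter> A2" for w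
  proof (rule A1(3)[rule_format, of w "chull n {0..N} w" "w 0"])
    show "chull n {0..N} w \<in> sets (lebesgue_n n)" by (rule sets_chull) simp
  qed (use w simplex_in_points[OF n] in auto)
  have v2: "ennreal (V ^ n) \<le> emeasure (lebesgue_n n) (chull n ({1..N} \<times> UNIV) (sym_points n w))" if w: "w \<in> A1 \<inter> A2" for w
  proof (rule A2(3)[rule_format, of w _ "\<lambda>_. 0"])
    show "chull n ({1..N} \<times> UNIV) (sym_points n w) \<in> sets (lebesgue_n n)" by (rule sets_chull) simp
    show "(\<lambda>k\<in>{..<n}. 0 + lincomb n {..<n} c (edges 0 w) k) \<in> chull n ({1..N} \<times> UNIV) (sym_points n w)" if "c \<in> corner n" for c
      by (rule simplex_in_sym_points[OF n that])
  qed (use w in simp)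
  show ?thesis
  proof (intro exI[of _ "A1 \<inter> A2"] exI[of _ V] conjI ballI)
    show "A1 \<inter> A2 \<in> sets ?G" using A1(1) A2(1) by auto
  qed (use V prob num v1 v2 in auto)
qed

theorem theorem1p1:
  "\<exists>C c :: real. C > 0 \<and> c > 0 \<and>
    (\<forall>n N :: nat. 1 \<le> n \<longrightarrow> n \<le> N \<longrightarrow>
      (\<exists>A \<in> sets (gauss_space n N).
         A \<subseteq> {\<omega> \<in> space (gauss_space n N).
                 measure (lebesgue_n n) (conv_n n ((\<lambda>i. \<omega> i) ` {0..N})) > 0 \<and>
                 measure (lebesgue_n n) (conv_n n ((\<lambda>i. \<omega> i) ` {1..N} \<union> (\<lambda>i. vneg n (\<omega> i)) ` {1..N})) > 0 \<and>
                 isotropic_const n (conv_n n ((\<lambda>i. \<omega> i) ` {0..N})) < C \<and>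
                 isotropic_const n (conv_n n ((\<lambda>i. \<omega> i) ` {1..N} \<union> (\<lambda>i. vneg n (\<omega> i)) ` {1..N})) < C} \<and>
         measure (gauss_space n N) A > 1 - C * exp (- c * real n)))"
proof -
  define b :: real where "b = 12 * (16 * ln 46656 + 32) * 960\<^sup>2 + 1152"
  have b: "b \<ge> 0" by (simp add: b_def)
  \<comment> \<open>One constant for two purposes: C exceeds sqrt b, which makes the isotropic bound
    strict, and C > 5 covers the failure probabilities 4 exp (-n) for the volumes and exp (-n) for
    the subset sums.\<close>
  define C where "C = sqrt b + 6"
  have C: "C > 5" "sqrt b < C" unfolding C_def using real_sqrt_ge_zero[OF b] by linarith+
  have main: "\<exists>A \<in> sets (gauss_space n N).
         A \<subseteq> {\<omega> \<in> space (gauss_space n N).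
                 measure (lebesgue_n n) (conv_n n ((\<lambda>i. \<omega> i) ` {0..N})) > 0 \<and>
                 measure (lebesgue_n n) (conv_n n ((\<lambda>i. \<omega> i) ` {1..N} \<union> (\<lambda>i. vneg n (\<omega> i)) ` {1..N})) > 0 \<and>
                 isotropic_const n (conv_n n ((\<lambda>i. \<omega> i) ` {0..N})) < C \<and>
                 isotropic_const n (conv_n n ((\<lambda>i. \<omega> i) ` {1..N} \<union> (\<lambda>i. vneg n (\<omega> i)) ` {1..N})) < C} \<and>
         measure (gauss_space n N) A > 1 - C * exp (- 1 * real n)"
    if n: "1 \<le> n" "n \<le> N" for n N
  proof -
    let ?G = "gauss_space n N"
    interpret G: prob_space ?G by (rule prob_space_gauss_space)
    define R where "R = (real n)\<^sup>2 * (16 * ln (real N / real n) + 32)"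
    have R: "0 \<le> R" using n by (simp add: R_def)
    obtain A0 V where A0: "A0 \<in> sets ?G" "emeasure ?G (space ?G - A0) \<le> ennreal (4 * exp (- real n))"
      and V: "0 < V" "12 * R / (real n)\<^sup>2 / V\<^sup>2 / real n \<le> b"
      and vol: "\<And>w. w \<in> A0 \<Longrightarrow> ennreal (V ^ n) \<le> emeasure (lebesgue_n n) (chull n {0..N} w)"
        "\<And>w. w \<in> A0 \<Longrightarrow> ennreal (V ^ n) \<le> emeasure (lebesgue_n n) (chull n ({1..N} \<times> UNIV) (sym_points n w))"
      using volume_event[OF n] unfolding R_def b_def by blast
    define S where "S = {w\<in>space ?G. subset_sums_bounded n N R w}"
    have S: "S \<in> sets ?G" unfolding S_def R_def by (rule subset_sums_bounded_prob(1)[OF n])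
    define A where "A = A0 \<inter> S"
    have A: "A \<in> sets ?G" using A0 S by (auto simp: A_def)
    have Ssp: "space ?G - S = {w\<in>space ?G. \<not> subset_sums_bounded n N R w}" by (auto simp: S_def)
    have "measure ?G (space ?G - A) \<le> measure ?G ((space ?G - A0) \<union> (space ?G - S))"
      using A0 S by (intro G.finite_measure_mono) (auto simp: A_def)
    also have "\<dots> \<le> measure ?G (space ?G - A0) + measure ?G (space ?G - S)"
      using A0 S by (intro measure_Un_le) auto
    also have "\<dots> \<le> 4 * exp (- real n) + exp (- real n)"
    proof (rule add_mono)
      show "measure ?G (space ?G - A0) \<le> 4 * exp (- real n)" using A0(2) by (simp add: G.emeasure_eq_measure)
      show "measure ?G (space ?G - S) \<le> exp (- real n)"
        unfolding Ssp R_def by (rule subset_sums_bounded_prob(2)[OF n])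
    qed
    also have "\<dots> < C * exp (- real n)" using C by simp
    finally have "1 - measure ?G A < C * exp (- 1 * real n)" using G.prob_compl[OF A] by simp
    moreover have "A \<subseteq> {\<omega> \<in> space ?G.
                 measure (lebesgue_n n) (conv_n n ((\<lambda>i. \<omega> i) ` {0..N})) > 0 \<and>
                 measure (lebesgue_n n) (conv_n n ((\<lambda>i. \<omega> i) ` {1..N} \<union> (\<lambda>i. vneg n (\<omega> i)) ` {1..N})) > 0 \<and>
                 isotropic_const n (conv_n n ((\<lambda>i. \<omega> i) ` {0..N})) < C \<and>
                 isotropic_const n (conv_n n ((\<lambda>i. \<omega> i) ` {1..N} \<union> (\<lambda>i. vneg n (\<omega> i)) ` {1..N})) < C}"
    proof
      fix w assume w: "w \<in> A"
      then have wsp: "w \<in> space ?G" and wS: "subset_sums_bounded n N R w" and w0: "w \<in> A0" by (auto simp: A_def S_def)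
      have wi: "w i \<in> space (lebesgue_n n)" if "i \<le> N" for i
        using wsp that by (auto simp: gauss_space_eq space_PiM PiE_iff space_gauss_n)
      have K: "conv_n n ((\<lambda>i. w i) ` {0..N}) = chull n {0..N} w"
        by (rule conv_n_eq_chull) (use wi in auto)
      have neg: "vneg n y \<in> space (lebesgue_n n)" for y by (simp add: vneg_def space_lebesgue_n)
      have T: "conv_n n ((\<lambda>i. w i) ` {1..N} \<union> (\<lambda>i. vneg n (w i)) ` {1..N}) = chull n ({1..N} \<times> UNIV) (sym_points n w)"
        unfolding sym_points_image by (rule conv_n_eq_chull) (use wi neg in \<open>auto simp: sym_points_def\<close>)
      have bnd: "sqrt (12 * R / (real n)\<^sup>2 / V\<^sup>2 / real n) < C"
        using real_sqrt_le_mono[OF V(2)] C(2) by linarith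
      have mK: "vertex_moment n B w \<le> 12 * R / (real n)\<^sup>2" if "B \<subseteq> {0..N}" "card B = Suc n" for B
        by (rule vertex_moment_points[OF n(1) wS R that])
      have mT: "vertex_moment n B (sym_points n w) \<le> 12 * R / (real n)\<^sup>2" if "B \<subseteq> {1..N} \<times> UNIV" "card B = Suc n" for B
        by (rule vertex_moment_sym_points[OF n(1) wS R that])
      have fin: "finite {0..N}" "finite ({1..N} \<times> (UNIV :: bool set))" by simp_all
      have Kb: "0 < measure (lebesgue_n n) (chull n {0..N} w)"
        "isotropic_const n (chull n {0..N} w) \<le> sqrt (12 * R / (real n)\<^sup>2 / V\<^sup>2 / real n)"
        by (rule chull_isotropic_const_le[OF n(1) fin(1) R mK V(1) vol(1)[OF w0]]; assumption)+
      have Tb: "0 < measure (lebesgue_n n) (chull n ({1..N} \<times> UNIV) (sym_points n w))"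
        "isotropic_const n (chull n ({1..N} \<times> UNIV) (sym_points n w)) \<le> sqrt (12 * R / (real n)\<^sup>2 / V\<^sup>2 / real n)"
        by (rule chull_isotropic_const_le[OF n(1) fin(2) R mT V(1) vol(2)[OF w0]]; assumption)+
      show "w \<in> {\<omega> \<in> space ?G.
                 measure (lebesgue_n n) (conv_n n ((\<lambda>i. \<omega> i) ` {0..N})) > 0 \<and>
                 measure (lebesgue_n n) (conv_n n ((\<lambda>i. \<omega> i) ` {1..N} \<union> (\<lambda>i. vneg n (\<omega> i)) ` {1..N})) > 0 \<and>
                 isotropic_const n (conv_n n ((\<lambda>i. \<omega> i) ` {0..N})) < C \<and>
                 isotropic_const n (conv_n n ((\<lambda>i. \<omega> i) ` {1..N} \<union> (\<lambda>i. vneg n (\<omega> i)) ` {1..N})) < C}"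
        unfolding mem_Collect_eq K T
        by (intro conjI wsp Kb(1) Tb(1) le_less_trans[OF Kb(2) bnd] le_less_trans[OF Tb(2) bnd])
    qed
    ultimately show ?thesis using A by (intro bexI[of _ A] conjI) auto
  qed
  show ?thesis
    by (rule exI[of _ C], rule exI[of _ 1], intro conjI allI impI, use C in simp, simp, rule main)
qed

end
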